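(* Let $\mathfrak{F}$ be a non-empty hereditary saturated formation of finite groups with $\mathfrak{F}\subseteq\mathfrak{L}_a(1)$. A finite group $G$ belongs to $\mathfrak{F}$ if and only if $\pi(G)\subseteq\pi(\mathfrak{F})$ and every Sylow subgroup of $G$ is strongly $\mathrm{K}$-$\mathfrak{F}$-subnormal in $G$.
   Context: All groups are finite; classes of groups are closed under isomorphism. For a group $G$, $\pi(G)$ is the set of prime divisors of $|G|$; for a class of groups $\mathfrak{F}$, $\pi(\mathfrak{F})=\bigcup_{G\in\mathfrak{F}}\pi(G)$. A class $\mathfrak{F}$ is a formation if (i) $G\in\mathfrak{F}$ and $N\trianglelefteq G$ imply $G/N\in\mathfrak{F}$, and (ii) $N_1,N_2\trianglelefteq G$ with $G/N_1,G/N_2\in\mathfrak{F}$ imply $G/(N_1\cap N_2)\in\mathfrak{F}$. A formation is hereditary if it contains every subgroup of each of its members, and saturated if $G/\Phi(G)\in\mathfrak{F}$ implies $G\in\mathfrak{F}$, where $\Phi(G)$ is the Frattini subgroup. For a non-empty formation $\mathfrak{F}$, the residual $G^{\mathfrak{F}}$ is the smallest normal subgroup of $G$ with $G/G^{\mathfrak{F}}\in\mathfrak{F}$. $\mathfrak{L}_a(1)$ is the class of all soluble groups $G$ such that the $p$-length $l_p(G)$ is at most $1$ for every prime $p\in\pi(G)$. A subgroup $H\le G$ is $\mathfrak{F}$-subnormal in $G$ if either $H=G$ or there is a chain $H=H_0<H_1<\dots<H_n=G$ in which each $H_{i-1}$ is a maximal subgroup of $H_i$ and $H_i^{\mathfrak{F}}\le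 H_{i-1}$ for $i=1,\dots,n$. A subgroup $H\le G$ is strongly $\mathrm{K}$-$\mathfrak{F}$-subnormal in $G$ if its normalizer $N_G(H)$ is $\mathfrak{F}$-subnormal in $G$. *)

theory Defs
  imports "HOL-Algebra.Group_Action" "HOL-Algebra.Solvable_Groups"
    "HOL-Computational_Algebra.Primes"
begin

text \<open>
  All groups are finite. Every finite group is isomorphic to one whose carrier is a set of natural
  numbers, so an isomorphism-closed class of finite groups is represented by the set of its members
  of type \<^typ>\<open>nat monoid\<close>; \<open>in_class\<close> extends membership to groups over an arbitrary type
  (in particular to quotients, whose elements are cosets). Quantifying over all finite groups of
  type \<^typ>\<open>nat monoid\<close> is therefore quantifying over all finite groups.
\<close>

definition group_class :: "nat monoid set \<Rightarrow> bool" where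
  "group_class F \<longleftrightarrow>
     (\<forall>G\<in>F. group G \<and> finite (carrier G)) \<and>
     (\<forall>G\<in>F. \<forall>H :: nat monoid. group H \<and> G \<cong> H \<longrightarrow> H \<in> F)"

definition in_class :: "('a, 'b) monoid_scheme \<Rightarrow> nat monoid set \<Rightarrow> bool" where
  "in_class G F \<longleftrightarrow> group G \<and> (\<exists>H\<in>F. G \<cong> H)"

lemma in_class_nat:
  fixes G :: "nat monoid"
  assumes "group_class F"
  shows "in_class G F \<longleftrightarrow> G \<in> F"
proof
  assume "in_class G F"
  then obtain H where H: "H \<in> F" "group G" "G \<cong> H"
    unfolding in_class_def by blast
  then have "H \<cong> G"
    using group.iso_sym by blast
  with H assms show "G \<in> F"
    unfolding group_class_def by blast
next
  assume "G \<in> F"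
  then show "in_class G F"
    using assms iso_refl[of G] unfolding in_class_def group_class_def by blast
qed

definition primes_of :: "('a, 'b) monoid_scheme \<Rightarrow> nat set" where
  "primes_of G = {p. prime p \<and> p dvd order G}"

definition class_primes :: "nat monoid set \<Rightarrow> nat set" where
  "class_primes F = (\<Union>G\<in>F. primes_of G)"

definition formation :: "nat monoid set \<Rightarrow> bool" where
  "formation F \<longleftrightarrow> group_class F \<and>
     (\<forall>G\<in>F. \<forall>N. N \<lhd> G \<longrightarrow> in_class (G Mod N) F) \<and>
     (\<forall>(G :: nat monoid) N1 N2. group G \<and> finite (carrier G) \<and> N1 \<lhd> G \<and> N2 \<lhd> G \<and>
        in_class (G Mod N1) F \<and> in_class (G Mod N2) F \<longrightarrow> in_class (G Mod (N1 \<inter> N2)) F)"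

definition hereditary :: "nat monoid set \<Rightarrow> bool" where
  "hereditary F \<longleftrightarrow> (\<forall>G\<in>F. \<forall>H. subgroup H G \<longrightarrow> in_class (G\<lparr>carrier := H\<rparr>) F)"

definition maximal_subgroup :: "'a set \<Rightarrow> ('a, 'b) monoid_scheme \<Rightarrow> bool" where
  "maximal_subgroup M G \<longleftrightarrow> subgroup M G \<and> M \<noteq> carrier G \<and>
     (\<forall>K. subgroup K G \<and> M \<subseteq> K \<longrightarrow> K = M \<or> K = carrier G)"

text \<open>The intersection with the carrier yields \<open>\<Phi>(G) = G\<close> when \<open>G\<close> has no maximal subgroups,
  i.e. for trivial \<open>G\<close>.\<close>

definition frattini :: "('a, 'b) monoid_scheme \<Rightarrow> 'a set" where
  "frattini G = carrier G \<inter> \<Inter>{M. maximal_subgroup M G}"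

definition saturated :: "nat monoid set \<Rightarrow> bool" where
  "saturated F \<longleftrightarrow> (\<forall>G :: nat monoid. group G \<and> finite (carrier G) \<and>
     in_class (G Mod frattini G) F \<longrightarrow> G \<in> F)"

definition residual :: "nat monoid set \<Rightarrow> ('a, 'b) monoid_scheme \<Rightarrow> 'a set" where
  "residual F G = (LEAST N. N \<lhd> G \<and> in_class (G Mod N) F)"

text \<open>\<open>O\<^sub>\<pi>(G)\<close>, the largest normal \<open>\<pi>\<close>-subgroup.\<close>

definition pi_core :: "nat set \<Rightarrow> ('a, 'b) monoid_scheme \<Rightarrow> 'a set" where
  "pi_core \<pi> G = (GREATEST N. N \<lhd> G \<and> (\<forall>q. prime q \<and> q dvd card N \<longrightarrow> q \<in> \<pi>))"

text \<open>The preimage in \<open>G\<close> of \<open>O\<^sub>\<pi>(G/N)\<close>.\<close>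

definition pi_core_above :: "nat set \<Rightarrow> ('a, 'b) monoid_scheme \<Rightarrow> 'a set \<Rightarrow> 'a set" where
  "pi_core_above \<pi> G N = {x \<in> carrier G. N #>\<^bsub>G\<^esub> x \<in> pi_core \<pi> (G Mod N)}"

text \<open>
  The upper \<open>p'p\<close>-series \<open>1 = P\<^sub>0 \<le> N\<^sub>0 \<le> P\<^sub>1 \<le> N\<^sub>1 \<le> \<dots>\<close> of \<open>G\<close> is given by
  \<open>N\<^sub>i/P\<^sub>i = O\<^sub>p\<^sub>'(G/P\<^sub>i)\<close> and \<open>P\<^sub>i\<^sub>+\<^sub>1/N\<^sub>i = O\<^sub>p(G/N\<^sub>i)\<close>. Here \<open>upper_series p G i\<close> is \<open>N\<^sub>i\<close>, and the
  \<open>p\<close>-length is the least \<open>l\<close> with \<open>N\<^sub>l = G\<close>; it is meaningful for \<open>p\<close>-soluble \<open>G\<close>, where such an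
  \<open>l\<close> exists.
\<close>

primrec upper_series :: "nat \<Rightarrow> ('a, 'b) monoid_scheme \<Rightarrow> nat \<Rightarrow> 'a set" where
  "upper_series p G 0 = pi_core (- {p}) G"
| "upper_series p G (Suc i) =
     pi_core_above (- {p}) G (pi_core_above {p} G (upper_series p G i))"

definition p_length :: "nat \<Rightarrow> ('a, 'b) monoid_scheme \<Rightarrow> nat" where
  "p_length p G = (LEAST l. upper_series p G l = carrier G)"

definition L_a1 :: "nat monoid set" where
  "L_a1 = {G. group G \<and> finite (carrier G) \<and> solvable G \<and> (\<forall>p\<in>primes_of G. p_length p G \<le> 1)}"

text \<open>The chain is \<open>C 0, \<dots>, C n\<close>; the case \<open>n = 0\<close> is \<open>H = G\<close>.\<close>

definition F_subnormal ::
  "nat monoid set \<Rightarrow> 'a set \<Rightarrow> ('a, 'b) monoid_scheme \<Rightarrow> bool" where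
  "F_subnormal F H G \<longleftrightarrow> (\<exists>(C :: nat \<Rightarrow> 'a set) n.
     C 0 = H \<and> C n = carrier G \<and> (\<forall>i\<le>n. subgroup (C i) G) \<and>
     (\<forall>i<n. maximal_subgroup (C i) (G\<lparr>carrier := C (Suc i)\<rparr>) \<and>
            residual F (G\<lparr>carrier := C (Suc i)\<rparr>) \<subseteq> C i))"

definition strongly_K_F_subnormal ::
  "nat monoid set \<Rightarrow> 'a set \<Rightarrow> ('a, 'b) monoid_scheme \<Rightarrow> bool" where
  "strongly_K_F_subnormal F H G \<longleftrightarrow> subgroup H G \<and> F_subnormal F (normalizer G H) G"

definition sylow_subgroup :: "nat \<Rightarrow> 'a set \<Rightarrow> ('a, 'b) monoid_scheme \<Rightarrow> bool" where
  "sylow_subgroup p P G \<longleftrightarrow> subgroup P G \<and> card P = p ^ multiplicity p (order G)"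

end

theory Submission
  imports Defs "HOL-Algebra.Multiplicative_Group" "HOL-Algebra.Sylow"
begin

text \<open>
  For the nontrivial direction, a counterexample modulo a maximal normal subgroup not containing the
  residual has a unique minimal normal subgroup \<open>N\<close>, and \<open>G/N\<close> lies in the class. Then \<open>N\<close> is an
  elementary abelian \<open>q\<close>-group and, as the class is saturated, it has a complement \<open>M\<close>, which lies in
  the class and has no nontrivial normal \<open>q\<close>-subgroup.

  Call a function from \<open>M\<close> to the integers modulo \<open>q\<close> tame if it lies in an \<open>M\<close>-submodule whose
  semidirect product with \<open>M\<close> belongs to the class. Tame functions form an algebra: the products
  \<open>u w\<close> of two tame functions are commutators in a Heisenberg group over the ring of functions and lie
  in its Frattini subgroup. Hence, as in the Stone--Weierstrass theorem, every function is tame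
  once the tame functions separate the points of \<open>M\<close>. In that case \<open>G = N M\<close>, which embeds into the
  semidirect product of all functions with \<open>M\<close>, belongs to the class.

  For separation, the stabiliser of the tame functions is a normal subgroup of \<open>M\<close>. Let \<open>p \<noteq> q\<close> be a
  prime, \<open>P\<close> a Sylow \<open>p\<close>-subgroup of \<open>M\<close> and \<open>L\<close> its normaliser in \<open>M\<close>. The chain from the normaliser of
  a Sylow subgroup of \<open>G\<close> shows that \<open>V L/B\<close> belongs to the class for the chief factors \<open>V/B\<close> of \<open>L\<close>
  in \<open>N\<close> that \<open>P\<close> does not centralise, so the functions tame for \<open>L\<close> are moved by \<open>p\<close>-elements.
  As the \<open>p\<close>-length is at most one, \<open>L\<close> supplements a normal \<open>p'\<close>-subgroup of \<open>M\<close>, which carries this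
  over from \<open>L\<close> to \<open>M\<close>. The stabiliser is therefore a normal \<open>q\<close>-subgroup of \<open>M\<close>, that is, trivial.
\<close>

section \<open>Preliminaries on homomorphisms and maximal subgroups\<close>

text \<open>Saturated formations are usually handled through local definitions. Here the stabiliser
  of the tame functions takes over the role of the residual that a local definition attaches to
  \<open>q\<close>. Modules are realised as spaces of functions because a functional \<lambda> on
  \<open>N\<close> sends each n to the function m \<mapsto> \<lambda>(m n m^-1) on \<open>M\<close>;
  all of them then lie in one ring and can be multiplied pointwise. Right translations give the
  module structure, and the commuting left translations make the stabiliser normal. The unit of the
  algebra comes from the trivial module, and this is where \<open>q\<close> has to divide the order
  of a member of the class.

  The hypothesis on normalisers is carried over to quotients, but inside a subgroup only the
  intersection of a given chain with it is available. This is why separation is obtained for the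
  normaliser \<open>L\<close> before it is lifted to \<open>M\<close>.

  Members of the class live on natural numbers, whereas cosets, pairs and Heisenberg groups have
  other types; membership is therefore expressed by homomorphisms into members.\<close>

lemma (in group) inv_cancel_left: "x \<in> carrier G \<Longrightarrow> y \<in> carrier G \<Longrightarrow> inv x \<otimes> (x \<otimes> y) = y"
  by (simp flip: m_assoc)

lemma (in group) cancel_inv_left: "x \<in> carrier G \<Longrightarrow> y \<in> carrier G \<Longrightarrow> x \<otimes> (inv x \<otimes> y) = y"
  by (simp flip: m_assoc)

lemmas (in group) group_simps = m_assoc inv_mult_group inv_cancel_left cancel_inv_left

lemma preimage_subgroup:
  assumes "f \<in> hom G H" "group G" "group H" "subgroup M H"
  shows "subgroup {x \<in> carrier G. f x \<in> M} G"
proof -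
  interpret group_hom G H f using assms by (simp add: group_hom_def group_hom_axioms_def)
  interpret M: subgroup M H by fact
  show ?thesis by (rule G.subgroupI) auto
qed

lemma preimage_normal:
  assumes "f \<in> hom G H" "group G" "group H" "M \<lhd> H"
  shows "{x \<in> carrier G. f x \<in> M} \<lhd> G"
proof -
  interpret group_hom G H f using assms by (simp add: group_hom_def group_hom_axioms_def)
  interpret M: normal M H by fact
  show ?thesis
    by (rule G.normal_invI)
      (use preimage_subgroup[OF assms(1-3) M.subgroup_axioms] in \<open>auto simp: M.inv_op_closed2\<close>)
qed

lemma normal_subset: "N \<lhd> G \<Longrightarrow> N \<subseteq> carrier G"
  by (simp add: normal_imp_subgroup subgroup.subset)

lemma maximal_subgroup_subgroup: "maximal_subgroup M G \<Longrightarrow> subgroup M G"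
  by (simp add: maximal_subgroup_def)

text \<open>Serves twice: with a conjugation for \<open>f\<close> it makes the Frattini subgroup
  normal, and with an isomorphism onto a copy on natural numbers it carries saturation over to other
  types.\<close>

lemma maximal_subgroup_preimage:
  assumes f: "f \<in> iso G H" and G: "group G" and H: "group H" and M: "maximal_subgroup M H"
  shows "maximal_subgroup {x \<in> carrier G. f x \<in> M} G"
proof -
  have fh: "f \<in> hom G H" and surj: "f ` carrier G = carrier H" and inj: "inj_on f (carrier G)"
    using f by (auto simp: iso_iff)
  interpret group_hom G H f using fh G H by (simp add: group_hom_def group_hom_axioms_def)
  have sM: "subgroup M H" and nM: "M \<noteq> carrier H"
    and mM: "\<And>K. subgroup K H \<Longrightarrow> M \<subseteq> K \<Longrightarrow> K = M \<or> K = carrier H"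
    using M by (auto simp: maximal_subgroup_def)
  let ?P = "{x \<in> carrier G. f x \<in> M}"
  have img: "f ` ?P = M"
  proof
    show "M \<subseteq> f ` ?P"
    proof
      fix y assume "y \<in> M"
      then obtain x where "x \<in> carrier G" "y = f x"
        using surj subgroup.subset[OF sM] by blast
      then show "y \<in> f ` ?P" using \<open>y \<in> M\<close> by blast
    qed
  qed auto
  show ?thesis
    unfolding maximal_subgroup_def
  proof (intro conjI allI impI)
    show "subgroup ?P G" using preimage_subgroup[OF fh G H sM] .
    show "?P \<noteq> carrier G" using img surj nM by metis
    fix K assume K: "subgroup K G \<and> ?P \<subseteq> K"
    have "subgroup (f ` K) H" using subgroup_img_is_subgroup K by simp
    moreover have "M \<subseteq> f ` K" using image_mono[of ?P K f] K unfolding img by simp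
    ultimately have "f ` K = M \<or> f ` K = carrier H" by (rule mM)
    then have "f ` K = f ` ?P \<or> f ` K = f ` carrier G" using img surj by simp
    then show "K = ?P \<or> K = carrier G"
      using inj_on_image_eq_iff[OF inj, of K ?P] inj_on_image_eq_iff[OF inj, of K "carrier G"]
        subgroup.subset[OF conjunct1[OF K]] by (metis (no_types, lifting) mem_Collect_eq order_refl subsetI)
  qed
qed

lemma (in group) conjugation_iso:
  assumes "g \<in> carrier G"
  shows "(\<lambda>x. g \<otimes> x \<otimes> inv g) \<in> iso G G"
proof -
  have "bij_betw (\<lambda>x. g \<otimes> x \<otimes> inv g) (carrier G) (carrier G)"
    by (rule bij_betw_byWitness[where f' = "\<lambda>x. inv g \<otimes> x \<otimes> g"])
      (use assms in \<open>auto simp: group_simps\<close>)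
  then show ?thesis
    using assms by (auto simp: iso_def hom_def group_simps)
qed

lemma (in group) frattini_normal: "frattini G \<lhd> G"
proof (rule normal_invI)
  show "subgroup (frattini G) G"
  proof (rule subgroupI)
    have "\<one> \<in> frattini G"
      by (auto simp: frattini_def dest: maximal_subgroup_subgroup intro: subgroup.one_closed)
    then show "frattini G \<noteq> {}" by blast
    fix x assume x: "x \<in> frattini G"
    then show "inv x \<in> frattini G"
      by (auto simp: frattini_def dest: maximal_subgroup_subgroup intro: subgroup.m_inv_closed)
    fix y assume "y \<in> frattini G"
    with x show "x \<otimes> y \<in> frattini G"
      by (auto simp: frattini_def dest: maximal_subgroup_subgroup intro: subgroup.m_closed)
  qed (simp add: frattini_def)
next
  fix g x assume g: "g \<in> carrier G" and x: "x \<in> frattini G"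
  have xc: "x \<in> carrier G" using x by (simp add: frattini_def)
  have "g \<otimes> x \<otimes> inv g \<in> M" if "maximal_subgroup M G" for M
    using x maximal_subgroup_preimage[OF conjugation_iso[OF g] _ _ that]
    by (auto simp: frattini_def)
  then show "g \<otimes> x \<otimes> inv g \<in> frattini G"
    using g xc by (auto simp: frattini_def)
qed

text \<open>\<open>formation\<close> and \<open>saturated\<close> speak about groups of type
  \<open>nat monoid\<close>; a copy of this kind brings their closure properties to finite groups of
  any type.\<close>

lemma ex_nat_copy:
  fixes G (structure)
  assumes G: "group G" and fin: "finite (carrier G)"
  obtains H :: "nat monoid" and f where "group H" "f \<in> iso H G"
proof -
  interpret group G by fact
  obtain b where b: "bij_betw b {0..<card (carrier G)} (carrier G)"
    using ex_bij_betw_nat_finite[OF fin] by blast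
  define c where "c = inv_into {0..<card (carrier G)} b"
  define H where "H = \<lparr>carrier = {0..<card (carrier G)}, monoid.mult = (\<lambda>x y. c (b x \<otimes> b y)), one = c \<one>\<rparr>"
  have bc [simp]: "b (c x) = x" if "x \<in> carrier G" for x
    using b that unfolding c_def by (simp add: bij_betw_inv_into_right)
  have cb [simp]: "c (b x) = x" if "x < card (carrier G)" for x
    using b that unfolding c_def by (simp add: bij_betw_inv_into_left)
  have cc [simp]: "c x < card (carrier G)" if "x \<in> carrier G" for x
    using bij_betw_inv_into[OF b] that unfolding c_def bij_betw_def by fastforce
  have bb [simp]: "b x \<in> carrier G" if "x < card (carrier G)" for x
    using b that unfolding bij_betw_def by auto
  have "group H"
  proof (rule groupI)
    fix x assume "x \<in> carrier H"
    then show "\<exists>y\<in>carrier H. y \<otimes>\<^bsub>H\<^esub> x = \<one>\<^bsub>H\<^esub>"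
      by (intro bexI[of _ "c (inv b x)"]) (auto simp: H_def)
  qed (auto simp: H_def m_assoc)
  moreover have "b \<in> iso H G"
    using b by (auto simp: H_def iso_def hom_def)
  ultimately show thesis using that by blast
qed

lemma iso_inverse:
  assumes "f \<in> iso G H" "group G"
  obtains g where "g \<in> iso H G" "\<And>x. x \<in> carrier G \<Longrightarrow> g (f x) = x" "\<And>y. y \<in> carrier H \<Longrightarrow> f (g y) = y"
proof
  show "inv_into (carrier G) f \<in> iso H G" using group.iso_set_sym[OF assms(2,1)] .
  show "inv_into (carrier G) f (f x) = x" if "x \<in> carrier G" for x
    using assms(1) that by (simp add: iso_iff)
  show "f (inv_into (carrier G) f y) = y" if "y \<in> carrier H" for y
    using assms(1) that by (metis f_inv_into_f iso_iff)
qed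

section \<open>Normal subgroups lying above the residual\<close>

text \<open>\<open>above_residual F G N\<close> says that \<open>N\<close> contains the kernel of a homomorphism from \<open>G\<close> into
  a member of \<open>F\<close>; for a hereditary formation this means that \<open>N\<close> contains the residual of \<open>G\<close>.
  Here \<open>N\<close> need not be a subgroup.\<close>

definition above_residual :: "nat monoid set \<Rightarrow> ('a, 'b) monoid_scheme \<Rightarrow> 'a set \<Rightarrow> bool" where
  "above_residual F G N \<longleftrightarrow>
     (\<exists>Q\<in>F. \<exists>h\<in>hom G Q. \<forall>x\<in>carrier G. h x = \<one>\<^bsub>Q\<^esub> \<longrightarrow> x \<in> N)"

lemma above_residual_mono:
  "above_residual F G N \<Longrightarrow> (\<And>x. x \<in> carrier G \<Longrightarrow> x \<in> N \<Longrightarrow> x \<in> N') \<Longrightarrow> above_residual F G N'"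
  unfolding above_residual_def by blast

lemma above_residual_hom:
  assumes "f \<in> hom G H" "above_residual F H N"
  shows "above_residual F G {x \<in> carrier G. f x \<in> N}"
proof -
  obtain Q h where "Q \<in> F" "h \<in> hom H Q" "\<forall>x\<in>carrier H. h x = \<one>\<^bsub>Q\<^esub> \<longrightarrow> x \<in> N"
    using assms(2) unfolding above_residual_def by blast
  then show ?thesis
    using Group.hom_compose[OF assms(1), of h Q] hom_in_carrier[OF assms(1)]
    unfolding above_residual_def by (intro bexI[of _ Q] bexI[of _ "h \<circ> f"]) auto
qed

lemma above_residual_restrict:
  assumes "above_residual F G N" "K \<subseteq> carrier G"
  shows "above_residual F (G\<lparr>carrier := K\<rparr>) N"
proof -
  have "(\<lambda>x. x) \<in> hom (G\<lparr>carrier := K\<rparr>) G" using assms(2) by (auto simp: hom_def)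
  from above_residual_hom[OF this assms(1)] show ?thesis
    by (rule above_residual_mono) auto
qed

section \<open>Quotients, intersections and saturation for groups of arbitrary type\<close>

locale saturated_formation =
  fixes F :: "nat monoid set"
  assumes nonempty: "F \<noteq> {}" and formation: "formation F"
    and hereditary: "hereditary F" and saturated: "saturated F"
begin

lemma class_F: "group_class F"
  using formation by (simp add: formation_def)

lemma group_F: "Q \<in> F \<Longrightarrow> group Q" and finite_F: "Q \<in> F \<Longrightarrow> finite (carrier Q)"
  using class_F by (auto simp: group_class_def)

lemma in_class_iso:
  assumes "in_class G F" "f \<in> iso H G" "group H"
  shows "in_class H F"
proof -
  obtain Q where "Q \<in> F" "G \<cong> Q" using assms(1) by (auto simp: in_class_def)
  then show ?thesis
    using iso_trans[of H G Q] assms by (auto simp: in_class_def is_iso_def)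
qed

lemma in_class_finite: "in_class G F \<Longrightarrow> finite (carrier G)"
  unfolding in_class_def using finite_F iso_finite by blast

text \<open>A homomorphism with trivial kernel identifies the group with a subgroup of a member, and
  heredity puts that subgroup into the class.\<close>

lemma in_class_above_residual: "in_class G F \<longleftrightarrow> group G \<and> above_residual F G {\<one>\<^bsub>G\<^esub>}"
proof
  assume "in_class G F"
  then obtain Q f where Q: "group G" "Q \<in> F" "f \<in> iso G Q"
    by (auto simp: in_class_def is_iso_def)
  then have "\<forall>x\<in>carrier G. f x = \<one>\<^bsub>Q\<^esub> \<longrightarrow> x \<in> {\<one>\<^bsub>G\<^esub>}"
    using iso_kernel_image[of G Q f] group_F[of Q] by (auto simp: kernel_def)
  then show "group G \<and> above_residual F G {\<one>\<^bsub>G\<^esub>}"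
    using Q by (auto simp: above_residual_def iso_def)
next
  assume A: "group G \<and> above_residual F G {\<one>\<^bsub>G\<^esub>}"
  then obtain Q h where Q: "Q \<in> F" "h \<in> hom G Q" "\<forall>x\<in>carrier G. h x = \<one>\<^bsub>Q\<^esub> \<longrightarrow> x \<in> {\<one>\<^bsub>G\<^esub>}"
    by (auto simp: above_residual_def)
  interpret group_hom G Q h using A Q group_F by (simp add: group_hom_def group_hom_axioms_def)
  have "kernel G Q h = {\<one>\<^bsub>G\<^esub>}" using Q(3) by (auto simp: kernel_def)
  then have "inj_on h (carrier G)" by (rule trivial_ker_imp_inj)
  then have "h \<in> iso G (Q\<lparr>carrier := h ` carrier G\<rparr>)"
    by (auto simp: iso_def bij_betw_def hom_def)
  moreover have "in_class (Q\<lparr>carrier := h ` carrier G\<rparr>) F"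
    using hereditary Q(1) img_is_subgroup by (auto simp: hereditary_def)
  ultimately show "in_class G F" using in_class_iso A by blast
qed

lemma above_residual_carrier: "above_residual F G (carrier G)"
proof -
  obtain Q where "Q \<in> F" using nonempty by blast
  then show ?thesis
    using trivial_hom[OF group_F, of Q G] unfolding above_residual_def by blast
qed

text \<open>Cut \<open>h\<close> down to a surjection \<open>h'\<close> onto a member. Then
  \<open>h'\<close> followed by division by the image of the kernel of \<open>f\<close> is constant
  on the fibres of \<open>f\<close> and factors through \<open>H\<close>. Its kernel on
  \<open>H\<close> consists of the \<open>f x\<close> with \<open>x\<close> in the product of the
  kernels of \<open>f\<close> and \<open>h'\<close>, and the kernel of \<open>h'\<close> lies in
  \<open>N\<close>.\<close>

lemma above_residual_image:
  assumes f: "f \<in> hom G H" and surj: "f ` carrier G = carrier H"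
    and G: "group G" and H: "group H" and N: "above_residual F G N"
  shows "above_residual F H (f ` (N \<inter> carrier G))"
proof -
  interpret f: group_hom G H f using f G H by (simp add: group_hom_def group_hom_axioms_def)
  obtain Q h where Q: "Q \<in> F" "h \<in> hom G Q" "\<forall>x\<in>carrier G. h x = \<one>\<^bsub>Q\<^esub> \<longrightarrow> x \<in> N"
    using N by (auto simp: above_residual_def)
  interpret h: group_hom G Q h using G Q group_F by (simp add: group_hom_def group_hom_axioms_def)
  have "in_class (Q\<lparr>carrier := h ` carrier G\<rparr>) F"
    using hereditary Q(1) h.img_is_subgroup by (auto simp: hereditary_def)
  then obtain Q0 k where Q0: "Q0 \<in> F" "k \<in> iso (Q\<lparr>carrier := h ` carrier G\<rparr>) Q0"
    "group (Q\<lparr>carrier := h ` carrier G\<rparr>)"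
    by (auto simp: in_class_def is_iso_def)
  define h' where "h' = k \<circ> h"
  have h': "h' \<in> hom G Q0" "h' ` carrier G = carrier Q0"
    using Q0(2) Q(2) by (auto simp: h'_def iso_def hom_def bij_betw_def)
  have kone: "k \<one>\<^bsub>Q\<^esub> = \<one>\<^bsub>Q0\<^esub>"
    using hom_one[of k _ Q0] Q0 group_F by (fastforce simp: iso_def)
  have one_mem: "\<one>\<^bsub>Q\<^esub> \<in> h ` carrier G"
    by (metis h.hom_one f.G.one_closed imageI)
  have h'1: "h x = \<one>\<^bsub>Q\<^esub>" if "x \<in> carrier G" "h' x = \<one>\<^bsub>Q0\<^esub>" for x
    using inj_onD[of k "h ` carrier G" "h x" "\<one>\<^bsub>Q\<^esub>"] that Q0(2) kone one_mem
    by (auto simp: h'_def iso_def bij_betw_def)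
  interpret h': group_hom G Q0 h'
    using G Q0 h' group_F by (simp add: group_hom_def group_hom_axioms_def)
  let ?K = "h' ` kernel G H f"
  have nK: "?K \<lhd> Q0"
    using normal.surj_hom_normal_subgroup[OF f.normal_kernel h'.group_hom_axioms h'(2)] .
  interpret K: normal ?K Q0 by fact
  have "in_class (Q0 Mod ?K) F" using formation nK Q0(1) by (auto simp: formation_def)
  then obtain Q1 c where Q1: "Q1 \<in> F" "c \<in> iso (Q0 Mod ?K) Q1"
    by (auto simp: in_class_def is_iso_def)
  define d where "d = (\<lambda>x. c (?K #>\<^bsub>Q0\<^esub> h' x))"
  have d: "d \<in> hom G Q1"
  proof -
    have "c \<circ> ((#>\<^bsub>Q0\<^esub>) ?K \<circ> h') \<in> hom G Q1"
      using Group.hom_compose[OF Group.hom_compose[OF h'(1) K.r_coset_hom_Mod]] Q1(2)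
      by (auto simp: iso_def)
    then show ?thesis by (simp add: d_def comp_def)
  qed
  have coset_eq: "?K #>\<^bsub>Q0\<^esub> h' x = ?K #>\<^bsub>Q0\<^esub> h' y" if "x \<in> carrier G" "y \<in> carrier G" "f x = f y" for x y
  proof -
    have "x \<otimes>\<^bsub>G\<^esub> inv\<^bsub>G\<^esub> y \<in> kernel G H f" using that by (simp add: kernel_def)
    then have "h' x \<otimes>\<^bsub>Q0\<^esub> inv\<^bsub>Q0\<^esub> (h' y) \<in> ?K"
      using that by (metis f.G.inv_closed h'.hom_inv h'.hom_mult imageI)
    then show ?thesis
      using that K.rcos_module_rev[OF h'.H.is_group, of "h' y" "h' x"]
      by (metis h'.H.repr_independence h'.hom_closed K.subgroup_axioms)
  qed
  have deq: "d x = d y" if "x \<in> carrier G" "y \<in> carrier G" "f x = f y" for x y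
    using coset_eq[OF that] by (simp add: d_def)
  define e where "e = (\<lambda>y. d (inv_into (carrier G) f y))"
  have ef: "e (f x) = d x" if "x \<in> carrier G" for x
    unfolding e_def using that
    by (intro deq) (auto intro: inv_into_into f_inv_into_f)
  have e: "e \<in> hom H Q1"
  proof (rule homI)
    fix y assume "y \<in> carrier H"
    then obtain x where "x \<in> carrier G" "y = f x" using surj by blast
    then show "e y \<in> carrier Q1" using ef d by (simp add: hom_in_carrier)
    fix y' assume "y' \<in> carrier H"
    then obtain x' where "x' \<in> carrier G" "y' = f x'" using surj by blast
    then show "e (y \<otimes>\<^bsub>H\<^esub> y') = e y \<otimes>\<^bsub>Q1\<^esub> e y'"
      using \<open>x \<in> carrier G\<close> \<open>y = f x\<close> ef[of "x \<otimes>\<^bsub>G\<^esub> x'"] ef hom_mult[OF d] by simp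
  qed
  have "y \<in> f ` (N \<inter> carrier G)" if y: "y \<in> carrier H" "e y = \<one>\<^bsub>Q1\<^esub>" for y
  proof -
    obtain x where x: "x \<in> carrier G" "y = f x" using surj y by blast
    have "c (?K #>\<^bsub>Q0\<^esub> h' x) = \<one>\<^bsub>Q1\<^esub>" using ef x y by (simp add: d_def)
    moreover have "c ?K = \<one>\<^bsub>Q1\<^esub>"
      using hom_one[of c "Q0 Mod ?K" Q1] Q1 group_F K.factorgroup_is_group by (auto simp: iso_def)
    moreover have "?K #>\<^bsub>Q0\<^esub> h' x \<in> carrier (Q0 Mod ?K)" "?K \<in> carrier (Q0 Mod ?K)"
      using x hom_in_carrier[OF K.r_coset_hom_Mod] group.is_monoid[OF K.factorgroup_is_group]
        monoid.one_closed by (force, fastforce)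
    ultimately have "?K #>\<^bsub>Q0\<^esub> h' x = ?K"
      using Q1(2) inj_onD[of c "carrier (Q0 Mod ?K)"] by (auto simp: iso_def bij_betw_def)
    then have "h' x \<in> ?K"
      using h'.H.rcos_self[OF h'.hom_closed[OF x(1)] K.subgroup_axioms] by simp
    then obtain z where z: "z \<in> carrier G" "f z = \<one>\<^bsub>H\<^esub>" "h' x = h' z" by (auto simp: kernel_def)
    have "h' (x \<otimes>\<^bsub>G\<^esub> inv\<^bsub>G\<^esub> z) = \<one>\<^bsub>Q0\<^esub>" using x z by simp
    then have "x \<otimes>\<^bsub>G\<^esub> inv\<^bsub>G\<^esub> z \<in> N \<inter> carrier G" using h'1 Q(3) x z by simp
    moreover have "y = f (x \<otimes>\<^bsub>G\<^esub> inv\<^bsub>G\<^esub> z)" using x z by simp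
    ultimately show ?thesis by blast
  qed
  then show ?thesis using Q1(1) e unfolding above_residual_def by blast
qed

lemma in_class_image:
  assumes "f \<in> hom G H" "f ` carrier G = carrier H" "group G" "group H"
    "above_residual F G {x \<in> carrier G. f x = \<one>\<^bsub>H\<^esub>}"
  shows "in_class H F"
  using above_residual_mono[OF above_residual_image[OF assms]] assms(4)
  by (auto simp: in_class_above_residual)

lemma in_class_Mod:
  assumes "N \<lhd> G"
  shows "in_class (G Mod N) F \<longleftrightarrow> above_residual F G N"
proof -
  interpret N: normal N G by fact
  have surj: "(#>\<^bsub>G\<^esub>) N ` carrier G = carrier (G Mod N)" by (simp add: carrier_FactGroup)
  have ker: "N #>\<^bsub>G\<^esub> x = N \<longleftrightarrow> x \<in> N" if "x \<in> carrier G" for x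
    using that N.rcos_const[OF N.is_group] N.rcos_self[OF that N.subgroup_axioms] by auto
  show ?thesis
  proof
    assume "in_class (G Mod N) F"
    then have "above_residual F (G Mod N) {\<one>\<^bsub>G Mod N\<^esub>}" by (simp add: in_class_above_residual)
    from above_residual_hom[OF N.r_coset_hom_Mod this] show "above_residual F G N"
      by (rule above_residual_mono) (use ker in auto)
  next
    assume "above_residual F G N"
    then have "above_residual F G {x \<in> carrier G. N #>\<^bsub>G\<^esub> x = \<one>\<^bsub>G Mod N\<^esub>}"
      by (rule above_residual_mono) (use ker in auto)
    then show "in_class (G Mod N) F"
      by (rule in_class_image[OF N.r_coset_hom_Mod surj N.is_group N.factorgroup_is_group])
  qed
qed

text \<open>Both kernels are pulled back to a copy on natural numbers, where closure of the
  formation under intersections applies to them.\<close>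

lemma above_residual_Int:
  assumes G: "group G" and fin: "finite (carrier G)"
    and N: "above_residual F G N" "above_residual F G N'"
  shows "above_residual F G (N \<inter> N')"
proof -
  obtain H :: "nat monoid" and f where H: "group H" "f \<in> iso H G"
    using ex_nat_copy[OF G fin] .
  obtain g where g: "g \<in> iso G H" "\<And>x. x \<in> carrier G \<Longrightarrow> f (g x) = x"
    using iso_inverse[OF H(2,1)] by metis
  have finH: "finite (carrier H)" using H(2) fin by (auto simp: iso_def bij_betw_finite)
  have *: "\<exists>K. K \<lhd> H \<and> in_class (H Mod K) F \<and> (\<forall>x\<in>K. f x \<in> M)" if M: "above_residual F G M" for M
  proof -
    have "above_residual F H {x \<in> carrier H. f x \<in> M}"
      using above_residual_hom[OF _ M] H(2) by (auto simp: iso_def)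
    then obtain Q h where Q: "Q \<in> F" "h \<in> hom H Q" "\<forall>x\<in>carrier H. h x = \<one>\<^bsub>Q\<^esub> \<longrightarrow> f x \<in> M"
      by (auto simp: above_residual_def)
    interpret h: group_hom H Q h using H Q group_F by (simp add: group_hom_def group_hom_axioms_def)
    have "above_residual F H (kernel H Q h)"
      unfolding above_residual_def kernel_def using Q(1,2) by blast
    then show ?thesis
      using Q(3) h.normal_kernel in_class_Mod[OF h.normal_kernel]
      by (intro exI[of _ "kernel H Q h"]) (auto simp: kernel_def)
  qed
  obtain K K' where K: "K \<lhd> H" "in_class (H Mod K) F" "\<forall>x\<in>K. f x \<in> N"
    "K' \<lhd> H" "in_class (H Mod K') F" "\<forall>x\<in>K'. f x \<in> N'"
    using *[OF N(1)] *[OF N(2)] by blast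
  have "in_class (H Mod (K \<inter> K')) F"
    using formation K H(1) finH by (simp add: formation_def)
  then have "above_residual F H (K \<inter> K')"
    using in_class_Mod[OF group.normal_subgroup_intersect[OF H(1) K(1,4)]] by simp
  then have "above_residual F G {x \<in> carrier G. g x \<in> K \<inter> K'}"
    using above_residual_hom[of g G H F "K \<inter> K'"] g by (auto simp: iso_def)
  then show ?thesis
    by (rule above_residual_mono) (use K g(2) in fastforce)
qed

text \<open>An isomorphism matches maximal subgroups, hence Frattini subgroups, so saturation passes
  from the copy on natural numbers to \<open>G\<close>.\<close>

lemma in_class_frattini:
  assumes G: "group G" and fin: "finite (carrier G)" and N: "above_residual F G (frattini G)"
  shows "in_class G F"
proof -
  obtain H :: "nat monoid" and f where H: "group H" "f \<in> iso H G"
    using ex_nat_copy[OF G fin] .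
  obtain g where g: "g \<in> iso G H" "\<And>x. x \<in> carrier G \<Longrightarrow> f (g x) = x"
    using iso_inverse[OF H(2,1)] by metis
  have finH: "finite (carrier H)" using H(2) fin by (auto simp: iso_def bij_betw_finite)
  have "f x \<in> frattini G \<Longrightarrow> x \<in> carrier H \<Longrightarrow> x \<in> M" if M: "maximal_subgroup M H" for x M
  proof -
    assume x: "f x \<in> frattini G" "x \<in> carrier H"
    have "g (f x) \<in> M"
      using maximal_subgroup_preimage[OF g(1) G H(1) M] x by (auto simp: frattini_def)
    moreover have "g (f x) = x"
      using g H(2) x by (metis hom_in_carrier inj_onD iso_iff)
    ultimately show "x \<in> M" by simp
  qed
  then have sub: "x \<in> carrier H \<Longrightarrow> f x \<in> frattini G \<Longrightarrow> x \<in> frattini H" for x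
    by (auto simp: frattini_def)
  have "above_residual F H {x \<in> carrier H. f x \<in> frattini G}"
    using above_residual_hom[OF _ N] H(2) by (auto simp: iso_def)
  then have "above_residual F H (frattini H)"
    by (rule above_residual_mono) (use sub in auto)
  then have "in_class (H Mod frattini H) F"
    using in_class_Mod[OF group.frattini_normal[OF H(1)]] by simp
  then have "H \<in> F" using saturated H(1) finH by (auto simp: saturated_def)
  then show ?thesis
    using G g(1) by (auto simp: in_class_def is_iso_def)
qed

lemma in_class_subgroup:
  assumes "in_class G F" "subgroup H G"
  shows "in_class (G\<lparr>carrier := H\<rparr>) F"
  using assms above_residual_restrict[of F G "{\<one>\<^bsub>G\<^esub>}" H] subgroup.subgroup_is_group[of H G]
    subgroup.subset[of H G]
  by (simp add: in_class_above_residual)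

text \<open>The least element in \<open>residual\<close> is meant with respect to inclusion, so its
  existence has to be shown: a member of the family of least cardinality lies in every other one,
  since the family is closed under intersection.\<close>

lemma residual_above_residual:
  assumes G: "group G" and fin: "finite (carrier G)"
  shows "residual F G \<lhd> G \<and> above_residual F G (residual F G)"
    and "N \<lhd> G \<Longrightarrow> above_residual F G N \<Longrightarrow> residual F G \<subseteq> N"
proof -
  interpret group G by fact
  let ?A = "{N. N \<lhd> G \<and> above_residual F G N}"
  have fA: "finite ?A"
    using finite_subset[of ?A "Pow (carrier G)"] fin normal_subset by blast
  have "carrier G \<in> ?A" using normal_self above_residual_carrier by simp
  then obtain R where R: "R \<in> ?A" "\<And>N. N \<in> ?A \<Longrightarrow> card R \<le> card N"
    using ex_has_least_nat[of "\<lambda>N. N \<in> ?A" "carrier G" card] by blast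
  have R_le: "R \<subseteq> N" if N: "N \<in> ?A" for N
  proof -
    have "R \<inter> N \<in> ?A"
      using R N normal_subgroup_intersect above_residual_Int[OF G fin] by simp
    then have "card R \<le> card (R \<inter> N)" by (rule R(2))
    moreover have "finite R" using R(1) fin normal_subset finite_subset by blast
    ultimately show ?thesis using card_subset_eq[of R "R \<inter> N"] card_mono[of R "R \<inter> N"] by auto
  qed
  have res: "residual F G = R"
    unfolding residual_def
  proof (rule Least_equality)
    show "R \<lhd> G \<and> in_class (G Mod R) F" using R(1) in_class_Mod[of R G] by simp
    show "R \<subseteq> N" if "N \<lhd> G \<and> in_class (G Mod N) F" for N
      using that R_le in_class_Mod[of N G] by simp
  qed
  show "residual F G \<lhd> G \<and> above_residual F G (residual F G)" using res R by simp
  show "residual F G \<subseteq> N" if "N \<lhd> G" "above_residual F G N" using res R_le that by simp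
qed

end

section \<open>Sylow subgroups\<close>

text \<open>An orbit of a p-group has p-power length, so it is a fixed point or has length divisible
  by p.\<close>

lemma card_fixed_points_mod:
  fixes act :: "'a \<Rightarrow> 'c \<Rightarrow> 'c" and Q (structure)
  assumes Q: "group Q" and card_Q: "card (carrier Q) = p ^ n" and p: "prime p" and fin: "finite E"
    and closed: "\<And>g x. g \<in> carrier Q \<Longrightarrow> x \<in> E \<Longrightarrow> act g x \<in> E"
    and act_one: "\<And>x. x \<in> E \<Longrightarrow> act \<one> x = x"
    and act_mult: "\<And>g h x. g \<in> carrier Q \<Longrightarrow> h \<in> carrier Q \<Longrightarrow> x \<in> E \<Longrightarrow> act (g \<otimes> h) x = act g (act h x)"
  shows "card {x \<in> E. \<forall>g\<in>carrier Q. act g x = x} mod p = card E mod p"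
proof -
  interpret Q: group Q by fact
  \<comment> \<open>\<open>Bij\<close> consists of extensional functions, hence the restriction to
    \<open>E\<close>.\<close>
  define \<phi> where "\<phi> = (\<lambda>g. \<lambda>x\<in>E. act g x)"
  have bij: "\<phi> g \<in> Bij E" if g: "g \<in> carrier Q" for g
  proof -
    have "act (inv g) (act g x) = x" "act g (act (inv g) x) = x" if "x \<in> E" for x
      using act_mult[of "inv g" g x] act_mult[of g "inv g" x] g that act_one by simp_all
    then have "bij_betw (act g) E E"
      by (intro bij_betw_byWitness[where f' = "act (inv g)"]) (use g closed in auto)
    then show ?thesis
      by (auto simp: Bij_def \<phi>_def cong: bij_betw_cong)
  qed
  have "\<phi> \<in> hom Q (BijGroup E)"
  proof (rule homI)
    fix g h assume "g \<in> carrier Q" "h \<in> carrier Q"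
    then show "\<phi> (g \<otimes> h) = \<phi> g \<otimes>\<^bsub>BijGroup E\<^esub> \<phi> h"
      using bij closed by (auto simp: BijGroup_def \<phi>_def compose_def act_mult restrict_def fun_eq_iff)
  qed (use bij in \<open>simp add: BijGroup_def\<close>)
  then interpret action: group_action Q E \<phi>
    using group_BijGroup Q by (simp add: group_action_def group_hom_def group_hom_axioms_def)
  define fixed where "fixed = (\<lambda>x. \<forall>g\<in>carrier Q. act g x = x)"
  define f where "f = (\<lambda>x. if fixed x then 1 else 0 :: nat)"
  have orb: "(\<Sum>x\<in>R. f x) mod p = card R mod p" if R: "R \<in> orbits Q E \<phi>" for R
  proof -
    obtain x where x: "x \<in> E" "R = orbit Q \<phi> x" using R by (auto simp: orbits_def)
    have R_eq: "R = {act g x |g. g \<in> carrier Q}" using x by (auto simp: orbit_def \<phi>_def)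
    have xR: "x \<in> R" using action.orbit_refl x by simp
    have finR: "finite R" using R_eq closed x(1) by (intro finite_subset[OF _ fin]) auto
    have "card R dvd p ^ n"
      using action.orbit_stabilizer_theorem[OF x(1)] card_Q x(2) unfolding order_def by (metis dvd_triv_left)
    then obtain k where k: "card R = p ^ k"
      using p by (auto simp: divides_primepow_nat)
    show ?thesis
    proof (cases "k = 0")
      case True
      then have "card R = 1" using k by simp
      then have "R = {x}" using xR by (metis card_1_singletonE singletonD)
      moreover from this have "fixed x" using R_eq by (auto simp: fixed_def)
      ultimately show ?thesis by (simp add: f_def)
    next
      case False
      have "\<not> fixed y" if y: "y \<in> R" for y
      proof
        assume "fixed y"
        moreover have "y \<in> E" using y R_eq closed x by auto
        ultimately have "orbit Q \<phi> y = {y}"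
          using action.orbit_refl[of y] by (auto simp: orbit_def \<phi>_def fixed_def)
        moreover have "x \<in> orbit Q \<phi> y"
          using action.orbit_sym[OF x(1) \<open>y \<in> E\<close>] y x(2) by simp
        ultimately have "y = x" by simp
        then have "R = {x}" using \<open>orbit Q \<phi> y = {y}\<close> x by simp
        then have "card R = 1" by simp
        then show False using k False p by (simp add: prime_nat_iff)
      qed
      then have "(\<Sum>x\<in>R. f x) = 0" by (simp add: f_def)
      moreover have "card R mod p = 0" using k False by simp
      ultimately show ?thesis by simp
    qed
  qed
  have "card E mod p = (\<Sum>R\<in>orbits Q E \<phi>. card R) mod p"
    using action.disjoint_sum[OF fin, of "\<lambda>_. 1::nat"] by simp
  also have "\<dots> = (\<Sum>R\<in>orbits Q E \<phi>. card R mod p) mod p" by (simp add: mod_sum_eq)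
  also have "\<dots> = (\<Sum>R\<in>orbits Q E \<phi>. (\<Sum>x\<in>R. f x) mod p) mod p" using orb by simp
  also have "\<dots> = (\<Sum>R\<in>orbits Q E \<phi>. \<Sum>x\<in>R. f x) mod p" by (simp add: mod_sum_eq)
  also have "\<dots> = (\<Sum>x\<in>E. f x) mod p" using action.disjoint_sum[OF fin, of f] by simp
  also have "(\<Sum>x\<in>E. f x) = card {x \<in> E. fixed x}"
    using fin by (simp add: f_def sum.If_cases Int_def)
  finally show ?thesis by (simp add: fixed_def)
qed

context group
begin

lemma subgroup_finite: "finite (carrier G) \<Longrightarrow> subgroup H G \<Longrightarrow> finite H"
  using finite_subset subgroup.subset by metis

lemma subgroup_card_dvd: "subgroup H G \<Longrightarrow> card H dvd order G"
  using lagrange by (metis dvd_triv_right)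

lemma subgroup_card_dvd_subgroup:
  assumes "subgroup H G" "subgroup K G" "H \<subseteq> K"
  shows "card H dvd card K"
  using group.subgroup_card_dvd[OF subgroup_imp_group[OF assms(2)], of H]
    subgroup_incl[OF assms] by (simp add: order_def)

lemma subgroup_pow_closed: "subgroup H G \<Longrightarrow> x \<in> H \<Longrightarrow> x [^] (n::nat) \<in> H"
  by (induction n) (auto intro: subgroup.m_closed subgroup.one_closed)

lemma subgroup_pow_card:
  assumes "subgroup H G" "finite (carrier G)" "x \<in> H"
  shows "x [^] card H = \<one>"
proof -
  interpret H: group "G\<lparr>carrier := H\<rparr>" by (rule subgroup_imp_group[OF assms(1)])
  show ?thesis
    using H.pow_order_eq_1[of x] subgroup_finite[OF assms(2,1)] assms(3)
    by (simp add: order_def nat_pow_consistent[symmetric])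
qed

lemma cauchy:
  assumes "finite (carrier G)" "prime p" "subgroup H G" "p dvd card H"
  obtains x where "x \<in> H" "x \<noteq> \<one>" "x [^] p = \<one>"
proof -
  interpret H: group "G\<lparr>carrier := H\<rparr>" by (rule subgroup_imp_group[OF assms(3)])
  obtain m where "card H = p ^ 1 * m" using assms(4) by (auto elim: dvdE)
  then obtain K where K: "subgroup K (G\<lparr>carrier := H\<rparr>)" "card K = p"
    using sylow_thm[OF assms(2) H.group_axioms, of 1 m] subgroup_finite[OF assms(1,3)]
    by (auto simp: order_def)
  have KG: "subgroup K G" using incl_subgroup[OF assms(3) K(1)] .
  have "card K > 1" using K(2) prime_gt_1_nat[OF assms(2)] by simp
  then have "K \<noteq> {\<one>}" by auto
  then obtain x where "x \<in> K" "x \<noteq> \<one>" using subgroup.one_closed[OF KG] by blast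
  moreover have "x [^] p = \<one>" using subgroup_pow_card[OF KG assms(1) \<open>x \<in> K\<close>] K(2) by simp
  moreover have "K \<subseteq> H" using subgroup.subset[OF K(1)] by simp
  ultimately show thesis using that by blast
qed

lemma pow_gcd_one:
  assumes "x \<in> carrier G" "x [^] (m::nat) \<in> H" "x [^] (n::nat) \<in> H" "coprime m n" "subgroup H G"
  shows "x \<in> H"
proof -
  interpret H: subgroup H G by fact
  obtain a b :: int where ab: "a * int m + b * int n = 1"
    using assms(4) bezout_int[of "int m" "int n"] by auto
  have "x = x [^] (a * int m + b * int n)" using assms(1) ab by simp
  also have "\<dots> = (x [^] m) [^] a \<otimes> (x [^] n) [^] b"
    using assms(1) by (simp add: int_pow_mult int_pow_pow mult.commute flip: int_pow_int)
  also have "\<dots> \<in> H"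
    using assms(2,3) subgroup_int_pow_closed[OF assms(5)] by blast
  finally show ?thesis .
qed

text \<open>By Cauchy's theorem another prime divisor \<open>r\<close> of the order would give a
  nontrivial element killed both by \<open>r\<close> and by a power of \<open>p\<close>.\<close>

lemma p_group_card:
  assumes "finite (carrier G)" "subgroup H G" "prime p" "\<And>x. x \<in> H \<Longrightarrow> \<exists>k. x [^] (p ^ k) = \<one>"
  obtains n where "card H = p ^ n"
proof -
  have pos: "card H > 0" using assms(1,2) subgroup.finite_imp_card_positive by blast
  then obtain n m where nm: "card H = p ^ n * m" "\<not> p dvd m"
    using multiplicity_decompose'[of "card H" p] assms(3) by (metis neq0_conv not_prime_unit)
  have "m = 1"
  proof (rule ccontr)
    assume "m \<noteq> 1"
    then obtain r where r: "prime r" "r dvd m" using prime_factor_nat by blast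
    then obtain x where x: "x \<in> H" "x \<noteq> \<one>" "x [^] r = \<one>"
      using cauchy[OF assms(1) r(1) assms(2)] nm(1) by (metis dvd_mult)
    obtain k where k: "x [^] (p ^ k) = \<one>" using assms(4) x(1) by blast
    have "r \<noteq> p" using r nm by blast
    then have "coprime (p ^ k) r" using r(1) assms(3) by (simp add: primes_coprime)
    then have "x \<in> {\<one>}"
      using pow_gcd_one[of x "p ^ k" "{\<one>}" r] x k subgroup.mem_carrier[OF assms(2)] triv_subgroup by simp
    then show False using x(2) by simp
  qed
  then show thesis using nm that by simp
qed

end

lemma sylow_subgroup_exists:
  assumes "group G" "finite (carrier G)" "prime p"
  obtains P where "sylow_subgroup p P G"
proof -
  have "order G = p ^ multiplicity p (order G) * (order G div p ^ multiplicity p (order G))"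
    by (simp add: multiplicity_dvd)
  from sylow_thm[OF assms(3,1) this assms(2)] show thesis
    using that by (auto simp: sylow_subgroup_def)
qed

context group
begin

lemma sylow_subgroup_restrict:
  assumes "finite (carrier G)" "prime p" "sylow_subgroup p P G" "subgroup R G" "P \<subseteq> R"
  shows "sylow_subgroup p P (G\<lparr>carrier := R\<rparr>)"
proof -
  have P: "subgroup P G" "card P = p ^ multiplicity p (order G)"
    using assms(3) by (auto simp: sylow_subgroup_def)
  have pos: "card R > 0" "order G > 0"
    using assms(1,4) subgroup.finite_imp_card_positive order_gt_0_iff_finite by blast+
  have "card P dvd card R" using subgroup_card_dvd_subgroup[OF P(1) assms(4,5)] .
  then have "multiplicity p (order G) \<le> multiplicity p (card R)"
    using P(2) pos by (metis multiplicity_geI assms(2) not_prime_unit neq0_conv)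
  moreover have "multiplicity p (card R) \<le> multiplicity p (order G)"
    using subgroup_card_dvd[OF assms(4)] pos by (simp add: dvd_imp_multiplicity_le)
  ultimately show ?thesis
    using P subgroup_incl[OF P(1) assms(4,5)] by (simp add: sylow_subgroup_def order_def)
qed

text \<open>\<open>Q\<close> acts on the right cosets of \<open>P\<close>, whose number is prime to
  \<open>p\<close>, and so fixes some coset P g; this says that g Q g^-1 lies in
  \<open>P\<close>.\<close>

lemma sylow_contains_conjugate:
  assumes fin: "finite (carrier G)" and p: "prime p" and P: "sylow_subgroup p P G"
    and Q: "subgroup Q G" "card Q = p ^ n"
  obtains g where "g \<in> carrier G" "\<And>x. x \<in> Q \<Longrightarrow> g \<otimes> x \<otimes> inv g \<in> P"
proof -
  have P': "subgroup P G" "card P = p ^ multiplicity p (order G)"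
    using P by (auto simp: sylow_subgroup_def)
  interpret P: subgroup P G by fact
  interpret Q: subgroup Q G by fact
  have pos: "order G > 0" using fin order_gt_0_iff_finite by blast
  have ndvd: "\<not> p dvd card (rcosets P)"
  proof
    assume "p dvd card (rcosets P)"
    then have "p ^ Suc (multiplicity p (order G)) dvd order G"
      using lagrange[OF P'(1)] P'(2) by (metis mult_dvd_mono dvd_refl power_Suc)
    then have "Suc (multiplicity p (order G)) \<le> multiplicity p (order G)"
      using pos p by (metis multiplicity_geI not_prime_unit neq0_conv)
    then show False by simp
  qed
  have Qcon: "inv\<^bsub>G\<lparr>carrier := Q\<rparr>\<^esub> x = inv x" if "x \<in> Q" for x
    using m_inv_consistent[OF Q(1) that] .
  \<comment> \<open>The inverse turns right multiplication into a left action.\<close>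
  let ?fix = "{C \<in> rcosets P. \<forall>x\<in>carrier (G\<lparr>carrier := Q\<rparr>). C #> inv x = C}"
  have "card ?fix mod p = card (rcosets P) mod p"
  proof (rule card_fixed_points_mod[where n = n])
    show "finite (rcosets P)" using rcosets_subset_PowG[OF P'(1)] fin finite_subset by blast
  qed (use Q subgroup_imp_group[OF Q(1)] p in
      \<open>auto simp: RCOSETS_def coset_mult_assoc P.subset inv_mult_group m_assoc\<close>)
  then have "?fix \<noteq> {}" using ndvd by (metis card.empty mod_0 mod_eq_0_iff_dvd)
  then obtain g where g: "g \<in> carrier G" "\<forall>x\<in>Q. P #> g #> inv x = P #> g"
    by (auto simp: RCOSETS_def)
  have "g \<otimes> x \<otimes> inv g \<in> P" if x: "x \<in> Q" for x
  proof -
    have "P #> (g \<otimes> x) = P #> g"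
      using g(2)[rule_format, of "inv x"] x g(1) by (simp add: coset_mult_assoc P.subset)
    then have "g \<otimes> x \<in> P #> g" using rcos_self[OF _ P'(1), of "g \<otimes> x"] g x by simp
    then obtain y where "y \<in> P" "g \<otimes> x = y \<otimes> g" by (auto simp: r_coset_def)
    then show ?thesis using g(1) x by (simp add: group_simps)
  qed
  then show thesis using that g(1) by blast
qed

lemma sylow_contains_conjugate_within:
  assumes fin: "finite (carrier G)" and p: "prime p" and P: "sylow_subgroup p P G"
    and R: "subgroup R G" "P \<subseteq> R" and Q: "subgroup Q G" "card Q = p ^ n" "Q \<subseteq> R"
  obtains g where "g \<in> R" "\<And>x. x \<in> Q \<Longrightarrow> g \<otimes> x \<otimes> inv g \<in> P"
proof -
  interpret R: group "G\<lparr>carrier := R\<rparr>" by (rule subgroup_imp_group[OF R(1)])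
  obtain g where g: "g \<in> R" "\<And>x. x \<in> Q \<Longrightarrow> g \<otimes> x \<otimes> inv\<^bsub>G\<lparr>carrier := R\<rparr>\<^esub> g \<in> P"
    using R.sylow_contains_conjugate[OF _ p sylow_subgroup_restrict[OF fin p P R] subgroup_incl[OF Q(1) R(1) Q(3)] Q(2)]
      subgroup_finite[OF fin R(1)] by auto
  then show thesis using that m_inv_consistent[OF R(1)] by simp
qed

lemma conjugate_set_eq:
  assumes "finite P" "P \<subseteq> carrier G" "g \<in> carrier G" "\<And>x. x \<in> P \<Longrightarrow> g \<otimes> x \<otimes> inv g \<in> P"
  shows "(\<lambda>x. g \<otimes> x \<otimes> inv g) ` P = P"
proof (rule endo_inj_surj[OF assms(1)])
  show "inj_on (\<lambda>x. g \<otimes> x \<otimes> inv g) P"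
    using conjugation_iso[OF assms(3)] assms(2) by (auto simp: Group.iso_iff intro: inj_on_subset)
qed (use assms in auto)

text \<open>Conjugation is injective, so on a finite \<open>P\<close> the inclusion of g P g^-1 in
  \<open>P\<close> is already an equality.\<close>

lemma normalizer_eq:
  assumes "finite (carrier G)" "subgroup P G"
  shows "normalizer G P = {g \<in> carrier G. \<forall>x\<in>P. g \<otimes> x \<otimes> inv g \<in> P}"
proof -
  have sub: "P \<subseteq> carrier G" using assms(2) by (rule subgroup.subset)
  have "(g <# P) #> inv g = (\<lambda>x. g \<otimes> x \<otimes> inv g) ` P" for g
    by (auto simp: l_coset_def r_coset_def)
  then have "normalizer G P = {g \<in> carrier G. (\<lambda>x. g \<otimes> x \<otimes> inv g) ` P = P}"
    using sub by (simp add: normalizer_def stabilizer_def)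
  also have "\<dots> = {g \<in> carrier G. \<forall>x\<in>P. g \<otimes> x \<otimes> inv g \<in> P}"
    using conjugate_set_eq[OF subgroup_finite[OF assms] sub] by blast
  finally show ?thesis .
qed

lemma normalizer_subgroup: "P \<subseteq> carrier G \<Longrightarrow> subgroup (normalizer G P) G"
  by (rule normalizer_imp_subgroup)

lemma p_element_generate:
  assumes fin: "finite (carrier G)" and p: "prime p" and y: "y \<in> carrier G" "y [^] (p ^ k) = \<one>"
  obtains n where "card (generate G {y}) = p ^ n"
proof -
  have C: "subgroup (generate G {y}) G" using generate_is_subgroup y(1) by simp
  have "\<exists>k. x [^] (p ^ k) = \<one>" if x: "x \<in> generate G {y}" for x
  proof -
    obtain i :: int where "x = y [^] i" using x generate_pow[OF y(1)] by auto
    then have "x [^] (p ^ k) = (y [^] (p ^ k)) [^] i"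
      using y(1) by (simp add: int_pow_pow mult.commute flip: int_pow_int)
    then show ?thesis using y(2) by auto
  qed
  from p_group_card[OF fin C p this] show thesis using that by blast
qed

lemma p_element_conjugate_in_sylow:
  assumes fin: "finite (carrier G)" and p: "prime p" and P: "sylow_subgroup p P G"
    and y: "y \<in> carrier G" "y [^] (p ^ k) = \<one>"
  obtains g where "g \<in> carrier G" "g \<otimes> y \<otimes> inv g \<in> P"
proof -
  have C: "subgroup (generate G {y}) G" using generate_is_subgroup y(1) by simp
  obtain n where n: "card (generate G {y}) = p ^ n" using p_element_generate[OF fin p y] .
  from sylow_contains_conjugate[OF fin p P C n] show thesis
    using that generate.incl[of y "{y}" G] by blast
qed

text \<open>\<open>P\<close> is a Sylow subgroup of its own normaliser, so an element
  \<open>g\<close> of the normaliser conjugates the cyclic group of \<open>y\<close> into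
  \<open>P\<close>; conjugating back by g^-1 does not leave \<open>P\<close>.\<close>

lemma p_element_normalizing_sylow:
  assumes fin: "finite (carrier G)" and p: "prime p" and P: "sylow_subgroup p P G"
    and y: "y \<in> normalizer G P" "y [^] (p ^ k) = \<one>"
  shows "y \<in> P"
proof -
  have P': "subgroup P G" using P by (simp add: sylow_subgroup_def)
  let ?N = "normalizer G P"
  have N: "subgroup ?N G" using normalizer_subgroup subgroup.subset[OF P'] by blast
  have PN: "P \<subseteq> ?N"
    using P' fin by (auto simp: normalizer_eq intro: subgroup.m_closed subgroup.m_inv_closed subgroup.mem_carrier)
  have yc: "y \<in> carrier G" using y(1) subgroup.mem_carrier[OF N] by blast
  let ?C = "generate G {y}"
  have C: "subgroup ?C G" using generate_is_subgroup yc by simp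
  have CN: "?C \<subseteq> ?N" using generate_subgroup_incl[OF _ N] y(1) by simp
  obtain n where n: "card ?C = p ^ n" using p_element_generate[OF fin p yc y(2)] .
  obtain g where g: "g \<in> ?N" "\<And>x. x \<in> ?C \<Longrightarrow> g \<otimes> x \<otimes> inv g \<in> P"
    using sylow_contains_conjugate_within[OF fin p P N PN C n CN] by blast
  have gc: "g \<in> carrier G" using g(1) subgroup.mem_carrier[OF N] by blast
  have "g \<otimes> y \<otimes> inv g \<in> P" using g(2) generate.incl by (metis insertI1)
  moreover have "inv g \<in> ?N" using subgroup.m_inv_closed[OF N g(1)] .
  ultimately have "inv g \<otimes> (g \<otimes> y \<otimes> inv g) \<otimes> inv (inv g) \<in> P"
    using normalizer_eq[OF fin P'] by blast
  then show ?thesis using gc yc by (simp add: group_simps)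
qed

text \<open>\<open>Y\<close> acts on \<open>N\<close> by conjugation, and the number of fixed points
  is congruent to \<open>card N\<close>, hence to 0, modulo \<open>p\<close>. The identity is one of
  them, so there is another.\<close>

lemma p_group_fixed_point:
  assumes fin: "finite (carrier G)" and p: "prime p" and Y: "subgroup Y G" "card Y = p ^ n"
    and N: "subgroup N G" "card N = p ^ m" "N \<noteq> {\<one>}"
    and norm: "\<And>y x. y \<in> Y \<Longrightarrow> x \<in> N \<Longrightarrow> y \<otimes> x \<otimes> inv y \<in> N"
  obtains z where "z \<in> N" "z \<noteq> \<one>" "\<And>y. y \<in> Y \<Longrightarrow> y \<otimes> z = z \<otimes> y"
proof -
  interpret Y: subgroup Y G by fact
  interpret N: subgroup N G by fact
  let ?fix = "{x \<in> N. \<forall>y\<in>carrier (G\<lparr>carrier := Y\<rparr>). y \<otimes> x \<otimes> inv y = x}"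
  have "card ?fix mod p = card N mod p"
    by (rule card_fixed_points_mod[where n = n])
      (use Y subgroup_imp_group[OF Y(1)] p subgroup_finite[OF fin N(1)] norm in \<open>auto simp: group_simps\<close>)
  moreover have "m \<noteq> 0"
  proof
    assume "m = 0"
    then have "card N = 1" using N(2) by simp
    then show False using N(3) N.one_closed by (metis card_1_singletonE singletonD)
  qed
  ultimately have "p dvd card ?fix" using N(2) by (simp add: mod_eq_0_iff_dvd)
  moreover have one: "\<one> \<in> ?fix" by auto
  moreover have "finite ?fix" using subgroup_finite[OF fin N(1)] by simp
  ultimately have "card ?fix \<noteq> 1" using p by (metis not_prime_unit)
  then have "?fix \<noteq> {\<one>}" by auto
  then obtain z where "z \<in> ?fix" "z \<noteq> \<one>" using one by blast
  moreover have "y \<otimes> z = z \<otimes> y" if "y \<otimes> z \<otimes> inv y = z" "y \<in> Y" "z \<in> N" for y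
    using that by (metis N.mem_carrier Y.mem_carrier inv_solve_right' m_closed)
  ultimately show thesis using that by auto
qed

end

section \<open>Sylow subgroups and their normalisers under surjective homomorphisms\<close>

lemma hom_card:
  assumes "f \<in> hom G H" "group G" "group H"
  shows "card (f ` carrier G) * card (kernel G H f) = order G"
proof -
  interpret group_hom G H f using assms by (simp add: group_hom_def group_hom_axioms_def)
  have ker: "kernel G (H\<lparr>carrier := f ` carrier G\<rparr>) f = kernel G H f"
    by (simp add: kernel_def)
  have "group_hom G (H\<lparr>carrier := f ` carrier G\<rparr>) f"
    using induced_group_hom[OF G.subgroup_self] by simp
  from group_hom.FactGroup_iso_set[OF this]
  have "(\<lambda>X. the_elem (f ` X)) \<in> iso (G Mod kernel G (H\<lparr>carrier := f ` carrier G\<rparr>) f) (H\<lparr>carrier := f ` carrier G\<rparr>)"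
    by simp
  with ker have "(\<lambda>X. the_elem (f ` X)) \<in> iso (G Mod kernel G H f) (H\<lparr>carrier := f ` carrier G\<rparr>)"
    by simp
  then have "card (carrier (G Mod kernel G H f)) = card (f ` carrier G)"
    by (auto simp: iso_def dest: bij_betw_same_card)
  then show ?thesis
    using G.lagrange[OF subgroup_kernel] by (simp add: FactGroup_def)
qed

text \<open>The preimage \<open>R\<close> of the image of \<open>P\<close> contains
  \<open>P\<close>, so \<open>card R\<close> and \<open>order G\<close> have the same p-part;
  dividing both by the order of the kernel shows that the image of \<open>P\<close> has the full
  p-part of \<open>order H\<close>. If \<open>f g\<close> normalises this image, then g P g^-1 is a
  Sylow subgroup of \<open>R\<close>, and conjugating it back to \<open>P\<close> inside
  \<open>R\<close> corrects \<open>g\<close> to an element of \<open>normalizer G P\<close>.\<close>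

lemma sylow_subgroup_image:
  fixes G (structure)
  assumes f: "f \<in> hom G H" and surj: "f ` carrier G = carrier H" and G: "group G" and H: "group H"
    and fin: "finite (carrier G)" and p: "prime p" and P: "sylow_subgroup p P G"
  shows "sylow_subgroup p (f ` P) H" and "normalizer H (f ` P) = f ` normalizer G P"
proof -
  interpret group_hom G H f using f G H by (simp add: group_hom_def group_hom_axioms_def)
  have P': "subgroup P G" "card P = p ^ multiplicity p (order G)"
    using P by (auto simp: sylow_subgroup_def)
  have finH: "finite (carrier H)" using fin surj by (metis finite_imageI)
  have fP: "subgroup (f ` P) H" using subgroup_img_is_subgroup[OF P'(1)] .
  define R where "R = {x \<in> carrier G. f x \<in> f ` P}"
  have R: "subgroup R G" unfolding R_def using preimage_subgroup[OF f G H fP] .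
  have PR: "P \<subseteq> R" using subgroup.subset[OF P'(1)] by (auto simp: R_def)
  have posG: "order G > 0" using fin G.order_gt_0_iff_finite by blast
  have posR: "card R > 0" using subgroup.finite_imp_card_positive[OF R] fin by blast
  have posH: "order H > 0" using finH H.order_gt_0_iff_finite by blast
  have cG: "order H * card (kernel G H f) = order G"
    using hom_card[OF f G H] surj by (simp add: order_def)
  have fR: "f \<in> hom (G\<lparr>carrier := R\<rparr>) H" using f R_def by (auto simp: hom_def)
  have "f ` R = f ` P" using PR R_def by auto
  moreover have "kernel (G\<lparr>carrier := R\<rparr>) H f = kernel G H f"
    using subgroup.one_closed[OF fP] by (auto simp: kernel_def R_def)
  ultimately have cR: "card (f ` P) * card (kernel G H f) = card R"
    using hom_card[OF fR G.subgroup_imp_group[OF R] H] by (simp add: order_def)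
  have cP: "card (f ` P) dvd p ^ multiplicity p (order G)"
  proof -
    have "f \<in> hom (G\<lparr>carrier := P\<rparr>) H" using group_hom.homh[OF induced_group_hom'[OF P'(1)]] .
    from hom_card[OF this G.subgroup_imp_group[OF P'(1)] H] show ?thesis
      using P'(2) by (simp add: order_def) (metis dvd_triv_left)
  qed
  then obtain k where k: "card (f ` P) = p ^ k"
    using p by (auto simp: divides_primepow_nat)
  have "multiplicity p (card R) = multiplicity p (order G)"
    using G.sylow_subgroup_restrict[OF fin p P R PR] P'(2) prime_gt_1_nat[OF p]
    by (auto simp: sylow_subgroup_def order_def)
  moreover have "multiplicity p (card R) = k + multiplicity p (card (kernel G H f))"
  proof -
    have "card (f ` P) \<noteq> 0" "card (kernel G H f) \<noteq> 0" using cR posR by (auto intro!: Nat.gr0I)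
    then show ?thesis
      using prime_elem_multiplicity_mult_distrib[of p "card (f ` P)" "card (kernel G H f)"] p k cR
      by (simp add: multiplicity_prime_power)
  qed
  moreover have "multiplicity p (order G) = multiplicity p (order H) + multiplicity p (card (kernel G H f))"
  proof -
    have "order H \<noteq> 0" "card (kernel G H f) \<noteq> 0" using cG posG by (auto intro!: Nat.gr0I)
    then show ?thesis
      using prime_elem_multiplicity_mult_distrib[of p "order H" "card (kernel G H f)"] p cG by simp
  qed
  ultimately have "k = multiplicity p (order H)" by simp
  then show "sylow_subgroup p (f ` P) H" using fP k by (simp add: sylow_subgroup_def)
  show "normalizer H (f ` P) = f ` normalizer G P"
  proof
    show "f ` normalizer G P \<subseteq> normalizer H (f ` P)"
      using subgroup.mem_carrier[OF P'(1)]
      by (auto simp: H.normalizer_eq[OF finH fP] G.normalizer_eq[OF fin P'(1)] simp flip: hom_mult hom_inv)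
    show "normalizer H (f ` P) \<subseteq> f ` normalizer G P"
    proof
      fix y assume y: "y \<in> normalizer H (f ` P)"
      then obtain g where g: "g \<in> carrier G" "y = f g"
        using surj by (auto simp: H.normalizer_eq[OF finH fP])
      let ?c = "\<lambda>x. g \<otimes> x \<otimes> inv g"
      have "group_hom G G ?c"
        using G.conjugation_iso[OF g(1)] G by (auto simp: group_hom_def group_hom_axioms_def iso_def)
      then have Q: "subgroup (?c ` P) G"
        using group_hom.subgroup_img_is_subgroup P'(1) by blast
      have "inj_on ?c P"
        using G.conjugation_iso[OF g(1)] subgroup.subset[OF P'(1)] by (auto simp: Group.iso_iff intro: inj_on_subset)
      then have cQ: "card (?c ` P) = p ^ multiplicity p (order G)" using P'(2) by (simp add: card_image)
      have QR: "?c ` P \<subseteq> R"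
        using y g subgroup.mem_carrier[OF P'(1)] by (auto simp: H.normalizer_eq[OF finH fP] R_def)
      obtain r where r: "r \<in> R" "\<And>x. x \<in> ?c ` P \<Longrightarrow> r \<otimes> x \<otimes> inv r \<in> P"
        using G.sylow_contains_conjugate_within[OF fin p P R PR Q cQ QR] by blast
      have rc: "r \<in> carrier G" using r(1) by (simp add: R_def)
      obtain u where u: "u \<in> P" "f r = f u" using r(1) by (auto simp: R_def)
      have uc: "u \<in> carrier G" using subgroup.mem_carrier[OF P'(1) u(1)] .
      have "r \<otimes> (g \<otimes> x \<otimes> inv g) \<otimes> inv r \<in> P" if "x \<in> P" for x
        using r(2) that by blast
      then have "r \<otimes> g \<in> normalizer G P"
        using rc g(1) subgroup.mem_carrier[OF P'(1)]
        by (auto simp: G.normalizer_eq[OF fin P'(1)] G.group_simps)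
      moreover have "inv u \<in> normalizer G P"
        using u(1) uc P'(1)
        by (simp add: G.normalizer_eq[OF fin P'(1)] subgroup.m_closed subgroup.m_inv_closed)
      \<comment> \<open>\<open>r\<close> and \<open>u\<close> have the same image, so the factor
        \<open>inv u\<close> restores the image \<open>f g\<close>.\<close>
      ultimately have "inv u \<otimes> (r \<otimes> g) \<in> normalizer G P"
        using G.normalizer_subgroup[OF subgroup.subset[OF P'(1)]] by (simp add: subgroup.m_closed)
      moreover have "f (inv u \<otimes> (r \<otimes> g)) = y"
        using rc uc u(2) g by (simp add: H.inv_cancel_left)
      ultimately show "y \<in> f ` normalizer G P" by blast
    qed
  qed
qed

section \<open>Modular functions on a group and Heisenberg groups\<close>

lemma (in group) finite_closed_subgroup:
  assumes "finite (carrier G)" "H \<subseteq> carrier G" "H \<noteq> {}" "\<And>x y. x \<in> H \<Longrightarrow> y \<in> H \<Longrightarrow> x \<otimes> y \<in> H"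
  shows "subgroup H G"
proof (rule subgroupI)
  fix x assume x: "x \<in> H"
  then have xc: "x \<in> carrier G" using assms(2) by blast
  have pos: "order G > 0" using assms(1) order_gt_0_iff_finite by blast
  have pow: "x [^] Suc n \<in> H" for n by (induction n) (use x xc assms(4) in auto)
  \<comment> \<open>Twice the order is used because \<open>pow\<close> covers positive exponents
    only, and \<open>order G - 1\<close> is 0 in the trivial group.\<close>
  have "x [^] (2 * order G - 1) \<otimes> x = x [^] (order G + order G)"
    using pos by (simp add: mult_2 flip: nat_pow_Suc)
  also have "\<dots> = \<one>"
    using xc pow_order_eq_1[OF xc] by (simp flip: nat_pow_mult)
  finally have "inv x = x [^] (2 * order G - 1)"
    using inv_equality xc by auto
  moreover have "2 * order G - 1 = Suc (2 * order G - 2)" using pos by simp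
  ultimately show "inv x \<in> H" using pow by simp
qed (use assms in auto)

lemma (in group) int_pow_mod:
  assumes "a \<in> carrier G" "a [^] n = \<one>"
  shows "a [^] (k mod int n) = a [^] k"
proof -
  have "a [^] k = a [^] (int n * (k div int n) + k mod int n)" by simp
  also have "\<dots> = (a [^] n) [^] (k div int n) \<otimes> a [^] (k mod int n)"
    using assms(1) by (simp only: int_pow_mult flip: int_pow_pow int_pow_int)
  finally show ?thesis using assms by simp
qed

locale modular_functions = group H for H (structure) +
  fixes q :: nat
  assumes finite_H: "finite (carrier H)" and q: "prime q"
begin

text \<open>Residues are stored as representatives below \<open>q\<close>, with value 0 off the
  carrier. Members that agree modulo \<open>q\<close> on the carrier are thus equal, and there are
  finitely many.\<close>

definition fns :: "('a \<Rightarrow> int) set" where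
  "fns = {f. \<forall>x. (x \<in> carrier H \<longrightarrow> f x \<in> {0..<int q}) \<and> (x \<notin> carrier H \<longrightarrow> f x = 0)}"

definition fzero :: "'a \<Rightarrow> int" where "fzero = (\<lambda>x. 0)"

definition fconst :: "int \<Rightarrow> 'a \<Rightarrow> int" where
  "fconst c = (\<lambda>x. if x \<in> carrier H then c mod int q else 0)"

definition fadd :: "('a \<Rightarrow> int) \<Rightarrow> ('a \<Rightarrow> int) \<Rightarrow> 'a \<Rightarrow> int" where
  "fadd f g = (\<lambda>x. (f x + g x) mod int q)"

definition fmul :: "('a \<Rightarrow> int) \<Rightarrow> ('a \<Rightarrow> int) \<Rightarrow> 'a \<Rightarrow> int" where
  "fmul f g = (\<lambda>x. (f x * g x) mod int q)"

definition fneg :: "('a \<Rightarrow> int) \<Rightarrow> 'a \<Rightarrow> int" where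
  "fneg f = (\<lambda>x. (- f x) mod int q)"

text \<open>Translating the argument on the right yields a left action of \<open>H\<close>;
  \<open>ltrans\<close> composes in the opposite order and commutes with it.\<close>

definition rtrans :: "'a \<Rightarrow> ('a \<Rightarrow> int) \<Rightarrow> 'a \<Rightarrow> int" where
  "rtrans g f = (\<lambda>x. if x \<in> carrier H then f (x \<otimes> g) else 0)"

definition ltrans :: "'a \<Rightarrow> ('a \<Rightarrow> int) \<Rightarrow> 'a \<Rightarrow> int" where
  "ltrans g f = (\<lambda>x. if x \<in> carrier H then f (g \<otimes> x) else 0)"

lemma q_gt: "int q > 1"
  using prime_gt_1_nat[OF q] by simp

lemma fns_finite: "finite fns"
  unfolding fns_def
  using finite_set_of_finite_funs[OF finite_H, of "{0..<int q}" 0] by simp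

lemma fzero_fns [simp]: "fzero \<in> fns"
  using q_gt by (simp add: fns_def fzero_def)

lemma fconst_fns [simp]: "fconst c \<in> fns"
  using q_gt by (simp add: fns_def fconst_def)

lemma fadd_fns [simp]: "f \<in> fns \<Longrightarrow> g \<in> fns \<Longrightarrow> fadd f g \<in> fns"
  using q_gt by (simp add: fns_def fadd_def)

lemma fmul_fns [simp]: "f \<in> fns \<Longrightarrow> g \<in> fns \<Longrightarrow> fmul f g \<in> fns"
  using q_gt by (simp add: fns_def fmul_def)

lemma fneg_fns [simp]: "f \<in> fns \<Longrightarrow> fneg f \<in> fns"
  using q_gt by (simp add: fns_def fneg_def)

lemma rtrans_fns [simp]: "f \<in> fns \<Longrightarrow> g \<in> carrier H \<Longrightarrow> rtrans g f \<in> fns"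
  by (simp add: fns_def rtrans_def)

lemma ltrans_fns [simp]: "f \<in> fns \<Longrightarrow> g \<in> carrier H \<Longrightarrow> ltrans g f \<in> fns"
  by (simp add: fns_def ltrans_def)

lemma fns_mod: "f \<in> fns \<Longrightarrow> f x mod int q = f x"
  using q_gt by (cases "x \<in> carrier H") (auto simp: fns_def)

lemma fadd_ac: "fadd (fadd f g) h = fadd f (fadd g h)" "fadd f g = fadd g f"
  "fadd f (fadd g h) = fadd g (fadd f h)"
  by (simp_all add: fadd_def mod_simps algebra_simps)

lemma fzero_simps [simp]: "f \<in> fns \<Longrightarrow> fadd fzero f = f" "f \<in> fns \<Longrightarrow> fadd f fzero = f"
  "fmul fzero f = fzero" "fmul f fzero = fzero" "rtrans g fzero = fzero" "ltrans g fzero = fzero"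
  by (auto simp: fadd_def fmul_def fzero_def rtrans_def ltrans_def fns_mod)

lemma fadd_fneg [simp]: "fadd (fneg f) f = fzero"
  by (simp add: fadd_def fneg_def fzero_def mod_simps)

lemma fmul_fadd: "fmul f (fadd g h) = fadd (fmul f g) (fmul f h)"
  "fmul (fadd g h) f = fadd (fmul g f) (fmul h f)"
  by (simp_all add: fadd_def fmul_def mod_simps algebra_simps)

lemma rtrans_fadd: "rtrans g (fadd f h) = fadd (rtrans g f) (rtrans g h)"
  by (auto simp: rtrans_def fadd_def)

lemma rtrans_fmul: "rtrans g (fmul f h) = fmul (rtrans g f) (rtrans g h)"
  by (auto simp: rtrans_def fmul_def)

lemma rtrans_rtrans: "g \<in> carrier H \<Longrightarrow> h \<in> carrier H \<Longrightarrow> rtrans (g \<otimes> h) f = rtrans g (rtrans h f)"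
  by (auto simp: rtrans_def m_assoc)

lemma rtrans_one [simp]: "f \<in> fns \<Longrightarrow> rtrans \<one> f = f"
  by (auto simp: rtrans_def fns_def)

lemma ltrans_fadd: "ltrans g (fadd f h) = fadd (ltrans g f) (ltrans g h)"
  by (auto simp: ltrans_def fadd_def)

lemma ltrans_rtrans: "g \<in> carrier H \<Longrightarrow> h \<in> carrier H \<Longrightarrow> ltrans h (rtrans g f) = rtrans g (ltrans h f)"
  by (auto simp: ltrans_def rtrans_def m_assoc)

text \<open>The unitriangular \<open>3 \<times> 3\<close> matrices over the ring of functions, extended by \<open>H\<close> acting
  through right translations; \<open>(u, w, t, g)\<close> has the entries \<open>u\<close> and \<open>w\<close> next to the diagonal and
  \<open>t\<close> in the corner.\<close>

definition heis :: "(('a \<Rightarrow> int) \<times> ('a \<Rightarrow> int) \<times> ('a \<Rightarrow> int) \<times> 'a) monoid" where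
  "heis = \<lparr>carrier = fns \<times> fns \<times> fns \<times> carrier H,
     monoid.mult = (\<lambda>(u, w, t, g) (u', w', t', g').
       (fadd u (rtrans g u'), fadd w (rtrans g w'),
        fadd (fadd t (rtrans g t')) (fmul u (rtrans g w')), g \<otimes> g')),
     one = (fzero, fzero, fzero, \<one>)\<rparr>"

lemma heis_mult [simp]: "(u, w, t, g) \<otimes>\<^bsub>heis\<^esub> (u', w', t', g') =
    (fadd u (rtrans g u'), fadd w (rtrans g w'),
      fadd (fadd t (rtrans g t')) (fmul u (rtrans g w')), g \<otimes> g')"
  by (simp add: heis_def)

lemma heis_one [simp]: "\<one>\<^bsub>heis\<^esub> = (fzero, fzero, fzero, \<one>)"
  by (simp add: heis_def)

lemma heis_carrier: "carrier heis = fns \<times> fns \<times> fns \<times> carrier H"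
  by (simp add: heis_def)

lemma heis_group: "group heis"
proof (rule groupI)
  fix x assume "x \<in> carrier heis"
  then obtain u w t g where x: "x = (u, w, t, g)" "u \<in> fns" "w \<in> fns" "t \<in> fns" "g \<in> carrier H"
    by (auto simp: heis_carrier)
  let ?u = "fneg (rtrans (inv g) u)"
  let ?y = "(?u, fneg (rtrans (inv g) w),
    fneg (fadd (rtrans (inv g) t) (fmul ?u (rtrans (inv g) w))), inv g)"
  have "?y \<in> carrier heis" "?y \<otimes>\<^bsub>heis\<^esub> x = \<one>\<^bsub>heis\<^esub>"
    using x by (simp_all add: heis_carrier fadd_ac(1))
  then show "\<exists>y\<in>carrier heis. y \<otimes>\<^bsub>heis\<^esub> x = \<one>\<^bsub>heis\<^esub>" by blast
next
  fix x y z assume "x \<in> carrier heis" "y \<in> carrier heis" "z \<in> carrier heis"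
  then obtain u w t g u' w' t' g' u'' w'' t'' g'' where
    "x = (u, w, t, g)" "y = (u', w', t', g')" "z = (u'', w'', t'', g'')"
    "g \<in> carrier H" "g' \<in> carrier H" "g'' \<in> carrier H"
    by (auto simp: heis_carrier)
  then show "x \<otimes>\<^bsub>heis\<^esub> y \<otimes>\<^bsub>heis\<^esub> z = x \<otimes>\<^bsub>heis\<^esub> (y \<otimes>\<^bsub>heis\<^esub> z)"
    by (simp add: rtrans_fadd rtrans_fmul rtrans_rtrans fmul_fadd fadd_ac m_assoc)
next
  show "\<one>\<^bsub>heis\<^esub> \<otimes>\<^bsub>heis\<^esub> x = x" if "x \<in> carrier heis" for x
    using that by (auto simp: heis_carrier)
  show "x \<otimes>\<^bsub>heis\<^esub> y \<in> carrier heis" if "x \<in> carrier heis" "y \<in> carrier heis" for x y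
    using that by (auto simp: heis_carrier)
  show "\<one>\<^bsub>heis\<^esub> \<in> carrier heis" by (simp add: heis_carrier)
qed

sublocale heis: group heis by (rule heis_group)

lemma heis_finite: "finite (carrier heis)"
  using fns_finite finite_H by (simp add: heis_carrier)

text \<open>Negatives and scalar multiples are repeated sums, because \<open>fns\<close> has
  exponent \<open>q\<close>.\<close>

definition submodule :: "('a \<Rightarrow> int) set \<Rightarrow> bool" where
  "submodule U \<longleftrightarrow> U \<subseteq> fns \<and> fzero \<in> U \<and> (\<forall>f\<in>U. \<forall>g\<in>U. fadd f g \<in> U) \<and>
     (\<forall>f\<in>U. \<forall>g\<in>carrier H. rtrans g f \<in> U)"

lemma submoduleD:
  assumes "submodule U"
  shows "f \<in> U \<Longrightarrow> f \<in> fns" "fzero \<in> U" "f \<in> U \<Longrightarrow> g \<in> U \<Longrightarrow> fadd f g \<in> U"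
    "f \<in> U \<Longrightarrow> h \<in> carrier H \<Longrightarrow> rtrans h f \<in> U"
  using assms by (auto simp: submodule_def)

lemma submodule_zero [simp]: "submodule {fzero}"
  by (simp add: submodule_def)

definition heis_sub :: "('a \<Rightarrow> int) set \<Rightarrow> ('a \<Rightarrow> int) set \<Rightarrow> ('a \<Rightarrow> int) set \<Rightarrow>
    (('a \<Rightarrow> int) \<times> ('a \<Rightarrow> int) \<times> ('a \<Rightarrow> int) \<times> 'a) set" where
  "heis_sub U W T = U \<times> W \<times> T \<times> carrier H"

lemma heis_sub_subgroup:
  assumes "submodule U" "submodule W" "submodule T" "\<And>u w. u \<in> U \<Longrightarrow> w \<in> W \<Longrightarrow> fmul u w \<in> T"
  shows "subgroup (heis_sub U W T) heis"
proof (rule heis.finite_closed_subgroup[OF heis_finite])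
  show "heis_sub U W T \<subseteq> carrier heis"
    using assms(1-3) by (auto simp: heis_sub_def heis_carrier submodule_def)
  show "heis_sub U W T \<noteq> {}" using assms by (auto simp: heis_sub_def submodule_def)
  show "x \<otimes>\<^bsub>heis\<^esub> y \<in> heis_sub U W T" if "x \<in> heis_sub U W T" "y \<in> heis_sub U W T" for x y
    using that assms by (auto simp: heis_sub_def submodule_def)
qed

text \<open>The module sits in the corner, so that for a submodule \<open>U\<close> this semidirect
  product with \<open>H\<close> is a subgroup of every \<open>heis_sub\<close> group with corner
  \<open>U\<close>.\<close>

abbreviation semidirect :: "('a \<Rightarrow> int) set \<Rightarrow> (('a \<Rightarrow> int) \<times> ('a \<Rightarrow> int) \<times> ('a \<Rightarrow> int) \<times> 'a) monoid"
  where "semidirect U \<equiv> heis\<lparr>carrier := heis_sub {fzero} {fzero} U\<rparr>"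

lemma semidirect_subgroup: "submodule U \<Longrightarrow> subgroup (heis_sub {fzero} {fzero} U) heis"
  by (rule heis_sub_subgroup) (auto simp: submodule_def)

lemma semidirect_group: "submodule U \<Longrightarrow> group (semidirect U)"
  using heis.subgroup_imp_group semidirect_subgroup by blast

definition product_span :: "('a \<Rightarrow> int) set \<Rightarrow> ('a \<Rightarrow> int) set \<Rightarrow> ('a \<Rightarrow> int) set" where
  "product_span U W = \<Inter>{S. S \<subseteq> fns \<and> fzero \<in> S \<and> (\<forall>f\<in>S. \<forall>g\<in>S. fadd f g \<in> S) \<and>
     (\<forall>u\<in>U. \<forall>w\<in>W. fmul u w \<in> S)}"

lemma product_span_least:
  assumes "S \<subseteq> fns" "fzero \<in> S" "\<And>f g. f \<in> S \<Longrightarrow> g \<in> S \<Longrightarrow> fadd f g \<in> S"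
    "\<And>u w. u \<in> U \<Longrightarrow> w \<in> W \<Longrightarrow> fmul u w \<in> S"
  shows "product_span U W \<subseteq> S"
  unfolding product_span_def by (rule Inter_lower) (use assms in auto)

lemma product_span_mult: "u \<in> U \<Longrightarrow> w \<in> W \<Longrightarrow> fmul u w \<in> product_span U W"
  unfolding product_span_def by blast

text \<open>Translation by \<open>h\<close> is additive and multiplicative, so the functions whose
  translate stays in the span form a set to which minimality of the span applies.\<close>

lemma submodule_product_span:
  assumes U: "submodule U" and W: "submodule W"
  shows "submodule (product_span U W)"
proof -
  let ?T = "product_span U W"
  have fns: "?T \<subseteq> fns"
    by (rule product_span_least) (use submoduleD[OF U] submoduleD[OF W] in auto)
  have zero: "fzero \<in> ?T" unfolding product_span_def by blast
  have add: "fadd f g \<in> ?T" if "f \<in> ?T" "g \<in> ?T" for f g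
    using that unfolding product_span_def by blast
  have "rtrans h f \<in> ?T" if f: "f \<in> ?T" and h: "h \<in> carrier H" for f h
  proof -
    have "?T \<subseteq> {f \<in> fns. rtrans h f \<in> ?T}"
    proof (rule product_span_least)
      fix u w assume uw: "u \<in> U" "w \<in> W"
      then show "fmul u w \<in> {f \<in> fns. rtrans h f \<in> ?T}"
        using submoduleD[OF U] submoduleD[OF W] h by (simp add: rtrans_fmul product_span_mult)
    qed (use zero add in \<open>auto simp: rtrans_fadd\<close>)
    then show ?thesis using f by blast
  qed
  then show ?thesis using fns zero add by (auto simp: submodule_def)
qed

text \<open>The corner entries \<open>u w\<close> are commutators, and the corner commutes with the other entries,
  so no maximal subgroup supplements the corner.\<close>

lemma product_span_frattini:
  assumes U: "submodule U" and W: "submodule W"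
  defines "T \<equiv> product_span U W"
  shows "{fzero} \<times> {fzero} \<times> T \<times> {\<one>} \<subseteq> frattini (heis\<lparr>carrier := heis_sub U W T\<rparr>)"
proof -
  let ?E = "heis\<lparr>carrier := heis_sub U W T\<rparr>"
  have T: "submodule T" using submodule_product_span[OF U W] by (simp add: T_def)
  have sub: "subgroup (heis_sub U W T) heis"
    by (rule heis_sub_subgroup[OF U W T]) (simp add: T_def product_span_mult)
  interpret E: group ?E by (rule heis.subgroup_imp_group[OF sub])
  note D = submoduleD[OF U] submoduleD[OF W] submoduleD[OF T]
  have "{fzero} \<times> {fzero} \<times> T \<times> {\<one>} \<subseteq> M" if max: "maximal_subgroup M ?E" for M
  proof (rule ccontr)
    assume "\<not> {fzero} \<times> {fzero} \<times> T \<times> {\<one>} \<subseteq> M"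
    then obtain t0 where t0: "t0 \<in> T" "(fzero, fzero, t0, \<one>) \<notin> M" by auto
    have M: "subgroup M ?E" using max by (simp add: maximal_subgroup_def)
    have Msub: "M \<subseteq> heis_sub U W T" using subgroup.subset[OF M] by simp
    have Mmult: "x \<otimes>\<^bsub>heis\<^esub> y \<in> M" if "x \<in> M" "y \<in> M" for x y
      using subgroup.m_closed[OF M that] by simp
    have Mone: "(fzero, fzero, fzero, \<one>) \<in> M" using subgroup.one_closed[OF M] by simp
    \<comment> \<open>\<open>K\<close> is the product of \<open>M\<close> with the corner. It
      contains the element given by \<open>t0\<close>, so maximality makes it the whole group:
      \<open>M\<close> has elements with any prescribed entries next to the diagonal.\<close>
    define K where "K = {(u, w, fadd t s, g) |u w t s g. (u, w, t, g) \<in> M \<and> s \<in> T}"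
    have MK: "M \<subseteq> K"
    proof
      fix x assume x: "x \<in> M"
      obtain u w t g where xe: "x = (u, w, t, g)" by (cases x)
      then have "t \<in> T" using x Msub by (auto simp: heis_sub_def)
      then have "x = (u, w, fadd t fzero, g)" using xe D(9) by simp
      moreover have "(u, w, t, g) \<in> M \<and> fzero \<in> T" using x xe D(10) by simp
      ultimately show "x \<in> K" unfolding K_def by blast
    qed
    have "subgroup K ?E"
    proof (rule E.finite_closed_subgroup)
      show "finite (carrier ?E)" using heis.subgroup_finite[OF heis_finite sub] by simp
      show "K \<subseteq> carrier ?E" using Msub D by (auto simp: K_def heis_sub_def)
      show "K \<noteq> {}" using MK Mone by blast
      fix x y assume "x \<in> K" "y \<in> K"
      then obtain u w t s g u' w' t' s' g' where x: "x = (u, w, fadd t s, g)" "(u, w, t, g) \<in> M" "s \<in> T"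
        and y: "y = (u', w', fadd t' s', g')" "(u', w', t', g') \<in> M" "s' \<in> T"
        unfolding K_def by blast
      have g: "g \<in> carrier H" using x(2) Msub by (auto simp: heis_sub_def)
      have "x \<otimes>\<^bsub>heis\<^esub> y = (fadd u (rtrans g u'), fadd w (rtrans g w'),
          fadd (fadd (fadd t (rtrans g t')) (fmul u (rtrans g w'))) (fadd s (rtrans g s')), g \<otimes> g')"
        using x y by (simp add: rtrans_fadd fadd_ac)
      moreover have "(fadd u (rtrans g u'), fadd w (rtrans g w'),
          fadd (fadd t (rtrans g t')) (fmul u (rtrans g w')), g \<otimes> g') \<in> M"
        using Mmult[OF x(2) y(2)] by simp
      moreover have "fadd s (rtrans g s') \<in> T" by (rule D(11)[OF x(3) D(12)[OF y(3) g]])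
      ultimately show "x \<otimes>\<^bsub>?E\<^esub> y \<in> K" unfolding K_def by auto
    qed
    then have "K = M \<or> K = carrier ?E" using max MK by (simp add: maximal_subgroup_def)
    moreover have "(fzero, fzero, fadd fzero t0, \<one>) \<in> K"
      using Mone t0(1) unfolding K_def by blast
    ultimately have K: "K = heis_sub U W T" using t0 D by auto
    have prod: "(fzero, fzero, fmul u w, \<one>) \<in> M" if u: "u \<in> U" and w: "w \<in> W" for u w
    proof -
      have "(u, fzero, fzero, \<one>) \<in> K" "(fzero, w, fzero, \<one>) \<in> K"
        using u w D by (auto simp: K heis_sub_def)
      then obtain t t' where tt: "(u, fzero, t, \<one>) \<in> M" "(fzero, w, t', \<one>) \<in> M"
        unfolding K_def by blast
      have fn: "u \<in> fns" "w \<in> fns" "t \<in> fns" "t' \<in> fns"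
        using tt Msub u w D by (auto simp: heis_sub_def)
      let ?a = "(u, fzero, t, \<one>)" and ?b = "(fzero, w, t', \<one>)" and ?c = "(fzero, fzero, fmul u w, \<one>)"
      \<comment> \<open>The unknown corner entries \<open>t\<close> and \<open>t'\<close> cancel,
        and what remains of the commutator is the product \<open>fmul u w\<close> in the
        corner.\<close>
      have c: "?c \<otimes>\<^bsub>?E\<^esub> (?b \<otimes>\<^bsub>?E\<^esub> ?a) = ?a \<otimes>\<^bsub>?E\<^esub> ?b"
        using fn by (simp add: fadd_ac)
      have ba: "?b \<otimes>\<^bsub>?E\<^esub> ?a \<in> M" "?a \<otimes>\<^bsub>?E\<^esub> ?b \<in> M"
        using subgroup.m_closed[OF M] tt by blast+
      have cE: "?c \<in> carrier ?E"
        using u w D product_span_mult[OF u w] by (simp add: heis_sub_def T_def)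
      have "?c = (?a \<otimes>\<^bsub>?E\<^esub> ?b) \<otimes>\<^bsub>?E\<^esub> inv\<^bsub>?E\<^esub> (?b \<otimes>\<^bsub>?E\<^esub> ?a)"
        by (rule E.inv_solve_right[THEN iffD2, OF cE _ _ c[symmetric]])
          (use ba subgroup.mem_carrier[OF M] in blast)+
      then show ?thesis
        using subgroup.m_closed[OF M ba(2) subgroup.m_inv_closed[OF M ba(1)]] by simp
    qed
    have "T \<subseteq> {t \<in> fns. (fzero, fzero, t, \<one>) \<in> M}"
      unfolding T_def
    proof (rule product_span_least)
      fix f g assume "f \<in> {t \<in> fns. (fzero, fzero, t, \<one>) \<in> M}" "g \<in> {t \<in> fns. (fzero, fzero, t, \<one>) \<in> M}"
      then show "fadd f g \<in> {t \<in> fns. (fzero, fzero, t, \<one>) \<in> M}"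
        using Mmult[of "(fzero, fzero, f, \<one>)" "(fzero, fzero, g, \<one>)"] by simp
    qed (use Mone prod D in auto)
    then show False using t0 by blast
  qed
  moreover have "{fzero} \<times> {fzero} \<times> T \<times> {\<one>} \<subseteq> heis_sub U W T"
    using D by (auto simp: heis_sub_def)
  ultimately show ?thesis
    unfolding frattini_def by (intro Int_greatest Inter_greatest) auto
qed

end

section \<open>Tame functions\<close>

locale formation_functions = saturated_formation F + modular_functions H q
  for F and H (structure) and q +
  assumes H_in: "in_class H F" and q_in: "q \<in> class_primes F"
begin

definition good :: "('a \<Rightarrow> int) set \<Rightarrow> bool" where
  "good U \<longleftrightarrow> submodule U \<and> in_class (semidirect U) F"

lemma good_above_residual: "good U \<Longrightarrow> above_residual F (semidirect U) {\<one>\<^bsub>semidirect U\<^esub>}"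
  using in_class_above_residual[of "semidirect U"] by (simp add: good_def)

lemma good_submodule: "good U \<Longrightarrow> submodule U"
  by (simp add: good_def)

lemma good_subset: "good U \<Longrightarrow> submodule U' \<Longrightarrow> U' \<subseteq> U \<Longrightarrow> good U'"
proof -
  assume U: "good U" and U': "submodule U'" "U' \<subseteq> U"
  have "subgroup (heis_sub {fzero} {fzero} U') (semidirect U)"
    using semidirect_subgroup[OF U'(1)] semidirect_subgroup[OF good_submodule[OF U]] U'(2)
    by (intro heis.subgroup_incl) (auto simp: heis_sub_def)
  then show "good U'"
    using in_class_subgroup[of "semidirect U"] U U' by (auto simp: good_def)
qed

text \<open>The projections \<open>?a\<close> and \<open>?b\<close> map to the semidirect products
  of \<open>U\<close> and \<open>W\<close>, and their kernels meet in the corner. The corner lies in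
  the Frattini subgroup, so saturation applies.\<close>

lemma heis_sub_in_class:
  assumes U: "good U" and W: "good W"
  shows "in_class (heis\<lparr>carrier := heis_sub U W (product_span U W)\<rparr>) F"
proof -
  let ?T = "product_span U W"
  let ?E = "heis\<lparr>carrier := heis_sub U W ?T\<rparr>"
  note sU = good_submodule[OF U] and sW = good_submodule[OF W]
  have sT: "submodule ?T" using submodule_product_span[OF sU sW] .
  note D = submoduleD[OF sU] submoduleD[OF sW] submoduleD[OF sT]
  have sub: "subgroup (heis_sub U W ?T) heis"
    by (rule heis_sub_subgroup[OF sU sW sT]) (simp add: product_span_mult)
  have E: "group ?E" "finite (carrier ?E)"
    using heis.subgroup_imp_group[OF sub] heis.subgroup_finite[OF heis_finite sub] by simp_all
  let ?a = "\<lambda>(u, w, t, g). (fzero, fzero, u, g)" and ?b = "\<lambda>(u, w, t, g). (fzero, fzero, w, g)"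
  have a: "?a \<in> hom ?E (semidirect U)" and b: "?b \<in> hom ?E (semidirect W)"
    using D by (auto simp: hom_def heis_sub_def)
  from above_residual_Int[OF E above_residual_hom[OF a good_above_residual[OF U]]
      above_residual_hom[OF b good_above_residual[OF W]]]
  have "above_residual F ?E (frattini ?E)"
    by (rule above_residual_mono)
      (use product_span_frattini[OF sU sW] in \<open>auto simp: heis_sub_def split: prod.splits\<close>)
  then show ?thesis by (rule in_class_frattini[OF E])
qed

text \<open>The corner together with \<open>H\<close> is a subgroup of the Heisenberg group just
  placed in the class.\<close>

lemma good_product_span:
  assumes U: "good U" and W: "good W"
  shows "good (product_span U W)"
proof -
  let ?T = "product_span U W"
  note sU = good_submodule[OF U] and sW = good_submodule[OF W]
  have sT: "submodule ?T" using submodule_product_span[OF sU sW] .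
  have sub: "subgroup (heis_sub U W ?T) heis"
    by (rule heis_sub_subgroup[OF sU sW sT]) (simp add: product_span_mult)
  have "subgroup (heis_sub {fzero} {fzero} ?T) (heis\<lparr>carrier := heis_sub U W ?T\<rparr>)"
    using semidirect_subgroup[OF sT] sub submoduleD(2)[OF sU] submoduleD(2)[OF sW]
    by (intro heis.subgroup_incl) (auto simp: heis_sub_def)
  then show ?thesis
    using in_class_subgroup[OF heis_sub_in_class[OF U W]] sT by (simp add: good_def)
qed

text \<open>Forgetting the corner and adding \<open>u\<close> and \<open>w\<close> maps the
  Heisenberg group onto the semidirect product of the sum.\<close>

lemma good_sum:
  assumes U: "good U" and W: "good W"
  shows "good {fadd u w |u w. u \<in> U \<and> w \<in> W}"
proof -
  let ?T = "product_span U W" and ?S = "{fadd u w |u w. u \<in> U \<and> w \<in> W}"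
  let ?E = "heis\<lparr>carrier := heis_sub U W ?T\<rparr>"
  note sU = good_submodule[OF U] and sW = good_submodule[OF W]
  have sT: "submodule ?T" using submodule_product_span[OF sU sW] .
  note D = submoduleD[OF sU] submoduleD[OF sW] submoduleD[OF sT]
  have sS: "submodule ?S"
    unfolding submodule_def
  proof (intro conjI ballI)
    show "?S \<subseteq> fns" using D by auto
    have "fzero = fadd fzero fzero" by simp
    then show "fzero \<in> ?S" using D(2,6) by blast
    fix f assume "f \<in> ?S"
    then obtain u w where f: "f = fadd u w" "u \<in> U" "w \<in> W" by blast
    show "rtrans g f \<in> ?S" if "g \<in> carrier H" for g
      using f D(4)[OF f(2) that] D(8)[OF f(3) that] by (auto simp: rtrans_fadd)
    fix g assume "g \<in> ?S"
    then obtain u' w' where g: "g = fadd u' w'" "u' \<in> U" "w' \<in> W" by blast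
    have "fadd f g = fadd (fadd u u') (fadd w w')" using f g by (simp add: fadd_ac)
    then show "fadd f g \<in> ?S" using D(3)[OF f(2) g(2)] D(7)[OF f(3) g(3)] by blast
  qed
  have E: "in_class ?E F" by (rule heis_sub_in_class[OF U W])
  let ?s = "\<lambda>(u, w, t, g). (fzero, fzero, fadd u w, g)"
  have s: "?s \<in> hom ?E (semidirect ?S)"
  proof (rule homI)
    fix x y assume "x \<in> carrier ?E" "y \<in> carrier ?E"
    then show "?s (x \<otimes>\<^bsub>?E\<^esub> y) = ?s x \<otimes>\<^bsub>semidirect ?S\<^esub> ?s y"
      using D by (auto simp: heis_sub_def rtrans_fadd fadd_ac)
  qed (auto simp: heis_sub_def)
  have surj: "?s ` carrier ?E = carrier (semidirect ?S)"
  proof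
    show "carrier (semidirect ?S) \<subseteq> ?s ` carrier ?E"
    proof
      fix x assume "x \<in> carrier (semidirect ?S)"
      then obtain u w g where "x = (fzero, fzero, fadd u w, g)" "u \<in> U" "w \<in> W" "g \<in> carrier H"
        by (auto simp: heis_sub_def)
      then show "x \<in> ?s ` carrier ?E"
        using D by (intro image_eqI[of _ _ "(u, w, fzero, g)"]) (auto simp: heis_sub_def)
    qed
  qed (auto simp: heis_sub_def)
  have "above_residual F ?E {\<one>\<^bsub>?E\<^esub>}" using E in_class_above_residual by blast
  then have "above_residual F ?E {x \<in> carrier ?E. ?s x = \<one>\<^bsub>semidirect ?S\<^esub>}"
    by (rule above_residual_mono) auto
  then have "in_class (semidirect ?S) F"
    using in_class_image[OF s surj] E semidirect_group[OF sS] by (auto simp: in_class_def)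
  then show ?thesis using sS by (simp add: good_def)
qed

text \<open>Left translations commute with the right translations that define the module structure,
  so they induce a homomorphism onto the semidirect product of the translated module.\<close>

lemma good_ltrans:
  assumes U: "good U" and h: "h \<in> carrier H"
  shows "good (ltrans h ` U)"
proof -
  note sU = good_submodule[OF U]
  note D = submoduleD[OF sU]
  have sL: "submodule (ltrans h ` U)"
    using D h unfolding submodule_def
    by (auto simp flip: ltrans_fadd ltrans_rtrans intro: image_eqI[of _ _ fzero])
  let ?s = "\<lambda>(u, w, t, g). (u, w, ltrans h t, g)"
  have s: "?s \<in> hom (semidirect U) (semidirect (ltrans h ` U))"
  proof (rule homI)
    fix x y assume "x \<in> carrier (semidirect U)" "y \<in> carrier (semidirect U)"
    then show "?s (x \<otimes>\<^bsub>semidirect U\<^esub> y) = ?s x \<otimes>\<^bsub>semidirect (ltrans h ` U)\<^esub> ?s y"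
      using D h by (auto simp: heis_sub_def ltrans_fadd ltrans_rtrans)
  qed (auto simp: heis_sub_def)
  have surj: "?s ` carrier (semidirect U) = carrier (semidirect (ltrans h ` U))"
    by (force simp: heis_sub_def)
  from good_above_residual[OF U] have "above_residual F (semidirect U) {x \<in> carrier (semidirect U). ?s x = \<one>\<^bsub>semidirect (ltrans h ` U)\<^esub>}"
    by (rule above_residual_mono) auto
  then have "in_class (semidirect (ltrans h ` U)) F"
    using in_class_image[OF s surj] semidirect_group[OF sL] semidirect_group[OF sU] by blast
  then show ?thesis using sL by (simp add: good_def)
qed

text \<open>The constants form the trivial module, whose semidirect product is the direct product of
  a cyclic group of order \<open>q\<close> with \<open>H\<close>. It maps to \<open>H\<close> and,
  through an element \<open>a\<close> of order \<open>q\<close>, to a member of the class; the two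
  kernels meet trivially.\<close>

lemma good_consts: "good (range fconst)"
proof -
  let ?C = "range fconst"
  have add: "fadd (fconst c) (fconst d) = fconst (c + d)" for c d
    by (auto simp: fadd_def fconst_def mod_simps)
  have tr: "rtrans g (fconst c) = fconst c" if "g \<in> carrier H" for g c
    using that by (auto simp: rtrans_def fconst_def)
  have zero: "fconst 0 = fzero" by (auto simp: fconst_def fzero_def)
  have sC: "submodule ?C"
    unfolding submodule_def using add tr zero[symmetric] by auto
  obtain Q where Q: "Q \<in> F" "q dvd order Q" using q_in by (auto simp: class_primes_def primes_of_def)
  interpret Q: group Q using group_F Q(1) .
  obtain a where a: "a \<in> carrier Q" "a \<noteq> \<one>\<^bsub>Q\<^esub>" "a [^]\<^bsub>Q\<^esub> q = \<one>\<^bsub>Q\<^esub>"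
    using Q.cauchy[OF finite_F[OF Q(1)] q Q.subgroup_self] Q(2) by (auto simp: order_def)
  let ?S = "semidirect ?C"
  let ?h = "\<lambda>(u :: 'a \<Rightarrow> int, w :: 'a \<Rightarrow> int, t, g :: 'a). a [^]\<^bsub>Q\<^esub> (t \<one> :: int)"
  have h: "?h \<in> hom ?S Q"
    using a by (auto simp: hom_def heis_sub_def fadd_def rtrans_def fmul_def fzero_def fconst_def mod_simps
        Q.int_pow_mod Q.int_pow_mult)
  have h1: "t = fzero" if t: "t \<in> ?C" "a [^]\<^bsub>Q\<^esub> (t \<one>) = \<one>\<^bsub>Q\<^esub>" for t
  proof -
    obtain c where c: "t = fconst c" using t(1) by blast
    let ?k = "nat (c mod int q)"
    have k: "int ?k = c mod int q" "?k < q" using q_gt by (simp_all add: nat_less_iff)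
    have pk: "a [^]\<^bsub>Q\<^esub> ?k = \<one>\<^bsub>Q\<^esub>" using t(2) c k(1) by (simp add: fconst_def flip: int_pow_int)
    have "?k = 0"
    proof (rule ccontr)
      assume "?k \<noteq> 0"
      then have "coprime ?k q" using k(2) q by (metis coprime_commute nat_dvd_not_less neq0_conv prime_imp_coprime)
      then show False
        using Q.pow_gcd_one[of a ?k "{\<one>\<^bsub>Q\<^esub>}" q] a pk Q.triv_subgroup by simp
    qed
    then have "c mod int q = 0" using k(1) by simp
    then show ?thesis using c by (auto simp: fconst_def fzero_def)
  qed
  have g: "(\<lambda>(u, w, t, g). g) \<in> hom ?S H" by (auto simp: hom_def heis_sub_def)
  have fin: "finite (carrier ?S)"
    using heis.subgroup_finite[OF heis_finite semidirect_subgroup[OF sC]] by simp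
  have "above_residual F ?S {x \<in> carrier ?S. ?h x = \<one>\<^bsub>Q\<^esub>}"
    using Q(1) h unfolding above_residual_def by blast
  moreover have "above_residual F H {\<one>}" using H_in in_class_above_residual by blast
  from above_residual_hom[OF g this]
  have "above_residual F ?S {x \<in> carrier ?S. (case x of (u, w, t, g) \<Rightarrow> g) \<in> {\<one>}}" .
  ultimately have "above_residual F ?S ({x \<in> carrier ?S. ?h x = \<one>\<^bsub>Q\<^esub>} \<inter>
      {x \<in> carrier ?S. (case x of (u, w, t, g) \<Rightarrow> g) \<in> {\<one>}})"
    by (rule above_residual_Int[OF semidirect_group[OF sC] fin])
  then have "above_residual F ?S {\<one>\<^bsub>?S\<^esub>}"
    by (rule above_residual_mono) (use h1 in \<open>auto simp: heis_sub_def\<close>)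
  then show ?thesis using sC semidirect_group[OF sC] by (simp add: good_def in_class_above_residual)
qed

section \<open>The algebra of tame functions and the cosets of its stabiliser\<close>

definition tame :: "('a \<Rightarrow> int) set" where
  "tame = \<Union>{U. good U}"

lemma tame_fns: "f \<in> tame \<Longrightarrow> f \<in> fns"
  using submoduleD(1)[OF good_submodule] by (auto simp: tame_def)

lemma tame_const: "fconst c \<in> tame"
  using good_consts by (auto simp: tame_def)

lemma tame_add: "f \<in> tame \<Longrightarrow> g \<in> tame \<Longrightarrow> fadd f g \<in> tame"
  using good_sum unfolding tame_def by blast

lemma tame_mul: "f \<in> tame \<Longrightarrow> g \<in> tame \<Longrightarrow> fmul f g \<in> tame"
  using good_product_span product_span_mult unfolding tame_def by blast

lemma tame_rtrans: "f \<in> tame \<Longrightarrow> g \<in> carrier H \<Longrightarrow> rtrans g f \<in> tame"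
  using submoduleD(4)[OF good_submodule] unfolding tame_def by blast

lemma tame_ltrans: "f \<in> tame \<Longrightarrow> g \<in> carrier H \<Longrightarrow> ltrans g f \<in> tame"
  using good_ltrans unfolding tame_def by blast

text \<open>Tame functions are constant on the cosets of this subgroup and separate them, so it
  measures how far they are from being all functions.\<close>

definition tame_stabilizer :: "'a set" where
  "tame_stabilizer = {d \<in> carrier H. \<forall>f\<in>tame. \<forall>z\<in>carrier H. f (d \<otimes> z) = f z}"

text \<open>Invariance of \<open>f\<close> under the conjugate of \<open>d\<close> by
  \<open>x\<close> is invariance of \<open>ltrans x f\<close> under \<open>d\<close>, and left
  translates of tame functions are tame.\<close>

lemma tame_stabilizer_normal: "tame_stabilizer \<lhd> H"
proof (rule normal_invI)
  show "subgroup tame_stabilizer H"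
  proof (rule finite_closed_subgroup[OF finite_H])
    show "tame_stabilizer \<noteq> {}" unfolding tame_stabilizer_def by (auto intro!: exI[of _ \<one>])
  qed (auto simp: tame_stabilizer_def m_assoc)
  fix x d assume x: "x \<in> carrier H" and d: "d \<in> tame_stabilizer"
  have dc: "d \<in> carrier H" using d by (simp add: tame_stabilizer_def)
  have "f (x \<otimes> d \<otimes> inv x \<otimes> z) = f z" if f: "f \<in> tame" and z: "z \<in> carrier H" for f z
  proof -
    have "ltrans x f (d \<otimes> (inv x \<otimes> z)) = ltrans x f (inv x \<otimes> z)"
      using d tame_ltrans[OF f x] x z by (simp add: tame_stabilizer_def)
    then show ?thesis using x z dc by (simp add: ltrans_def group_simps)
  qed
  then show "x \<otimes> d \<otimes> inv x \<in> tame_stabilizer" using x dc by (simp add: tame_stabilizer_def)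
qed

lemma tame_separates:
  assumes g: "g \<in> carrier H" and h: "h \<in> carrier H" and n: "g \<otimes> inv h \<notin> tame_stabilizer"
  obtains e where "e \<in> tame" "e g = 1" "e h = 0"
proof -
  obtain f z where f: "f \<in> tame" "z \<in> carrier H" "f (g \<otimes> inv h \<otimes> z) \<noteq> f z"
    using n g h by (auto simp: tame_stabilizer_def)
  \<comment> \<open>The right translate moves the points
    \<open>g \<otimes> inv h \<otimes> z\<close> and \<open>z\<close>, where \<open>f\<close>
    differs, to \<open>g\<close> and \<open>h\<close>.\<close>
  define f' where "f' = rtrans (inv h \<otimes> z) f"
  have f': "f' \<in> tame" using tame_rtrans f h by (simp add: f'_def)
  have ne: "f' g \<noteq> f' h" using f g h by (simp add: f'_def rtrans_def group_simps)
  have bounds: "0 \<le> f' g" "f' g < int q" "0 \<le> f' h" "f' h < int q"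
    using tame_fns[OF f'] g h by (auto simp: fns_def)
  have "\<not> int q dvd f' g - f' h"
  proof
    assume "int q dvd f' g - f' h"
    then have "int q \<le> \<bar>f' g - f' h\<bar>" using ne dvd_imp_le_int[of "f' g - f' h" "int q"] by simp
    then show False using bounds by linarith
  qed
  then have "coprime (f' g - f' h) (int q)"
    using q by (metis coprime_commute prime_imp_coprime prime_nat_int_transfer)
  then obtain a b where ab: "a * (f' g - f' h) + b * int q = 1"
    using bezout_int[of "f' g - f' h" "int q"] by (metis coprime_imp_gcd_eq_1 mult.commute)
  have "a * (f' g - f' h) = 1 - b * int q" using ab by linarith
  then have "(a * (f' g - f' h)) mod int q = (1 - b * int q) mod int q" by simp
  also have "\<dots> = 1" using q_gt by (simp add: mod_simps mod_diff_right_eq[symmetric])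
  finally have inverse: "(a * (f' g - f' h)) mod int q = 1" .
  \<comment> \<open>The value at \<open>h\<close> is subtracted, and \<open>a\<close> inverts the
    difference of the two values modulo \<open>q\<close>.\<close>
  define e where "e = fmul (fconst a) (fadd f' (fconst (- f' h)))"
  have diff: "fadd f' (fconst (- f' h)) x = (f' x - f' h) mod int q" if "x \<in> carrier H" for x
    using that by (simp add: fadd_def fconst_def mod_simps)
  have "e \<in> tame" unfolding e_def by (intro tame_add tame_mul tame_const f')
  moreover have "e g = 1"
    using g inverse by (simp add: e_def fmul_def diff) (simp add: fconst_def mod_simps)
  moreover have "e h = 0"
    using h by (simp add: e_def fmul_def diff)
  ultimately show thesis by (rule that)
qed

text \<open>Functions that separate \<open>g\<close> from one point each are multiplied
  together.\<close>

lemma tame_peak: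
  assumes g: "g \<in> carrier H"
  obtains e where "e \<in> tame" "e g = 1" "\<And>h. h \<in> carrier H \<Longrightarrow> g \<otimes> inv h \<notin> tame_stabilizer \<Longrightarrow> e h = 0"
proof -
  let ?B = "{h \<in> carrier H. g \<otimes> inv h \<notin> tame_stabilizer}"
  have "\<exists>e\<in>tame. e g = 1 \<and> (\<forall>h\<in>B. e h = 0)" if "finite B" "B \<subseteq> ?B" for B
    using that
  proof (induction B)
    case empty
    have "fconst 1 g = 1" using g q_gt by (simp add: fconst_def)
    then show ?case using tame_const[of 1] by blast
  next
    case (insert h B)
    then obtain e where e: "e \<in> tame" "e g = 1" "\<forall>h\<in>B. e h = 0" by blast
    obtain e' where e': "e' \<in> tame" "e' g = 1" "e' h = 0"
      using tame_separates[OF g, of h] insert.prems by blast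
    have "fmul e e' g = 1" "\<forall>h\<in>insert h B. fmul e e' h = 0"
      using e e' q_gt by (auto simp: fmul_def)
    then show ?case using tame_mul[OF e(1) e'(1)] by blast
  qed
  from this[of ?B] finite_H show thesis using that by auto
qed

lemma tame_indicator:
  assumes S: "S \<subseteq> carrier H" and inv: "\<And>d x. d \<in> tame_stabilizer \<Longrightarrow> x \<in> S \<Longrightarrow> d \<otimes> x \<in> S"
  shows "(\<lambda>x. if x \<in> S then 1 else 0) \<in> tame"
proof -
  interpret stab: normal tame_stabilizer H by (rule tame_stabilizer_normal)
  have sym: "x \<otimes> inv g \<in> tame_stabilizer" if "g \<otimes> inv x \<in> tame_stabilizer" "g \<in> carrier H" "x \<in> carrier H" for g x
    using stab.m_inv_closed[OF that(1)] that(2,3) by (simp add: inv_mult_group)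
  have "\<exists>f\<in>tame. \<forall>x\<in>carrier H. f x = (if \<exists>g\<in>A. g \<otimes> inv x \<in> tame_stabilizer then 1 else 0)"
    if "finite A" "A \<subseteq> S" for A
    using that
  proof (induction A)
    case empty
    show ?case by (rule bexI[OF _ tame_const[of 0]]) (simp add: fconst_def)
  next
    case (insert a A)
    then obtain f where f: "f \<in> tame" "\<forall>x\<in>carrier H. f x = (if \<exists>g\<in>A. g \<otimes> inv x \<in> tame_stabilizer then 1 else 0)"
      by blast
    have a: "a \<in> carrier H" using insert.prems S by blast
    obtain e where e: "e \<in> tame" "e a = 1" "\<And>h. h \<in> carrier H \<Longrightarrow> a \<otimes> inv h \<notin> tame_stabilizer \<Longrightarrow> e h = 0"
      using tame_peak[OF a] by blast
    have e1: "e x = 1" if x: "x \<in> carrier H" "a \<otimes> inv x \<in> tame_stabilizer" for x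
    proof -
      have "e (x \<otimes> inv a \<otimes> a) = e a"
        using sym[OF x(2) a x(1)] e(1) a unfolding tame_stabilizer_def by blast
      then show ?thesis using e(2) x(1) a by (simp add: m_assoc)
    qed
    \<comment> \<open>On the values 0 and 1 the expression e + (1 - e) f is the maximum, so
      indicators of two unions of cosets combine to that of their union.\<close>
    define f' where "f' = fadd e (fmul (fadd (fconst 1) (fmul (fconst (- 1)) e)) f)"
    have "f' \<in> tame"
      unfolding f'_def by (intro tame_add tame_mul tame_const f(1) e(1))
    moreover have "f' x = (if \<exists>g\<in>insert a A. g \<otimes> inv x \<in> tame_stabilizer then 1 else 0)" if x: "x \<in> carrier H" for x
    proof -
      have "f' x = (e x + (1 - e x) * f x) mod int q"
      proof -
        have "fmul (fconst (- 1)) e x = (- e x) mod int q"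
          using x mod_mult_left_eq[of "- 1" "int q" "e x"] by (simp add: fmul_def fconst_def)
        then have "fadd (fconst 1) (fmul (fconst (- 1)) e) x = (1 - e x) mod int q"
          using x by (simp add: fadd_def fconst_def mod_simps)
        then have "fmul (fadd (fconst 1) (fmul (fconst (- 1)) e)) f x = ((1 - e x) * f x) mod int q"
          by (simp add: fmul_def mod_simps)
        then show ?thesis by (simp add: f'_def fadd_def mod_simps)
      qed
      moreover have "e x = (if a \<otimes> inv x \<in> tame_stabilizer then 1 else 0)"
        using e(3) e1 x by simp
      ultimately show ?thesis using f(2) x q_gt by auto
    qed
    ultimately show ?case by blast
  qed
  from this[of S] finite_subset[OF S finite_H]
  obtain f where f: "f \<in> tame" "\<forall>x\<in>carrier H. f x = (if \<exists>g\<in>S. g \<otimes> inv x \<in> tame_stabilizer then 1 else 0)"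
    by auto
  have mem: "(\<exists>g\<in>S. g \<otimes> inv x \<in> tame_stabilizer) \<longleftrightarrow> x \<in> S" if x: "x \<in> carrier H" for x
  proof
    assume "\<exists>g\<in>S. g \<otimes> inv x \<in> tame_stabilizer"
    then obtain g where g: "g \<in> S" "g \<otimes> inv x \<in> tame_stabilizer" by blast
    then have "g \<in> carrier H" using S by blast
    then have "x \<otimes> inv g \<otimes> g \<in> S" using inv[OF sym[OF g(2) _ x] g(1)] by simp
    then show "x \<in> S" using x \<open>g \<in> carrier H\<close> by (simp add: m_assoc)
  next
    assume "x \<in> S"
    then show "\<exists>g\<in>S. g \<otimes> inv x \<in> tame_stabilizer" using x by (intro bexI[of _ x]) auto
  qed
  have "f x = (if x \<in> S then 1 else 0)" for x
    using f(2) mem tame_fns[OF f(1)] S by (cases "x \<in> carrier H") (auto simp: fns_def)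
  then have "f = (\<lambda>x. if x \<in> S then 1 else 0)" by blast
  then show ?thesis using f(1) by simp
qed

text \<open>Single points are now cosets of the stabiliser, and every function is a combination of
  their indicators.\<close>

lemma tame_stabilizer_trivial:
  assumes triv: "tame_stabilizer = {\<one>}" and f: "f \<in> fns"
  shows "f \<in> tame"
proof -
  have "\<exists>f'\<in>tame. \<forall>x\<in>carrier H. f' x = (if x \<in> A then f x else 0)" if "finite A" "A \<subseteq> carrier H" for A
    using that
  proof (induction A)
    case empty
    show ?case by (rule bexI[OF _ tame_const[of 0]]) (simp add: fconst_def)
  next
    case (insert a A)
    then obtain f' where f': "f' \<in> tame" "\<forall>x\<in>carrier H. f' x = (if x \<in> A then f x else 0)" by blast
    have e: "(\<lambda>x. if x \<in> {a} then 1 else 0) \<in> tame" (is "?e \<in> _")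
      by (rule tame_indicator) (use insert.prems triv in auto)
    let ?f = "fadd f' (fmul (fconst (f a)) ?e)"
    have "?f \<in> tame" using tame_add[OF f'(1) tame_mul[OF tame_const e]] .
    moreover have "?f x = (if x \<in> insert a A then f x else 0)" if "x \<in> carrier H" for x
      using f'(2) that insert.hyps(2) fns_mod[OF f, of x] by (auto simp: fadd_def fmul_def fconst_def)
    ultimately show ?case by blast
  qed
  from this[of "carrier H"] obtain f' where f': "f' \<in> tame" "\<forall>x\<in>carrier H. f' x = f x"
    using finite_H by auto
  have "f' = f" using f' f tame_fns[OF f'(1)] by (intro ext) (metis (mono_tags, lifting) fns_def mem_Collect_eq)
  then show ?thesis using f'(1) by simp
qed

text \<open>The pairs \<open>(v y, y)\<close> with \<open>v \<in> V\<close> form a semidirect product of \<open>V\<close> with \<open>X\<close> inside \<open>X \<times> X\<close>,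
  which maps onto the semidirect product of the image of \<open>V\<close> with \<open>H\<close>.\<close>

lemma good_image:
  fixes X :: "('c, 'd) monoid_scheme" and \<mu> :: "'c \<Rightarrow> 'a \<Rightarrow> int"
  assumes X: "group X" and finX: "finite (carrier X)" and V: "V \<lhd> X"
    and B: "above_residual F X B"
    and \<phi>: "\<phi> \<in> hom X H" "\<phi> ` carrier X = carrier H"
    and \<mu>: "\<And>v. v \<in> V \<Longrightarrow> \<mu> v \<in> fns" "\<And>v w. v \<in> V \<Longrightarrow> w \<in> V \<Longrightarrow> \<mu> (v \<otimes>\<^bsub>X\<^esub> w) = fadd (\<mu> v) (\<mu> w)"
      "\<And>x v. x \<in> carrier X \<Longrightarrow> v \<in> V \<Longrightarrow> \<mu> (x \<otimes>\<^bsub>X\<^esub> v \<otimes>\<^bsub>X\<^esub> inv\<^bsub>X\<^esub> x) = rtrans (\<phi> x) (\<mu> v)"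
    and BB: "\<And>b. b \<in> B \<Longrightarrow> b \<in> carrier X \<Longrightarrow> \<phi> b = \<one>\<^bsub>H\<^esub>" "\<And>b. b \<in> B \<Longrightarrow> b \<in> V \<Longrightarrow> \<mu> b = fzero"
    and Bsub: "subgroup B X"
  shows "good (\<mu> ` V)"
proof -
  interpret X: group X by fact
  interpret V: normal V X by fact
  interpret \<phi>: group_hom X H \<phi> using \<phi>(1) X by (simp add: group_hom_def group_hom_axioms_def group_axioms)
  have \<mu>1: "\<mu> \<one>\<^bsub>X\<^esub> = fzero"
  proof -
    have "\<mu> \<one>\<^bsub>X\<^esub> = fadd (\<mu> \<one>\<^bsub>X\<^esub>) (\<mu> \<one>\<^bsub>X\<^esub>)" using \<mu>(2)[OF V.one_closed V.one_closed] by simp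
    then have "fadd (fneg (\<mu> \<one>\<^bsub>X\<^esub>)) (\<mu> \<one>\<^bsub>X\<^esub>) = fadd (fneg (\<mu> \<one>\<^bsub>X\<^esub>)) (fadd (\<mu> \<one>\<^bsub>X\<^esub>) (\<mu> \<one>\<^bsub>X\<^esub>))" by simp
    then show ?thesis using \<mu>(1)[OF V.one_closed] by (simp flip: fadd_ac(1))
  qed
  have sub: "submodule (\<mu> ` V)"
    unfolding submodule_def
  proof (intro conjI ballI)
    show "\<mu> ` V \<subseteq> fns" using \<mu>(1) by blast
    show "fzero \<in> \<mu> ` V" using \<mu>1 V.one_closed by (metis imageI)
    fix f assume "f \<in> \<mu> ` V"
    then obtain v where v: "v \<in> V" "f = \<mu> v" by blast
    show "fadd f g \<in> \<mu> ` V" if "g \<in> \<mu> ` V" for g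
      using that v by (auto simp flip: \<mu>(2))
    show "rtrans h f \<in> \<mu> ` V" if h: "h \<in> carrier H" for h
    proof -
      obtain x where "x \<in> carrier X" "h = \<phi> x" using h by (auto simp flip: \<phi>(2))
      then have "rtrans h f = \<mu> (x \<otimes>\<^bsub>X\<^esub> v \<otimes>\<^bsub>X\<^esub> inv\<^bsub>X\<^esub> x)" "x \<otimes>\<^bsub>X\<^esub> v \<otimes>\<^bsub>X\<^esub> inv\<^bsub>X\<^esub> x \<in> V"
        using v \<mu>(3) V.inv_op_closed2 by simp_all
      then show ?thesis by (metis imageI)
    qed
  qed
  let ?XX = "X \<times>\<times> X"
  define Y where "Y = {p \<in> carrier ?XX. fst p \<otimes>\<^bsub>X\<^esub> inv\<^bsub>X\<^esub> (snd p) \<in> V}"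
  have XX: "group ?XX" using DirProd_group[OF X X] .
  \<comment> \<open>The quotient of the components obeys a cocycle rule, with \<open>snd p\<close>
    acting by conjugation; this makes \<open>?t\<close> below a homomorphism.\<close>
  have split: "fst p \<otimes>\<^bsub>X\<^esub> fst p' \<otimes>\<^bsub>X\<^esub> inv\<^bsub>X\<^esub> (snd p \<otimes>\<^bsub>X\<^esub> snd p') =
      (fst p \<otimes>\<^bsub>X\<^esub> inv\<^bsub>X\<^esub> (snd p)) \<otimes>\<^bsub>X\<^esub> (snd p \<otimes>\<^bsub>X\<^esub> (fst p' \<otimes>\<^bsub>X\<^esub> inv\<^bsub>X\<^esub> (snd p')) \<otimes>\<^bsub>X\<^esub> inv\<^bsub>X\<^esub> (snd p))"
    if "p \<in> carrier ?XX" "p' \<in> carrier ?XX" for p p'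
    using that by (auto simp: X.group_simps)
  have "subgroup Y ?XX"
  proof (rule group.finite_closed_subgroup[OF XX])
    show "finite (carrier ?XX)" using finX by simp
    have "(\<one>\<^bsub>X\<^esub>, \<one>\<^bsub>X\<^esub>) \<in> Y" by (simp add: Y_def)
    then show "Y \<noteq> {}" by blast
    fix p p' assume "p \<in> Y" "p' \<in> Y"
    then have p: "p \<in> carrier ?XX" "p' \<in> carrier ?XX" "fst p \<otimes>\<^bsub>X\<^esub> inv\<^bsub>X\<^esub> (snd p) \<in> V" "fst p' \<otimes>\<^bsub>X\<^esub> inv\<^bsub>X\<^esub> (snd p') \<in> V"
      by (auto simp: Y_def)
    then have "snd p \<otimes>\<^bsub>X\<^esub> (fst p' \<otimes>\<^bsub>X\<^esub> inv\<^bsub>X\<^esub> (snd p')) \<otimes>\<^bsub>X\<^esub> inv\<^bsub>X\<^esub> (snd p) \<in> V"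
      by (intro V.inv_op_closed2) auto
    then show "p \<otimes>\<^bsub>?XX\<^esub> p' \<in> Y"
      using p split[OF p(1,2)] by (auto simp: Y_def mult_DirProd')
  qed (auto simp: Y_def)
  then have Y: "group (?XX\<lparr>carrier := Y\<rparr>)" by (rule group.subgroup_imp_group[OF XX])
  let ?Y = "?XX\<lparr>carrier := Y\<rparr>"
  have finY: "finite (carrier ?Y)" using finX by (auto simp: Y_def)
  let ?t = "\<lambda>p. (fzero, fzero, \<mu> (fst p \<otimes>\<^bsub>X\<^esub> inv\<^bsub>X\<^esub> (snd p)), \<phi> (snd p))"
  have t: "?t \<in> hom ?Y (semidirect (\<mu> ` V))"
  proof (rule homI)
    fix p assume p: "p \<in> carrier ?Y"
    then show "?t p \<in> carrier (semidirect (\<mu> ` V))" by (auto simp: Y_def heis_sub_def)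
    fix p' assume p': "p' \<in> carrier ?Y"
    have pc: "p \<in> carrier ?XX" "p' \<in> carrier ?XX" "fst p \<otimes>\<^bsub>X\<^esub> inv\<^bsub>X\<^esub> (snd p) \<in> V" "fst p' \<otimes>\<^bsub>X\<^esub> inv\<^bsub>X\<^esub> (snd p') \<in> V"
      using p p' by (auto simp: Y_def)
    let ?c = "snd p \<otimes>\<^bsub>X\<^esub> (fst p' \<otimes>\<^bsub>X\<^esub> inv\<^bsub>X\<^esub> (snd p')) \<otimes>\<^bsub>X\<^esub> inv\<^bsub>X\<^esub> (snd p)"
    have sp: "snd p \<in> carrier X" using pc(1) by auto
    have "\<mu> ?c = rtrans (\<phi> (snd p)) (\<mu> (fst p' \<otimes>\<^bsub>X\<^esub> inv\<^bsub>X\<^esub> (snd p')))"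
      by (rule \<mu>(3)[OF sp pc(4)])
    moreover have "?c \<in> V" by (rule V.inv_op_closed2[OF sp pc(4)])
    ultimately have eq: "\<mu> (fst p \<otimes>\<^bsub>X\<^esub> fst p' \<otimes>\<^bsub>X\<^esub> inv\<^bsub>X\<^esub> (snd p \<otimes>\<^bsub>X\<^esub> snd p')) =
        fadd (\<mu> (fst p \<otimes>\<^bsub>X\<^esub> inv\<^bsub>X\<^esub> (snd p))) (rtrans (\<phi> (snd p)) (\<mu> (fst p' \<otimes>\<^bsub>X\<^esub> inv\<^bsub>X\<^esub> (snd p'))))"
      unfolding split[OF pc(1,2)] using \<mu>(2)[OF pc(3)] by simp
    have "p \<otimes>\<^bsub>?Y\<^esub> p' = (fst p \<otimes>\<^bsub>X\<^esub> fst p', snd p \<otimes>\<^bsub>X\<^esub> snd p')"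
      by (simp add: mult_DirProd')
    moreover have "\<mu> (fst p \<otimes>\<^bsub>X\<^esub> inv\<^bsub>X\<^esub> (snd p)) \<in> fns"
      "rtrans (\<phi> (snd p)) (\<mu> (fst p' \<otimes>\<^bsub>X\<^esub> inv\<^bsub>X\<^esub> (snd p'))) \<in> fns"
      using \<mu>(1)[OF pc(3)] \<mu>(1)[OF pc(4)] sp by simp_all
    moreover have "snd p' \<in> carrier X" using pc(2) by auto
    ultimately show "?t (p \<otimes>\<^bsub>?Y\<^esub> p') = ?t p \<otimes>\<^bsub>semidirect (\<mu> ` V)\<^esub> ?t p'"
      using sp by (simp add: eq)
  qed
  have surj: "?t ` carrier ?Y = carrier (semidirect (\<mu> ` V))"
  proof
    show "carrier (semidirect (\<mu> ` V)) \<subseteq> ?t ` carrier ?Y"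
    proof
      fix z assume "z \<in> carrier (semidirect (\<mu> ` V))"
      then obtain v h where v: "v \<in> V" "h \<in> carrier H" "z = (fzero, fzero, \<mu> v, h)"
        by (auto simp: heis_sub_def)
      obtain x where x: "x \<in> carrier X" "h = \<phi> x" using v(2) by (auto simp flip: \<phi>(2))
      have "(v \<otimes>\<^bsub>X\<^esub> x, x) \<in> carrier ?Y" "z = ?t (v \<otimes>\<^bsub>X\<^esub> x, x)"
        using v x by (auto simp: Y_def X.m_assoc)
      then show "z \<in> ?t ` carrier ?Y" by blast
    qed
  qed (use hom_carrier[OF t] in simp)
  \<comment> \<open>Where both components lie in \<open>B\<close>, so does their quotient; then
    \<mu> vanishes on it and \<phi> is trivial on the second component.\<close>
  have "fst \<in> hom ?Y X" "snd \<in> hom ?Y X" by (auto simp: hom_def Y_def mult_DirProd')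
  from above_residual_Int[OF Y finY above_residual_hom[OF this(1) B] above_residual_hom[OF this(2) B]]
  have "above_residual F ?Y {p \<in> carrier ?Y. ?t p = \<one>\<^bsub>semidirect (\<mu> ` V)\<^esub>}"
  proof (rule above_residual_mono)
    fix p assume p: "p \<in> carrier ?Y" "p \<in> {x \<in> carrier ?Y. fst x \<in> B} \<inter> {x \<in> carrier ?Y. snd x \<in> B}"
    then have "fst p \<otimes>\<^bsub>X\<^esub> inv\<^bsub>X\<^esub> (snd p) \<in> B" "fst p \<otimes>\<^bsub>X\<^esub> inv\<^bsub>X\<^esub> (snd p) \<in> V" "snd p \<in> B" "snd p \<in> carrier X"
      using subgroup.m_closed[OF Bsub] subgroup.m_inv_closed[OF Bsub] by (auto simp: Y_def)
    then show "p \<in> {p \<in> carrier ?Y. ?t p = \<one>\<^bsub>semidirect (\<mu> ` V)\<^esub>}" using p BB by simp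
  qed
  then have "in_class (semidirect (\<mu> ` V)) F"
    by (rule in_class_image[OF t surj Y semidirect_group[OF sub]])
  then show ?thesis using sub by (simp add: good_def)
qed

end

section \<open>Functionals on elementary abelian groups\<close>

lemma ex_maximal_subset:
  assumes "finite S" "P K" "\<And>A. P A \<Longrightarrow> A \<subseteq> S"
  obtains A where "P A" "\<And>A'. P A' \<Longrightarrow> A \<subseteq> A' \<Longrightarrow> A' = A"
proof -
  obtain A where A: "P A" "\<forall>A'. P A' \<longrightarrow> card A' \<le> card A"
    using ex_has_greatest_nat[of P K card "Suc (card S)"] assms by (metis card_mono le_imp_less_Suc)
  then show thesis
    using that assms(1,3) by (metis card_seteq finite_subset)
qed

lemma ex_minimal_subset:
  assumes "finite S" "P K" "\<And>A. P A \<Longrightarrow> A \<subseteq> S"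
  obtains A where "P A" "\<And>A'. P A' \<Longrightarrow> A' \<subseteq> A \<Longrightarrow> A' = A"
proof -
  obtain A where A: "P A" "\<forall>A'. P A' \<longrightarrow> card A \<le> card A'"
    using ex_has_least_nat[of P K card] assms by blast
  then show thesis
    using that assms(1,3) by (metis card_seteq finite_subset)
qed

lemma bezout_mod_prime:
  assumes "prime q" "\<not> int q dvd i"
  obtains s t where "s * i + t * int q = 1"
proof -
  have "coprime i (int q)"
    using assms by (metis coprime_commute prime_imp_coprime prime_nat_int_transfer)
  then show thesis
    using bezout_int[of i "int q"] that by (metis coprime_imp_gcd_eq_1)
qed

text \<open>A subgroup \<open>A\<close> maximal among those containing \<open>B\<close> but not
  \<open>w\<close> is a complement to the cyclic group of \<open>w\<close>, and \<open>l v\<close>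
  is the exponent of \<open>w\<close> in the decomposition of \<open>v\<close>, modulo
  \<open>q\<close>.\<close>

lemma (in comm_group) ex_functional:
  assumes fin: "finite (carrier G)" and q: "prime q" and exp: "\<And>v. v \<in> carrier G \<Longrightarrow> v [^] q = \<one>"
    and B: "subgroup B G" and w: "w \<in> carrier G" "w \<notin> B"
  obtains l :: "'a \<Rightarrow> int" where "\<And>v. v \<in> carrier G \<Longrightarrow> l v \<in> {0..<int q}"
    "\<And>u v. u \<in> carrier G \<Longrightarrow> v \<in> carrier G \<Longrightarrow> l (u \<otimes> v) = (l u + l v) mod int q"
    "\<And>b. b \<in> B \<Longrightarrow> l b = 0" "l w \<noteq> 0"
proof -
  have q1: "int q > 1" using prime_gt_1_nat[OF q] by simp
  let ?P = "\<lambda>A. subgroup A G \<and> B \<subseteq> A \<and> w \<notin> A"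
  obtain A where A: "?P A" and max: "\<And>A'. ?P A' \<Longrightarrow> A \<subseteq> A' \<Longrightarrow> A' = A"
    using ex_maximal_subset[of "carrier G" ?P B] fin B w subgroup.subset by (metis order_refl)
  interpret A: subgroup A G using A by simp
  have expi: "v [^] (t * int q) = \<one>" if "v \<in> carrier G" for v t
    using that exp by (metis int_pow_int int_pow_one int_pow_pow mult.commute)
  have pow_mem: "q dvd nat \<bar>k\<bar>" if k: "w [^] k \<in> A" for k :: int
  proof (rule ccontr)
    assume "\<not> q dvd nat \<bar>k\<bar>"
    then have "\<not> int q dvd k" by (simp add: nat_dvd_iff int_dvd_int_iff[symmetric])
    then obtain s t where st: "s * k + t * int q = 1" using bezout_mod_prime[OF q] by blast
    have "w = w [^] (k * s + t * int q)" using st w(1) by (simp add: mult.commute)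
    also have "\<dots> = (w [^] k) [^] s" using w(1) expi by (simp add: int_pow_mult int_pow_pow)
    also have "\<dots> \<in> A" using subgroup_int_pow_closed[OF A.subgroup_axioms k] .
    finally show False using A by simp
  qed
  have ex: "\<exists>k::int. v \<otimes> w [^] (- k) \<in> A" if v: "v \<in> carrier G" for v
  proof (cases "v \<in> A")
    case True
    then show ?thesis using v by (intro exI[of _ 0]) simp
  next
    case False
    let ?A = "{a \<otimes> v [^] i |a i. a \<in> A \<and> (i::int) \<in> UNIV}"
    have sub: "subgroup ?A G"
    proof (rule subgroupI)
      show "?A \<subseteq> carrier G" using v by auto
      have "\<one> \<otimes> v [^] (0::int) \<in> ?A" using A.one_closed by blast
      then show "?A \<noteq> {}" by blast
      fix x assume "x \<in> ?A"
      then obtain a i where x: "x = a \<otimes> v [^] (i::int)" "a \<in> A" by blast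
      have "inv x = inv a \<otimes> v [^] (- i)"
        using x v by (simp add: inv_mult_group int_pow_neg m_comm)
      then show "inv x \<in> ?A" using x by blast
      fix y assume "y \<in> ?A"
      then obtain b j where y: "y = b \<otimes> v [^] (j::int)" "b \<in> A" by blast
      have "x \<otimes> y = (a \<otimes> b) \<otimes> v [^] (i + j)"
        using x y v by (simp add: int_pow_mult m_ac)
      then show "x \<otimes> y \<in> ?A" using x y by blast
    qed
    have AA: "A \<subseteq> ?A"
    proof
      fix a assume "a \<in> A"
      then have "a = a \<otimes> v [^] (0::int)" by simp
      then show "a \<in> ?A" using \<open>a \<in> A\<close> by blast
    qed
    have "v = \<one> \<otimes> v [^] (1::int)" using v by simp
    then have "v \<in> ?A" using A.one_closed by blast
    then have "?A \<noteq> A" using False by blast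
    then have "w \<in> ?A" using max[of ?A] sub AA A by blast
    \<comment> \<open>Maximality of \<open>A\<close> yields this relation. The exponent
      \<open>i\<close> is invertible modulo \<open>q\<close>, since otherwise \<open>w\<close> would
      lie in \<open>A\<close>, so the relation can be solved for \<open>v\<close>.\<close>
    then obtain a i where wi: "w = a \<otimes> v [^] (i::int)" "a \<in> A" by blast
    have "\<not> int q dvd i"
    proof
      assume "int q dvd i"
      then obtain t where "i = t * int q" by (metis dvdE mult.commute)
      then have "w = a" using wi expi[OF v] by simp
      then show False using wi A by simp
    qed
    then obtain s t where st: "s * i + t * int q = 1" using bezout_mod_prime[OF q] by blast
    have "v [^] i = inv a \<otimes> w" using wi v by (simp add: inv_cancel_left)
    moreover have "v = (v [^] i) [^] s"
    proof -
      have "v = v [^] (i * s + t * int q)" using st v by (simp add: mult.commute)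
      then show ?thesis using v expi[OF v] by (simp add: int_pow_mult int_pow_pow)
    qed
    ultimately have "v = (inv a) [^] s \<otimes> w [^] s"
      using int_pow_mult_distrib[of "inv a" w s] w(1) wi(2) m_comm[of "inv a" w] by simp
    then have "v \<otimes> w [^] (- s) = (inv a) [^] s"
      using w(1) wi(2) by (simp add: int_pow_neg m_assoc)
    moreover have "(inv a) [^] s \<in> A"
      using subgroup_int_pow_closed[OF A.subgroup_axioms] wi(2) by simp
    ultimately show ?thesis by metis
  qed
  define l where "l v = (SOME k. v \<otimes> w [^] (- k) \<in> A) mod int q" for v
  have l: "l v = k mod int q" if v: "v \<in> carrier G" and k: "v \<otimes> w [^] (- k) \<in> A" for v k
  proof -
    define k' :: int where "k' = (SOME k. v \<otimes> w [^] (- k) \<in> A)"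
    have k': "v \<otimes> w [^] (- k') \<in> A" unfolding k'_def using ex[OF v] by (rule someI_ex)
    have "inv (v \<otimes> w [^] (- k)) \<otimes> (v \<otimes> w [^] (- k')) \<in> A" using k k' by simp
    also have "inv (v \<otimes> w [^] (- k)) \<otimes> (v \<otimes> w [^] (- k')) = w [^] (k - k')"
      using v w(1) by (simp add: inv_mult_group m_assoc inv_cancel_left int_pow_neg int_pow_diff)
    finally have "q dvd nat \<bar>k - k'\<bar>" by (rule pow_mem)
    then have "int q dvd k - k'" by (simp add: nat_dvd_iff int_dvd_int_iff[symmetric])
    then show ?thesis by (simp add: l_def k'_def[symmetric] mod_eq_dvd_iff dvd_diff_commute)
  qed
  show thesis
  proof (rule that)
    show "l v \<in> {0..<int q}" for v using q1 by (simp add: l_def)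
    show "l (u \<otimes> v) = (l u + l v) mod int q" if uv: "u \<in> carrier G" "v \<in> carrier G" for u v
    proof -
      obtain j k :: int where jk: "u \<otimes> w [^] (- j) \<in> A" "v \<otimes> w [^] (- k) \<in> A"
        using ex[OF uv(1)] ex[OF uv(2)] by blast
      have "w [^] (- (j + k)) = w [^] (- j) \<otimes> w [^] (- k)"
        using int_pow_mult[OF w(1), of "- j" "- k"] by simp
      then have "(u \<otimes> v) \<otimes> w [^] (- (j + k)) = (u \<otimes> w [^] (- j)) \<otimes> (v \<otimes> w [^] (- k))"
        using uv w(1) by (simp add: m_ac del: minus_add_distrib)
      then have "(u \<otimes> v) \<otimes> w [^] (- (j + k)) \<in> A" using jk by simp
      from l[OF _ this] l[OF uv(1) jk(1)] l[OF uv(2) jk(2)] uv show ?thesis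
        by (simp add: mod_simps)
    qed
    show "l b = 0" if "b \<in> B" for b
      using l[of b 0] that A by auto
    show "l w \<noteq> 0" using l[of w 1] w(1) q1 by (simp add: int_pow_neg)
  qed
qed

lemma (in group) ex_functional_subgroup:
  assumes fin: "finite (carrier G)" and q: "prime q" and V: "subgroup V G"
    and comm: "\<And>u v. u \<in> V \<Longrightarrow> v \<in> V \<Longrightarrow> u \<otimes> v = v \<otimes> u" and exp: "\<And>v. v \<in> V \<Longrightarrow> v [^] q = \<one>"
    and B: "subgroup B G" "B \<subseteq> V" and w: "w \<in> V" "w \<notin> B"
  obtains l :: "'a \<Rightarrow> int" where "\<And>v. v \<in> V \<Longrightarrow> l v \<in> {0..<int q}"
    "\<And>u v. u \<in> V \<Longrightarrow> v \<in> V \<Longrightarrow> l (u \<otimes> v) = (l u + l v) mod int q"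
    "\<And>b. b \<in> B \<Longrightarrow> l b = 0" "l w \<noteq> 0"
proof -
  interpret V: comm_group "G\<lparr>carrier := V\<rparr>"
    by (rule group.group_comm_groupI[OF subgroup_imp_group[OF V]]) (use comm in simp)
  show thesis
    using V.ex_functional[of q B w] that fin q exp subgroup_incl[OF B(1) V B(2)] w subgroup_finite[OF fin V]
    by (auto simp: nat_pow_consistent[symmetric])
qed

section \<open>Groups of \<open>p\<close>-length at most one\<close>

text \<open>\<open>1 \<le> C \<le> R \<le> G\<close> with \<open>C\<close> and \<open>G/R\<close> of order prime to \<open>p\<close> and \<open>R/C\<close> a \<open>p\<close>-group.\<close>

definition p_series :: "nat \<Rightarrow> ('a, 'b) monoid_scheme \<Rightarrow> 'a set \<Rightarrow> 'a set \<Rightarrow> bool" where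
  "p_series p G C R \<longleftrightarrow> C \<lhd> G \<and> R \<lhd> G \<and> C \<subseteq> R \<and>
     (\<forall>x\<in>C. \<exists>k::nat. \<not> p dvd k \<and> x [^]\<^bsub>G\<^esub> k = \<one>\<^bsub>G\<^esub>) \<and>
     (\<forall>x\<in>R. \<exists>k. x [^]\<^bsub>G\<^esub> (p ^ k) \<in> C) \<and>
     (\<forall>x\<in>carrier G. \<exists>k::nat. \<not> p dvd k \<and> x [^]\<^bsub>G\<^esub> k \<in> R)"

section \<open>The largest normal \<pi>-subgroup and the upper series\<close>

abbreviation pi_subgroup :: "nat set \<Rightarrow> 'a set \<Rightarrow> bool" where
  "pi_subgroup \<pi> N \<equiv> \<forall>q. prime q \<and> q dvd card N \<longrightarrow> q \<in> \<pi>"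

lemma (in group) coset_eq_iff: "N \<lhd> G \<Longrightarrow> x \<in> carrier G \<Longrightarrow> N #> x = N \<longleftrightarrow> x \<in> N"
  by (metis normal_imp_subgroup coset_join1 coset_join2 subgroup.subset)

text \<open>\<open>R\<close> is the product of \<open>N\<close> and \<open>N'\<close>, written as a
  preimage; its order is \<open>card N\<close> times a divisor of \<open>card N'\<close>.\<close>

lemma (in group) pi_subgroup_mult:
  assumes fin: "finite (carrier G)" and N: "N \<lhd> G" "pi_subgroup \<pi> N" "N' \<lhd> G" "pi_subgroup \<pi> N'"
  obtains R where "R \<lhd> G" "pi_subgroup \<pi> R" "N \<subseteq> R" "N' \<subseteq> R"
proof -
  interpret N: normal N G by fact
  interpret N': normal N' G by fact
  let ?f = "(#>) N"
  have Q: "group (G Mod N)" by (rule N.factorgroup_is_group)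
  have f: "?f \<in> hom G (G Mod N)" by (rule N.r_coset_hom_Mod)
  interpret f: group_hom G "G Mod N" ?f using f Q by (simp add: group_hom_def group_hom_axioms_def)
  have surj: "?f ` carrier G = carrier (G Mod N)" by (simp add: carrier_FactGroup)
  have imgN: "?f ` N' \<lhd> G Mod N"
    by (rule N'.surj_hom_normal_subgroup[OF f.group_hom_axioms surj])
  define R where "R = {x \<in> carrier G. ?f x \<in> ?f ` N'}"
  have R: "R \<lhd> G" unfolding R_def by (rule preimage_normal[OF f is_group Q imgN])
  have N'R: "N' \<subseteq> R" using N'.subset by (auto simp: R_def)
  have NR: "N \<subseteq> R"
  proof
    fix x assume x: "x \<in> N"
    then have "?f x = ?f \<one>" using coset_eq_iff[OF N(1), of x] coset_eq_iff[OF N(1), of \<one>] by auto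
    then show "x \<in> R" using x N.subset unfolding R_def by (auto intro: image_eqI[of _ _ \<one>])
  qed
  have fR: "?f \<in> hom (G\<lparr>carrier := R\<rparr>) (G Mod N)" and fN': "?f \<in> hom (G\<lparr>carrier := N'\<rparr>) (G Mod N)"
    using f.induced_group_hom'[OF normal_imp_subgroup[OF R]] f.induced_group_hom'[OF N'.subgroup_axioms]
    by (simp_all add: group_hom.homh)
  have "kernel (G\<lparr>carrier := R\<rparr>) (G Mod N) ?f = N"
    using coset_eq_iff[OF N(1)] NR normal_subset[OF R] by (auto simp: kernel_def)
  moreover have "?f ` R = ?f ` N'" using N'R by (auto simp: R_def)
  ultimately have "card (?f ` N') * card N = card R"
    using hom_card[OF fR subgroup_imp_group[OF normal_imp_subgroup[OF R]] Q] by (simp add: order_def)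
  moreover have "card (?f ` N') dvd card N'"
    using hom_card[OF fN' subgroup_imp_group[OF N'.subgroup_axioms] Q]
    by (simp add: order_def) (metis dvd_triv_left)
  ultimately have "pi_subgroup \<pi> R"
    using N(2,4) by (metis dvd_trans prime_dvd_mult_iff)
  then show thesis using that R NR N'R by blast
qed

text \<open>\<open>pi_core\<close> asks for a greatest element with respect to inclusion. A maximal
  normal \<pi>-subgroup is one, since together with any other it lies in a third.\<close>

lemma (in group) pi_core:
  assumes fin: "finite (carrier G)"
  shows "pi_core \<pi> G \<lhd> G" "pi_subgroup \<pi> (pi_core \<pi> G)"
    and "N \<lhd> G \<Longrightarrow> pi_subgroup \<pi> N \<Longrightarrow> N \<subseteq> pi_core \<pi> G"
proof -
  let ?P = "\<lambda>N. N \<lhd> G \<and> pi_subgroup \<pi> N"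
  have "?P {\<one>}" using one_is_normal by auto
  then obtain A where A: "?P A" "\<And>A'. ?P A' \<Longrightarrow> A \<subseteq> A' \<Longrightarrow> A' = A"
  proof (rule ex_maximal_subset[of "carrier G" ?P "{\<one>}", OF fin])
    show "A \<subseteq> carrier G" if "?P A" for A using that normal_subset by blast
  qed (use \<open>?P {\<one>}\<close> in blast)+
  have le: "N \<subseteq> A" if N: "?P N" for N
  proof -
    obtain R where "R \<lhd> G" "pi_subgroup \<pi> R" "A \<subseteq> R" "N \<subseteq> R"
      by (rule pi_subgroup_mult[OF fin, of A \<pi> N]) (use A(1) N in blast)+
    then show ?thesis using A(2)[of R] by simp
  qed
  have eq: "pi_core \<pi> G = A"
    unfolding pi_core_def by (rule Greatest_equality) (use A(1) le in auto)
  show "pi_core \<pi> G \<lhd> G" "pi_subgroup \<pi> (pi_core \<pi> G)" using A(1) eq by auto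
  show "N \<lhd> G \<Longrightarrow> pi_subgroup \<pi> N \<Longrightarrow> N \<subseteq> pi_core \<pi> G" using le eq by simp
qed

lemma (in group) pi_core_above:
  assumes fin: "finite (carrier G)" and N: "N \<lhd> G"
  shows "pi_core_above \<pi> G N \<lhd> G" "N \<subseteq> pi_core_above \<pi> G N"
proof -
  interpret N: normal N G by fact
  interpret Q: group "G Mod N" by (rule N.factorgroup_is_group)
  have finQ: "finite (carrier (G Mod N))" using fin by (simp add: carrier_FactGroup)
  show "pi_core_above \<pi> G N \<lhd> G"
    unfolding pi_core_above_def
    by (rule preimage_normal[OF N.r_coset_hom_Mod is_group Q.group_axioms Q.pi_core(1)[OF finQ]])
  show "N \<subseteq> pi_core_above \<pi> G N"
  proof
    fix x assume x: "x \<in> N"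
    then have "N #> x = N" using coset_eq_iff[OF N, of x] by simp
    moreover have "N \<in> pi_core \<pi> (G Mod N)"
      using subgroup.one_closed[OF normal_imp_subgroup[OF Q.pi_core(1)[OF finQ, of \<pi>]]] by simp
    ultimately show "x \<in> pi_core_above \<pi> G N" using x by (simp add: pi_core_above_def)
  qed
qed

lemma (in group) pi_core_above_pow:
  assumes fin: "finite (carrier G)" and N: "N \<lhd> G" and x: "x \<in> pi_core_above \<pi> G N"
  obtains k where "x [^] k \<in> N" "k > 0" "\<And>r. prime r \<Longrightarrow> r dvd k \<Longrightarrow> r \<in> \<pi>"
proof -
  interpret N: normal N G by fact
  interpret Q: group "G Mod N" by (rule N.factorgroup_is_group)
  interpret f: group_hom G "G Mod N" "(#>) N"
    using N.r_coset_hom_Mod is_group Q.group_axioms by (simp add: group_hom_def group_hom_axioms_def)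
  have finQ: "finite (carrier (G Mod N))" using fin by (simp add: carrier_FactGroup)
  let ?C = "pi_core \<pi> (G Mod N)"
  have C: "subgroup ?C (G Mod N)" using normal_imp_subgroup[OF Q.pi_core(1)[OF finQ]] .
  have xc: "x \<in> carrier G" and xC: "N #> x \<in> ?C" using x by (auto simp: pi_core_above_def)
  have "N #> (x [^] card ?C) = (N #> x) [^]\<^bsub>G Mod N\<^esub> card ?C" using f.hom_nat_pow[OF xc] .
  also have "\<dots> = N" using Q.subgroup_pow_card[OF C finQ xC] by simp
  finally have "x [^] card ?C \<in> N" using coset_eq_iff[OF N] xc by simp
  moreover have "card ?C > 0" using subgroup.finite_imp_card_positive[OF C finQ] .
  ultimately show thesis using that Q.pi_core(2)[OF finQ] by blast
qed

lemma (in group) derived_trivial_commute: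
  assumes A: "A \<subseteq> carrier G" and dA: "derived G A = {\<one>}" and xy: "x \<in> A" "y \<in> A"
  shows "x \<otimes> y = y \<otimes> x"
proof -
  have c: "x \<in> carrier G" "y \<in> carrier G" using A xy by auto
  have "x \<otimes> y \<otimes> inv x \<otimes> inv y \<in> derived G A"
    unfolding derived_def using xy by (intro generate.incl) blast
  then have "x \<otimes> y \<otimes> inv x \<otimes> inv y = \<one>" using dA by simp
  then have "x \<otimes> y = \<one> \<otimes> y \<otimes> x"
    using c by (metis inv_closed inv_inv inv_solve_right' m_closed one_closed)
  then show ?thesis using c by simp
qed

text \<open>The last nontrivial derived subgroup \<open>A\<close> is abelian, and for a prime
  \<open>r\<close> dividing its order the elements killed by \<open>r\<close> form a subgroup
  preserved by conjugation.\<close>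

lemma (in group) solvable_ex_normal_p_subgroup:
  assumes fin: "finite (carrier G)" and sol: "solvable G" and nt: "carrier G \<noteq> {\<one>}"
  obtains Y r n where "Y \<lhd> G" "Y \<noteq> {\<one>}" "prime r" "card Y = r ^ n"
proof -
  let ?D = "\<lambda>n. (derived G ^^ n) (carrier G)"
  have ex: "\<exists>n. ?D n = {\<one>}" using sol solvable_iff_trivial_derived_seq by blast
  define n where "n = (LEAST n. ?D n = {\<one>})"
  have n: "?D n = {\<one>}" unfolding n_def using ex by (rule LeastI_ex)
  have "n \<noteq> 0"
  proof
    assume "n = 0"
    then show False using n nt by simp
  qed
  then obtain m where m: "n = Suc m" using not0_implies_Suc by blast
  define A where "A = ?D m"
  have A1: "A \<noteq> {\<one>}" using not_less_Least[of m "\<lambda>n. ?D n = {\<one>}"] m by (auto simp: A_def n_def)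
  have "?D k \<lhd> G" for k by (induction k) (use normal_self derived_is_normal in auto)
  then have A: "A \<lhd> G" by (simp add: A_def)
  interpret A: normal A G by (rule A)
  have dA: "derived G A = {\<one>}" using n m by (simp add: A_def)
  note comm = derived_trivial_commute[OF A.subset dA]
  have "card A \<noteq> 1" using A1 A.one_closed by (metis card_1_singletonE singletonD)
  then obtain r where r: "prime r" "r dvd card A" using prime_factor_nat by blast
  define Y where "Y = {a \<in> A. a [^] r = \<one>}"
  have subY: "subgroup Y G"
    by (rule subgroupI) (auto simp: Y_def pow_mult_distrib comm nat_pow_inv intro: exI[of _ \<one>])
  have "Y \<lhd> G"
  proof (rule normal_invI[OF subY])
    fix x y assume x: "x \<in> carrier G" and y: "y \<in> Y"
    interpret c: group_hom G G "\<lambda>y. x \<otimes> y \<otimes> inv x"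
      using conjugation_iso[OF x] by (simp add: group_hom_def group_hom_axioms_def iso_def)
    have "(x \<otimes> y \<otimes> inv x) [^] r = x \<otimes> y [^] r \<otimes> inv x"
      by (rule c.hom_nat_pow[symmetric]) (use y in \<open>simp add: Y_def\<close>)
    then show "x \<otimes> y \<otimes> inv x \<in> Y" using x y A.inv_op_closed2 by (simp add: Y_def)
  qed
  moreover have "Y \<noteq> {\<one>}"
    using cauchy[OF fin r(1) A.subgroup_axioms r(2)] by (auto simp: Y_def)
  moreover obtain k where "card Y = r ^ k"
    using p_group_card[OF fin subY r(1)] by (auto simp: Y_def) (metis power_one_right)
  ultimately show thesis using that r(1) by blast
qed

lemma (in group) upper_series_normal:
  "finite (carrier G) \<Longrightarrow> upper_series p G i \<lhd> G"
  by (induction i) (simp_all add: pi_core(1) pi_core_above(1))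

text \<open>If the p-step adds nothing, the soluble quotient still has a nontrivial normal
  r-subgroup for some prime \<open>r\<close>; the p-step would have caught it for
  \<open>r = p\<close>, and the p'-step catches it otherwise.\<close>

lemma (in group) upper_series_grows:
  assumes fin: "finite (carrier G)" and sol: "solvable G"
    and ne: "upper_series p G i \<noteq> carrier G"
  shows "upper_series p G i \<subset> upper_series p G (Suc i)"
proof -
  let ?N = "upper_series p G i"
  let ?P = "pi_core_above {p} G ?N"
  have N: "?N \<lhd> G" using upper_series_normal[OF fin] .
  have P: "?P \<lhd> G" "?N \<subseteq> ?P" using pi_core_above[OF fin N] by auto
  have PU: "?P \<subseteq> upper_series p G (Suc i)" using pi_core_above(2)[OF fin P(1)] by simp
  show ?thesis
  proof (cases "?P = ?N")
    case False
    then show ?thesis using P PU by blast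
  next
    case True
    interpret N: normal ?N G by (rule N)
    interpret Q: group "G Mod ?N" by (rule N.factorgroup_is_group)
    interpret f: group_hom G "G Mod ?N" "(#>) ?N"
      using N.r_coset_hom_Mod is_group Q.group_axioms by (simp add: group_hom_def group_hom_axioms_def)
    have surj: "(#>) ?N ` carrier G = carrier (G Mod ?N)" by (simp add: carrier_FactGroup)
    have finQ: "finite (carrier (G Mod ?N))" using fin by (simp add: carrier_FactGroup)
    have solQ: "solvable (G Mod ?N)" using f.surj_hom_imp_solvable[OF surj sol] .
    have "carrier (G Mod ?N) \<noteq> {\<one>\<^bsub>G Mod ?N\<^esub>}"
    proof
      assume "carrier (G Mod ?N) = {\<one>\<^bsub>G Mod ?N\<^esub>}"
      then have "?N #> x = ?N" if "x \<in> carrier G" for x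
        using f.hom_closed[OF that] by simp
      then have "carrier G \<subseteq> ?N" using coset_eq_iff[OF N] by blast
      then show False using ne N.subset by blast
    qed
    from Q.solvable_ex_normal_p_subgroup[OF finQ solQ this]
    obtain Y r n where Y: "Y \<lhd> G Mod ?N" "Y \<noteq> {\<one>\<^bsub>G Mod ?N\<^esub>}" "prime r" "card Y = r ^ n" by blast
    obtain y where y: "y \<in> Y" "y \<noteq> ?N"
      using Y(2) subgroup.one_closed[OF normal_imp_subgroup[OF Y(1)]] by auto
    obtain x where x: "x \<in> carrier G" "y = ?N #> x"
      using normal_subset[OF Y(1)] y(1) surj by blast
    have xN: "x \<notin> ?N" using x y(2) coset_eq_iff[OF N] by blast
    have piY: "r' = r" if "prime r'" "r' dvd card Y" for r'
      using that Y(3,4) by (metis prime_dvd_power primes_dvd_imp_eq)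
    show ?thesis
    proof (cases "r = p")
      case True
      then have "pi_subgroup {p} Y" using piY by simp
      then have "Y \<subseteq> pi_core {p} (G Mod ?N)" by (rule Q.pi_core(3)[OF finQ Y(1)])
      then have "x \<in> ?P" using x y by (auto simp: pi_core_above_def)
      then show ?thesis using P PU xN by blast
    next
      case False
      then have "pi_subgroup (- {p}) Y" using piY False by blast
      then have "Y \<subseteq> pi_core (- {p}) (G Mod ?N)" by (rule Q.pi_core(3)[OF finQ Y(1)])
      then have "x \<in> pi_core_above (- {p}) G ?N" using x y by (auto simp: pi_core_above_def)
      then have "x \<in> upper_series p G (Suc i)" using \<open>?P = ?N\<close> by simp
      then show ?thesis using P PU xN by blast
    qed
  qed
qed

text \<open>The \<open>LEAST\<close> in \<open>p_length\<close> is attained because a strictly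
  growing series of subgroups must reach the whole finite group.\<close>

lemma (in group) upper_series_p_length:
  assumes fin: "finite (carrier G)" and sol: "solvable G"
  shows "upper_series p G (p_length p G) = carrier G"
proof -
  have "\<exists>l. upper_series p G l = carrier G"
  proof (rule ccontr)
    assume ne: "\<nexists>l. upper_series p G l = carrier G"
    have "i \<le> card (upper_series p G i)" for i
    proof (induction i)
      case (Suc i)
      have "upper_series p G i \<subset> upper_series p G (Suc i)"
        using upper_series_grows[OF fin sol] ne by blast
      moreover have "finite (upper_series p G (Suc i))"
        using normal_subset[OF upper_series_normal[OF fin]] fin by (rule finite_subset)
      ultimately have "card (upper_series p G i) < card (upper_series p G (Suc i))"
        by (rule psubset_card_mono[rotated])
      then show ?case using Suc by linarith
    qed simp
    then have "Suc (order G) \<le> card (upper_series p G (Suc (order G)))" by blast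
    moreover have "card (upper_series p G (Suc (order G))) \<le> order G"
      unfolding order_def using normal_subset[OF upper_series_normal[OF fin]] fin by (intro card_mono)
    ultimately show False by simp
  qed
  then show ?thesis unfolding p_length_def by (rule LeastI_ex)
qed

text \<open>The bound on the p-length is stated for primes dividing the order; for the others
  \<open>C\<close> and \<open>R\<close> are both the whole group. If \<open>p\<close> divides the
  order, the p-length is exactly 1, since p-length 0 would make the order prime to
  \<open>p\<close>.\<close>

lemma L_a1_p_series:
  assumes G: "G \<in> L_a1" and p: "prime p"
  obtains C R where "p_series p G C R"
proof -
  have G': "group G" "finite (carrier G)" "solvable G" "\<And>p. p \<in> primes_of G \<Longrightarrow> p_length p G \<le> 1"
    using G by (auto simp: L_a1_def)
  interpret group G by (rule G')
  let ?C = "pi_core (- {p}) G"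
  note fin = G'(2)
  have card_pow: "x [^]\<^bsub>G\<^esub> card K = \<one>\<^bsub>G\<^esub>" if "subgroup K G" "x \<in> K" for x K
    using subgroup_pow_card[OF that(1) fin that(2)] .
  have whole: "p_series p G (carrier G) (carrier G)" if "\<not> p dvd order G"
    using that normal_self card_pow[OF subgroup_self] subgroup_self
    by (auto simp: p_series_def order_def intro!: exI[of _ "card (carrier G)"])
  show thesis
  proof (cases "p dvd order G \<and> upper_series p G 0 \<noteq> carrier G")
    case False
    have "\<not> p dvd order G"
    proof
      assume "p dvd order G"
      then have "?C = carrier G" using False by simp
      then show False using pi_core(2)[OF fin, of "- {p}"] \<open>p dvd order G\<close> p by (auto simp: order_def)
    qed
    then show thesis using whole that by blast
  next
    case True
    then have "p_length p G \<le> 1" using G'(4) p by (simp add: primes_of_def)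
    moreover have "p_length p G \<noteq> 0" using True upper_series_p_length[OF fin G'(3), of p] by metis
    ultimately have "p_length p G = 1" by simp
    then have top: "pi_core_above (- {p}) G (pi_core_above {p} G ?C) = carrier G"
      using upper_series_p_length[OF fin G'(3), of p] by simp
    let ?R = "pi_core_above {p} G ?C"
    have C: "?C \<lhd> G" "subgroup ?C G" using pi_core(1)[OF fin] normal_imp_subgroup by blast+
    have R: "?R \<lhd> G" "?C \<subseteq> ?R" using pi_core_above[OF fin C(1)] by auto
    have "p_series p G ?C ?R"
      unfolding p_series_def
    proof (intro conjI ballI C(1) R)
      fix x assume "x \<in> ?C"
      moreover have "\<not> p dvd card ?C" using pi_core(2)[OF fin, of "- {p}"] p by blast
      ultimately show "\<exists>k::nat. \<not> p dvd k \<and> x [^]\<^bsub>G\<^esub> k = \<one>\<^bsub>G\<^esub>" using card_pow[OF C(2)] by blast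
    next
      fix x assume "x \<in> ?R"
      then obtain k where k: "x [^]\<^bsub>G\<^esub> k \<in> ?C" "k > 0" "\<And>r. prime r \<Longrightarrow> r dvd k \<Longrightarrow> r \<in> {p}"
        using pi_core_above_pow[OF fin C(1)] by blast
      obtain n m where nm: "k = p ^ n * m" "\<not> p dvd m"
        using multiplicity_decompose'[of k p] k(2) p by (metis neq0_conv not_prime_unit)
      have "m = 1"
      proof (rule ccontr)
        assume "m \<noteq> 1"
        then obtain r where "prime r" "r dvd m" using prime_factor_nat by blast
        then show False using k(3)[of r] nm by auto
      qed
      then show "\<exists>k. x [^]\<^bsub>G\<^esub> (p ^ k) \<in> ?C" using k(1) nm by auto
    next
      fix x assume "x \<in> carrier G"
      then obtain k where k: "x [^]\<^bsub>G\<^esub> k \<in> ?R" "k > 0" "\<And>r. prime r \<Longrightarrow> r dvd k \<Longrightarrow> r \<in> - {p}"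
        using pi_core_above_pow[OF fin R(1), of x "- {p}"] top by blast
      then show "\<exists>k::nat. \<not> p dvd k \<and> x [^]\<^bsub>G\<^esub> k \<in> ?R" using p by blast
    qed
    then show thesis using that by blast
  qed
qed

lemma p_series_iso:
  assumes f: "f \<in> iso G Q" and G: "group G" and Q: "group Q" and S: "p_series p Q C R"
  shows "p_series p G {x \<in> carrier G. f x \<in> C} {x \<in> carrier G. f x \<in> R}"
proof -
  interpret group_hom G Q f using f G Q by (simp add: group_hom_def group_hom_axioms_def iso_def)
  have inj: "x = \<one>\<^bsub>G\<^esub>" if "x \<in> carrier G" "f x = \<one>\<^bsub>Q\<^esub>" for x
    using f that inj_onD[of f "carrier G" x "\<one>\<^bsub>G\<^esub>"] by (auto simp: iso_def bij_betw_def)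
  have C: "C \<lhd> Q" "R \<lhd> Q" "C \<subseteq> R" using S by (auto simp: p_series_def)
  show ?thesis
    unfolding p_series_def
  proof (intro conjI ballI preimage_normal[OF homh G Q] C(1,2))
    show "{x \<in> carrier G. f x \<in> C} \<subseteq> {x \<in> carrier G. f x \<in> R}" using C(3) by blast
    fix x assume "x \<in> {x \<in> carrier G. f x \<in> C}"
    moreover from this obtain k where "\<not> p dvd k" "f x [^]\<^bsub>Q\<^esub> k = \<one>\<^bsub>Q\<^esub>" using S by (auto simp: p_series_def)
    ultimately show "\<exists>k::nat. \<not> p dvd k \<and> x [^]\<^bsub>G\<^esub> k = \<one>\<^bsub>G\<^esub>"
      using inj[of "x [^]\<^bsub>G\<^esub> k"] by (auto simp: hom_nat_pow)
  next
    fix x assume "x \<in> {x \<in> carrier G. f x \<in> R}"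
    moreover from this obtain k where "f x [^]\<^bsub>Q\<^esub> (p ^ k) \<in> C" using S by (auto simp: p_series_def)
    ultimately show "\<exists>k. x [^]\<^bsub>G\<^esub> (p ^ k) \<in> {x \<in> carrier G. f x \<in> C}"
      by (intro exI[of _ k]) (simp add: hom_nat_pow)
  next
    fix x assume x: "x \<in> carrier G"
    then obtain k where "\<not> p dvd k" "f x [^]\<^bsub>Q\<^esub> k \<in> R"
      using S hom_closed[OF x] unfolding p_series_def by blast
    then show "\<exists>k::nat. \<not> p dvd k \<and> x [^]\<^bsub>G\<^esub> k \<in> {x \<in> carrier G. f x \<in> R}"
      using x by (intro exI[of _ k]) (simp add: hom_nat_pow)
  qed
qed

text \<open>Modulo \<open>C\<close>, the normal p-subgroup R/C lies in the image of
  \<open>P\<close>, so R = C P. Conjugacy of Sylow subgroups inside \<open>R\<close> writes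
  \<open>G\<close> as \<open>R\<close> times the normaliser of \<open>P\<close>, hence as
  \<open>C\<close> times it. A commutator of \<open>c\<close> and \<open>y\<close> lies in both
  \<open>C\<close> and \<open>P\<close>, which meet trivially.\<close>

lemma (in group) p_series_sylow:
  assumes fin: "finite (carrier G)" and p: "prime p" and P: "sylow_subgroup p P G"
    and S: "p_series p G C R"
  shows "\<And>g. g \<in> carrier G \<Longrightarrow> \<exists>c\<in>C. \<exists>l\<in>normalizer G P. g = c \<otimes> l"
    and "\<And>c y. c \<in> C \<Longrightarrow> c \<in> normalizer G P \<Longrightarrow> y \<in> P \<Longrightarrow> c \<otimes> y = y \<otimes> c"
proof -
  have C: "C \<lhd> G" "R \<lhd> G" "C \<subseteq> R" using S by (auto simp: p_series_def)
  interpret C: normal C G by (rule C)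
  interpret R: normal R G by (rule C)
  have Psub: "subgroup P G" "card P = p ^ multiplicity p (order G)"
    using P by (auto simp: sylow_subgroup_def)
  interpret P: subgroup P G by (rule Psub)
  have Ppow: "y [^] (p ^ multiplicity p (order G)) = \<one>" if "y \<in> P" for y
    using subgroup_pow_card[OF Psub(1) fin that] Psub(2) by simp
  have coprime_pow: "coprime (p ^ n) k" if "\<not> p dvd k" for n k
    using that p by (metis coprime_power_left_iff prime_imp_coprime)
  have PR: "P \<subseteq> R"
  proof
    fix y assume y: "y \<in> P"
    then obtain k where k: "\<not> p dvd k" "y [^] k \<in> R" using S P.mem_carrier unfolding p_series_def by blast
    have "y [^] (p ^ multiplicity p (order G)) \<in> R" using Ppow[OF y] by simp
    from pow_gcd_one[OF P.mem_carrier[OF y] this k(2) coprime_pow[OF k(1)] R.subgroup_axioms]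
    show "y \<in> R" .
  qed
  have CP1: "x = \<one>" if x: "x \<in> C" "x \<in> P" for x
  proof -
    obtain k where k: "\<not> p dvd k" "x [^] k = \<one>" using S x(1) unfolding p_series_def by blast
    have "x [^] (p ^ multiplicity p (order G)) \<in> {\<one>}" "x [^] k \<in> {\<one>}"
      using Ppow[OF x(2)] k(2) by simp_all
    from pow_gcd_one[OF P.mem_carrier[OF x(2)] this coprime_pow[OF k(1)] triv_subgroup]
    show ?thesis by simp
  qed
  let ?f = "(#>) C"
  interpret Q: group "G Mod C" by (rule C.factorgroup_is_group)
  interpret f: group_hom G "G Mod C" ?f
    using C.r_coset_hom_Mod is_group Q.group_axioms by (simp add: group_hom_def group_hom_axioms_def)
  have surj: "?f ` carrier G = carrier (G Mod C)" by (simp add: carrier_FactGroup)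
  have finQ: "finite (carrier (G Mod C))" using fin by (simp add: carrier_FactGroup)
  have fP: "sylow_subgroup p (?f ` P) (G Mod C)"
    by (rule sylow_subgroup_image(1)[OF f.homh surj is_group Q.group_axioms fin p P])
  have fR: "?f ` R \<lhd> G Mod C" by (rule R.surj_hom_normal_subgroup[OF f.group_hom_axioms surj])
  have "\<exists>k. z [^]\<^bsub>G Mod C\<^esub> (p ^ k) = \<one>\<^bsub>G Mod C\<^esub>" if z: "z \<in> ?f ` R" for z
  proof -
    obtain x where x: "x \<in> R" "z = C #> x" using z by blast
    obtain k where "x [^] (p ^ k) \<in> C" using S x(1) by (auto simp: p_series_def)
    then have "C #> (x [^] (p ^ k)) = C" using coset_eq_iff[OF C(1)] x(1) by simp
    then show ?thesis using f.hom_nat_pow[of x "p ^ k"] x by auto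
  qed
  from Q.p_group_card[OF finQ normal_imp_subgroup[OF fR] p this]
  obtain n where n: "card (?f ` R) = p ^ n" by blast
  obtain h where h: "h \<in> carrier (G Mod C)"
    "\<And>x. x \<in> ?f ` R \<Longrightarrow> h \<otimes>\<^bsub>G Mod C\<^esub> x \<otimes>\<^bsub>G Mod C\<^esub> inv\<^bsub>G Mod C\<^esub> h \<in> ?f ` P"
    using Q.sylow_contains_conjugate[OF finQ p fP normal_imp_subgroup[OF fR] n] by blast
  have fRP: "?f ` R \<subseteq> ?f ` P"
  proof
    fix z assume z: "z \<in> ?f ` R"
    have zc: "z \<in> carrier (G Mod C)" using z normal_subset[OF fR] by blast
    have "inv\<^bsub>G Mod C\<^esub> h \<otimes>\<^bsub>G Mod C\<^esub> z \<otimes>\<^bsub>G Mod C\<^esub> h \<in> ?f ` R"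
      using normal.inv_op_closed1[OF fR h(1) z] .
    from h(2)[OF this] show "z \<in> ?f ` P" using h(1) zc by (simp add: Q.group_simps del: mult_FactGroup one_FactGroup)
  qed
  have RCP: "\<exists>c\<in>C. \<exists>y\<in>P. x = c \<otimes> y" if x: "x \<in> R" for x
  proof -
    obtain y where y: "y \<in> P" "C #> x = C #> y" using fRP x by blast
    have "x \<in> C #> y" using rcos_self[OF R.mem_carrier[OF x] C.subgroup_axioms] y by simp
    then show ?thesis using y(1) by (auto simp: r_coset_def)
  qed
  show "\<exists>c\<in>C. \<exists>l\<in>normalizer G P. g = c \<otimes> l" if g: "g \<in> carrier G" for g
  proof -
    let ?c = "\<lambda>x. g \<otimes> x \<otimes> inv g"
    interpret c: group_hom G G ?c
      using conjugation_iso[OF g] by (simp add: group_hom_def group_hom_axioms_def iso_def)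
    have Q': "subgroup (?c ` P) G" using c.subgroup_img_is_subgroup[OF Psub(1)] .
    have "inj_on ?c P"
      using conjugation_iso[OF g] P.subset by (auto simp: Group.iso_iff intro: inj_on_subset)
    then have cQ: "card (?c ` P) = p ^ multiplicity p (order G)" using Psub(2) by (simp add: card_image)
    have QR: "?c ` P \<subseteq> R" using PR R.inv_op_closed2[OF g] by blast
    obtain r where r: "r \<in> R" "\<And>x. x \<in> ?c ` P \<Longrightarrow> r \<otimes> x \<otimes> inv r \<in> P"
      using sylow_contains_conjugate_within[OF fin p P R.subgroup_axioms PR Q' cQ QR] by blast
    have rc: "r \<in> carrier G" using r(1) by simp
    have "r \<otimes> ?c x \<otimes> inv r \<in> P" if "x \<in> P" for x using r(2) that by blast
    then have rg: "r \<otimes> g \<in> normalizer G P"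
      using rc g by (auto simp: normalizer_eq[OF fin Psub(1)] group_simps)
    obtain c y where cy: "c \<in> C" "y \<in> P" "inv r = c \<otimes> y" using RCP[of "inv r"] r(1) by auto
    have "y \<in> normalizer G P" using cy(2) by (simp add: normalizer_eq[OF fin Psub(1)])
    then have "y \<otimes> (r \<otimes> g) \<in> normalizer G P"
      using rg normalizer_subgroup[OF P.subset] by (simp add: subgroup.m_closed)
    moreover have "g = c \<otimes> (y \<otimes> (r \<otimes> g))"
    proof -
      have "c \<otimes> (y \<otimes> (r \<otimes> g)) = (c \<otimes> y) \<otimes> (r \<otimes> g)" using cy rc g by (simp add: m_assoc)
      also have "\<dots> = g" unfolding cy(3)[symmetric] using rc g by (rule inv_cancel_left)
      finally show ?thesis by (rule sym)
    qed
    ultimately show ?thesis using cy(1) by blast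
  qed
  show "c \<otimes> y = y \<otimes> c" if c: "c \<in> C" "c \<in> normalizer G P" and y: "y \<in> P" for c y
  proof -
    have cc: "c \<in> carrier G" "y \<in> carrier G" using c(1) y by auto
    have "c \<otimes> y \<otimes> inv c \<in> P" using c(2) y by (simp add: normalizer_eq[OF fin Psub(1)])
    then have "c \<otimes> y \<otimes> inv c \<otimes> inv y \<in> P" using y by simp
    moreover have "y \<otimes> inv c \<otimes> inv y \<in> C" using C.inv_op_closed2[OF cc(2)] c(1) by simp
    then have "c \<otimes> (y \<otimes> inv c \<otimes> inv y) \<in> C" using c(1) by simp
    then have "c \<otimes> y \<otimes> inv c \<otimes> inv y \<in> C" using cc by (simp add: m_assoc)
    ultimately have "c \<otimes> y \<otimes> inv c \<otimes> inv y = \<one>" using CP1 by blast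
    then have "c \<otimes> y \<otimes> inv c = y"
      using cc inv_solve_right'[of "\<one>" "c \<otimes> y \<otimes> inv c" "inv y"] by (metis inv_closed inv_equality inv_inv m_closed)
    then show ?thesis using cc by (metis inv_solve_right' m_closed)
  qed
qed

section \<open>Chains of subgroups above residuals\<close>

text \<open>Steps may be trivial or skip intermediate subgroups, because intersections with a
  subgroup and images under homomorphisms can collapse inclusions and destroy maximality.\<close>

inductive residual_chain :: "nat monoid set \<Rightarrow> ('a, 'b) monoid_scheme \<Rightarrow> 'a set \<Rightarrow> 'a set \<Rightarrow> bool"
  for F and G :: "('a, 'b) monoid_scheme" where
  refl: "subgroup K G \<Longrightarrow> residual_chain F G K K"
| step: "subgroup A G \<Longrightarrow> A \<subseteq> K \<Longrightarrow> above_residual F (G\<lparr>carrier := K\<rparr>) A \<Longrightarrow>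
    residual_chain F G K L \<Longrightarrow> residual_chain F G A L"

lemma residual_chain_subgroup:
  "residual_chain F G A L \<Longrightarrow> subgroup A G \<and> subgroup L G \<and> A \<subseteq> L"
  by (induction rule: residual_chain.induct) auto

lemma residual_chain_Int:
  assumes "residual_chain F G A L" "group G" "subgroup Y G"
  shows "residual_chain F G (A \<inter> Y) (L \<inter> Y)"
  using assms(1)
proof induction
  case (refl K)
  then show ?case using assms(2,3) by (intro residual_chain.refl group.subgroups_Inter_pair)
next
  case (step A K L)
  have "above_residual F (G\<lparr>carrier := K \<inter> Y\<rparr>) A"
    using above_residual_restrict[OF step(3), of "K \<inter> Y"] by simp
  then have "above_residual F (G\<lparr>carrier := K \<inter> Y\<rparr>) (A \<inter> Y)"
    by (rule above_residual_mono) auto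
  then show ?case
    using step assms(2,3) by (intro residual_chain.step[OF _ _ _ step(5)]) (auto intro: group.subgroups_Inter_pair)
qed

lemma residual_chain_restrict:
  assumes "residual_chain F G A L" "group G" "subgroup Y G" "L \<subseteq> Y"
  shows "residual_chain F (G\<lparr>carrier := Y\<rparr>) A L"
  using assms(1,4)
proof induction
  case (refl K)
  then show ?case using assms(2,3) by (intro residual_chain.refl group.subgroup_incl)
next
  case (step A K L)
  have "K \<subseteq> Y" using residual_chain_subgroup[OF step(4)] step.prems by blast
  then show ?case
    using step assms(2,3) by (intro residual_chain.step[of A _ K]) (auto intro: group.subgroup_incl)
qed

text \<open>Trivial steps at the upper end are passed over until a proper one is found.\<close>

lemma residual_chain_top:
  assumes "residual_chain F G A L" "A \<noteq> L"
  shows "\<exists>A'. subgroup A' G \<and> A \<subseteq> A' \<and> A' \<subset> L \<and> above_residual F (G\<lparr>carrier := L\<rparr>) A'"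
  using assms
proof induction
  case (step A K L)
  show ?case
  proof (cases "K = L")
    case True
    then show ?thesis using step by blast
  next
    case False
    then show ?thesis using step by blast
  qed
qed simp

lemma (in saturated_formation) residual_chain_image:
  assumes "residual_chain F G A L" "f \<in> hom G H" "group G" "group H"
  shows "residual_chain F H (f ` A) (f ` L)"
proof -
  interpret f: group_hom G H f using assms by (simp add: group_hom_def group_hom_axioms_def)
  show ?thesis
    using assms(1)
  proof induction
    case (refl K)
    then show ?case by (intro residual_chain.refl f.subgroup_img_is_subgroup)
  next
    case (step A K L)
    have K: "subgroup K G" using residual_chain_subgroup[OF step(4)] by blast
    interpret k: group_hom "G\<lparr>carrier := K\<rparr>" "H\<lparr>carrier := f ` K\<rparr>" f by (rule f.induced_group_hom[OF K])
    have "above_residual F (H\<lparr>carrier := f ` K\<rparr>) (f ` (A \<inter> K))"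
      using above_residual_image[OF k.homh _ k.G.group_axioms k.H.group_axioms step(3)] by simp
    then have "above_residual F (H\<lparr>carrier := f ` K\<rparr>) (f ` A)"
      by (rule above_residual_mono) auto
    then show ?case
      using step by (intro residual_chain.step[OF _ _ _ step(5)]) (auto intro: f.subgroup_img_is_subgroup)
  qed
qed

lemma (in saturated_formation) F_subnormal_residual_chain:
  assumes G: "group G" and fin: "finite (carrier G)" and H: "F_subnormal F H G"
  shows "residual_chain F G H (carrier G)"
proof -
  interpret group G by fact
  obtain C n where C: "C 0 = H" "C n = carrier G" "\<And>i. i \<le> n \<Longrightarrow> subgroup (C i) G"
    "\<And>i. i < n \<Longrightarrow> maximal_subgroup (C i) (G\<lparr>carrier := C (Suc i)\<rparr>)"
    "\<And>i. i < n \<Longrightarrow> residual F (G\<lparr>carrier := C (Suc i)\<rparr>) \<subseteq> C i"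
    using H unfolding F_subnormal_def by blast
  have "residual_chain F G (C i) (carrier G)" if "i \<le> n" for i
    using that
  proof (induction rule: inc_induct)
    case base
    then show ?case using C(2) residual_chain.refl[OF subgroup_self] by simp
  next
    case (step i)
    let ?K = "G\<lparr>carrier := C (Suc i)\<rparr>"
    have sub: "subgroup (C (Suc i)) G" using step by (intro C(3)) simp
    have "above_residual F ?K (residual F ?K)"
      using residual_above_residual(1)[of ?K] subgroup_imp_group[OF sub] subgroup_finite[OF fin sub] by simp
    then have "above_residual F ?K (C i)"
      by (rule above_residual_mono) (use C(5)[of i] step in auto)
    moreover have "C i \<subseteq> C (Suc i)"
      using subgroup.subset[OF maximal_subgroup_subgroup[OF C(4)[of i]]] step by simp
    ultimately show ?case
      using residual_chain.step[of "C i" G "C (Suc i)" F "carrier G"] C(3)[of i] step by simp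
  qed
  from this[of 0] show ?thesis using C(1) by simp
qed

section \<open>Tame functions and supplements\<close>

text \<open>If \<open>L\<close> supplements \<open>C\<close>, functions on \<open>L\<close> invariant under \<open>C \<inter> L\<close> extend to functions on \<open>H\<close>
  which are constant on the cosets of \<open>C\<close>. The extensions are realised inside the fibre product of
  \<open>H\<close> with a semidirect product over \<open>L\<close>.\<close>

lemma tame_stabilizer_supplement:
  fixes H (structure)
  assumes HF: "formation_functions F H q" and LF: "formation_functions F (H\<lparr>carrier := L\<rparr>) q"
    and C: "C \<lhd> H" and L: "subgroup L H"
    and supp: "\<And>h. h \<in> carrier H \<Longrightarrow> \<exists>c\<in>C. \<exists>l\<in>L. h = c \<otimes> l"
    and p: "prime p" and Cp: "\<And>c. c \<in> C \<Longrightarrow> \<exists>k::nat. \<not> p dvd k \<and> c [^] k = \<one>"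
    and y: "y \<in> L" "y [^] (p ^ a) = \<one>" and comm: "\<And>j. j \<in> C \<Longrightarrow> j \<in> L \<Longrightarrow> j \<otimes> y = y \<otimes> j"
    and ny: "y \<notin> formation_functions.tame_stabilizer F (H\<lparr>carrier := L\<rparr>) q"
  shows "y \<notin> formation_functions.tame_stabilizer F H q"
proof
  interpret H: formation_functions F H q by (rule HF)
  interpret L: formation_functions F "H\<lparr>carrier := L\<rparr>" q by (rule LF)
  interpret C: normal C H by (rule C)
  interpret Ls: subgroup L H by (rule L)
  let ?L = "H\<lparr>carrier := L\<rparr>"
  assume yH: "y \<in> H.tame_stabilizer"
  have Linv: "inv\<^bsub>?L\<^esub> l = inv l" if "l \<in> L" for l using H.m_inv_consistent[OF L that] .
  interpret D: normal "L.tame_stabilizer" ?L by (rule L.tame_stabilizer_normal)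
  have Dsub: "subgroup L.tame_stabilizer H" using H.incl_subgroup[OF L D.subgroup_axioms] .
  have DL: "L.tame_stabilizer \<subseteq> L" using D.subset by simp
  define J where "J = C \<inter> L"
  have J: "subgroup J H" unfolding J_def by (rule H.subgroups_Inter_pair[OF C.subgroup_axioms L])
  have JL: "J \<subseteq> L" by (simp add: J_def)
  have Jconj: "l \<otimes> j \<otimes> inv l \<in> J" if "l \<in> L" "j \<in> J" for l j
    using that C.inv_op_closed2[of l j] by (auto simp: J_def)
  have Jconj': "inv l \<otimes> j \<otimes> l \<in> J" if "l \<in> L" "j \<in> J" for l j
    using Jconj[of "inv l" j] that by simp
  \<comment> \<open>The product of the stabiliser over \<open>L\<close> with \<open>J\<close>. Its
    indicator is tame over \<open>L\<close> and invariant under \<open>J\<close>, so it can be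
    extended to \<open>H\<close>; it is 1 at the identity and, as shown next, 0 at
    \<open>y\<close>.\<close>
  define S where "S = {d \<otimes> j |d j. d \<in> L.tame_stabilizer \<and> j \<in> J}"
  have SL: "S \<subseteq> L" using DL JL by (auto simp: S_def)
  have yS: "y \<notin> S"
  proof
    assume "y \<in> S"
    then obtain d j where dj: "d \<in> L.tame_stabilizer" "j \<in> J" "y = d \<otimes> j" by (auto simp: S_def)
    have c: "d \<in> carrier H" "j \<in> carrier H" "y \<in> carrier H"
      using dj DL JL y(1) by auto
    obtain k where k: "\<not> p dvd k" "j [^] k = \<one>" using Cp dj(2) by (auto simp: J_def)
    \<comment> \<open>As \<open>y\<close> commutes with \<open>j\<close>, the \<open>k\<close>-th
      power of \<open>d\<close> is that of \<open>y\<close>. Thus \<open>y\<close> has two powers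
      with coprime exponents in the stabiliser.\<close>
    have d: "d = y \<otimes> inv j" using dj(3) c by (simp add: H.m_assoc)
    have yj: "y \<otimes> inv j = inv j \<otimes> y"
    proof -
      have "j \<otimes> y = y \<otimes> j" using comm dj(2) by (simp add: J_def)
      then have "inv j \<otimes> (j \<otimes> y) \<otimes> inv j = inv j \<otimes> (y \<otimes> j) \<otimes> inv j" by simp
      then show ?thesis using c by (simp add: H.group_simps)
    qed
    have "d [^] k = y [^] k \<otimes> inv j [^] k"
      unfolding d by (rule H.pow_mult_distrib[OF yj]) (use c in simp_all)
    also have "\<dots> = y [^] k" using c k(2) by (simp add: H.nat_pow_inv)
    finally have "y [^] k \<in> L.tame_stabilizer"
      using H.subgroup_pow_closed[OF Dsub dj(1), of k] by simp
    moreover have "y [^] (p ^ a) \<in> L.tame_stabilizer" using y(2) subgroup.one_closed[OF Dsub] by simp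
    moreover have "coprime (p ^ a) k" using k(1) p by (metis coprime_power_left_iff prime_imp_coprime)
    ultimately have "y \<in> L.tame_stabilizer" using H.pow_gcd_one[OF c(3) _ _ _ Dsub] by blast
    then show False using ny by simp
  qed
  define w where "w = (\<lambda>x. if x \<in> S then 1 else 0 :: int)"
  have "w \<in> L.tame"
    unfolding w_def
  proof (rule L.tame_indicator)
    show "S \<subseteq> carrier ?L" using SL by simp
    fix d x assume d: "d \<in> L.tame_stabilizer" and "x \<in> S"
    then obtain d' j where x: "x = d' \<otimes> j" "d' \<in> L.tame_stabilizer" "j \<in> J" by (auto simp: S_def)
    have "d \<otimes> x = (d \<otimes> d') \<otimes> j"
      using x d DL JL by (simp add: H.m_assoc subset_iff)
    moreover have "d \<otimes> d' \<in> L.tame_stabilizer" using subgroup.m_closed[OF Dsub d x(2)] .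
    ultimately show "d \<otimes>\<^bsub>?L\<^esub> x \<in> S" using x(3) by (auto simp: S_def)
  qed
  then obtain U where U: "L.good U" "w \<in> U" by (auto simp: L.tame_def)
  \<comment> \<open>Invariance under \<open>J\<close> is what makes a function on \<open>L\<close>
    well defined on the cosets of \<open>C\<close> in \<open>H\<close>; translations preserve it
    because \<open>J\<close> is normal in \<open>L\<close>.\<close>
  define U' where "U' = {f \<in> U. \<forall>x\<in>L. \<forall>j\<in>J. f (x \<otimes> j) = f x}"
  note D = L.submoduleD[OF L.good_submodule[OF U(1)]]
  have U'sub: "L.submodule U'"
    unfolding L.submodule_def
  proof (intro conjI ballI)
    show "U' \<subseteq> L.fns" using D(1) by (auto simp: U'_def)
    show "L.fzero \<in> U'" using D(2) by (auto simp: U'_def L.fzero_def)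
    show "L.fadd f g \<in> U'" if "f \<in> U'" "g \<in> U'" for f g
      using that D(3) by (auto simp: U'_def L.fadd_def)
    show "L.rtrans l f \<in> U'" if f: "f \<in> U'" and l: "l \<in> carrier ?L" for f l
    proof -
      have l: "l \<in> L" using l by simp
      have "f (x \<otimes> j \<otimes> l) = f (x \<otimes> l)" if x: "x \<in> L" and j: "j \<in> J" for x j
      proof -
        have "x \<otimes> j \<otimes> l = (x \<otimes> l) \<otimes> (inv l \<otimes> j \<otimes> l)"
          using x l j JL by (simp add: H.group_simps subset_iff)
        moreover have "x \<otimes> l \<in> L" using x l by simp
        ultimately show ?thesis using f Jconj'[OF l j] by (simp add: U'_def)
      qed
      moreover have "L.rtrans l f \<in> U" using f l D(4) by (simp add: U'_def)
      ultimately show ?thesis using JL by (auto simp: U'_def L.rtrans_def)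
    qed
  qed
  have wU': "w \<in> U'"
  proof -
    have "x \<otimes> j \<in> S \<longleftrightarrow> x \<in> S" if x: "x \<in> L" and j: "j \<in> J" for x j
    proof
      assume "x \<in> S"
      then obtain d j' where d: "x = d \<otimes> j'" "d \<in> L.tame_stabilizer" "j' \<in> J" by (auto simp: S_def)
      have "x \<otimes> j = d \<otimes> (j' \<otimes> j)" using d j DL JL by (simp add: H.m_assoc subset_iff)
      then show "x \<otimes> j \<in> S" using d j subgroup.m_closed[OF J] by (auto simp: S_def)
    next
      assume "x \<otimes> j \<in> S"
      then obtain d j' where d: "x \<otimes> j = d \<otimes> j'" "d \<in> L.tame_stabilizer" "j' \<in> J" by (auto simp: S_def)
      have c: "d \<in> carrier H" "j' \<in> carrier H" "x \<in> carrier H" "j \<in> carrier H"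
        using d x j DL JL by auto
      have "x = x \<otimes> j \<otimes> inv j" using c by (simp add: H.m_assoc)
      then have "x = d \<otimes> (j' \<otimes> inv j)" using d(1) c by (simp add: H.m_assoc)
      moreover have "j' \<otimes> inv j \<in> J" using d j subgroup.m_closed[OF J] subgroup.m_inv_closed[OF J] by simp
      ultimately show "x \<in> S" using d(2) unfolding S_def by blast
    qed
    then show ?thesis using U(2) by (simp add: U'_def w_def)
  qed
  have U': "L.good U'" by (rule L.good_subset[OF U(1) U'sub]) (auto simp: U'_def)
  have U'D: "f \<in> L.fns" "f (x \<otimes> j) = f x" if "f \<in> U'" "x \<in> L" "j \<in> J" for f x j
    using that D(1) by (auto simp: U'_def)
  let ?S = "L.semidirect U'"
  have Sgroup: "group ?S" using L.semidirect_group[OF U'sub] .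
  let ?P = "H \<times>\<times> ?S"
  interpret P: group ?P by (rule DirProd_group[OF H.group_axioms Sgroup])
  have finS: "finite (carrier ?S)"
    using L.heis.subgroup_finite[OF L.heis_finite L.semidirect_subgroup[OF U'sub]] by simp
  have finP: "finite (carrier ?P)" using H.finite_H finS by simp
  have Scar: "carrier ?S = {L.fzero} \<times> {L.fzero} \<times> U' \<times> L" by (simp add: L.heis_sub_def)
  \<comment> \<open>The fibre product over H/C: \<open>h\<close> and \<open>l\<close> represent the
    same coset of \<open>C\<close>. Its two projections map to groups of the class, and their
    kernels meet trivially.\<close>
  define Xc where "Xc = {(h, (L.fzero, L.fzero, f, l)) |h f l. h \<in> carrier H \<and> f \<in> U' \<and> l \<in> L \<and> (\<exists>c\<in>C. h = c \<otimes> l)}"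
  note D' = L.submoduleD[OF U'sub]
  have supp_mult: "\<exists>c\<in>C. h \<otimes> h' = c \<otimes> (l \<otimes> l')"
    if "h = c \<otimes> l" "h' = c' \<otimes> l'" "c \<in> C" "c' \<in> C" "l \<in> L" "l' \<in> L" for h h' c c' l l'
  proof -
    have "h \<otimes> h' = (c \<otimes> (l \<otimes> c' \<otimes> inv l)) \<otimes> (l \<otimes> l')"
      using that by (simp add: H.group_simps)
    moreover have "c \<otimes> (l \<otimes> c' \<otimes> inv l) \<in> C" using that C.inv_op_closed2 by simp
    ultimately show ?thesis by blast
  qed
  have Xsub: "subgroup Xc ?P"
  proof (rule P.finite_closed_subgroup[OF finP])
    show "Xc \<subseteq> carrier ?P" by (auto simp: Xc_def Scar)
    have "\<one> = \<one> \<otimes> \<one>" by simp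
    then have "(\<one>, (L.fzero, L.fzero, L.fzero, \<one>)) \<in> Xc"
      using D'(2) C.one_closed Ls.one_closed unfolding Xc_def by blast
    then show "Xc \<noteq> {}" by blast
    fix s t assume "s \<in> Xc" "t \<in> Xc"
    then obtain h f l c h' f' l' c' where s: "s = (h, (L.fzero, L.fzero, f, l))" "h = c \<otimes> l" "f \<in> U'" "c \<in> C" "l \<in> L"
      and t: "t = (h', (L.fzero, L.fzero, f', l'))" "h' = c' \<otimes> l'" "f' \<in> U'" "c' \<in> C" "l' \<in> L"
      unfolding Xc_def by blast
    have "s \<otimes>\<^bsub>?P\<^esub> t = (h \<otimes> h', (L.fzero, L.fzero, L.fadd f (L.rtrans l f'), l \<otimes> l'))"
      using s t D' by (simp add: subset_iff)
    moreover have "L.fadd f (L.rtrans l f') \<in> U'" using s t D' by simp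
    moreover have "h \<otimes> h' \<in> carrier H" using s t by simp
    ultimately show "s \<otimes>\<^bsub>?P\<^esub> t \<in> Xc"
      using supp_mult[OF s(2) t(2) s(4) t(4) s(5) t(5)] s(5) t(5) unfolding Xc_def by auto
  qed
  let ?X = "?P\<lparr>carrier := Xc\<rparr>"
  interpret X: group ?X by (rule P.subgroup_imp_group[OF Xsub])
  have finX: "finite (carrier ?X)" using P.subgroup_finite[OF finP Xsub] by simp
  have XE: "\<exists>h f l. s = (h, (L.fzero, L.fzero, f, l)) \<and> h \<in> carrier H \<and> f \<in> U' \<and> l \<in> L \<and> (\<exists>c\<in>C. h = c \<otimes> l)"
    if "s \<in> carrier ?X" for s
    using that by (auto simp: Xc_def)
  have fst: "fst \<in> hom ?X H" and snd: "snd \<in> hom ?X ?S"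
    by (auto simp: hom_def Xc_def Scar mult_DirProd')
  have "above_residual F H {\<one>}" "above_residual F ?S {\<one>\<^bsub>?S\<^esub>}"
    using H.H_in H.in_class_above_residual L.good_above_residual[OF U'] by auto
  from H.above_residual_Int[OF X.group_axioms finX above_residual_hom[OF fst this(1)] above_residual_hom[OF snd this(2)]]
  have resX: "above_residual F ?X {\<one>\<^bsub>?X\<^esub>}"
    by (rule above_residual_mono) (auto simp: Xc_def)
  define V where "V = {(\<one>, (L.fzero, L.fzero, f, \<one>)) |f. f \<in> U'}"
  have VX: "V \<subseteq> Xc"
  proof
    fix v assume "v \<in> V"
    then obtain f where "v = (\<one>, (L.fzero, L.fzero, f, \<one>))" "f \<in> U'" by (auto simp: V_def)
    moreover have "\<one> = \<one> \<otimes> \<one>" by simp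
    ultimately show "v \<in> Xc" using C.one_closed Ls.one_closed unfolding Xc_def by blast
  qed
  have Vmult: "(\<one>, (L.fzero, L.fzero, f, \<one>)) \<otimes>\<^bsub>?X\<^esub> (\<one>, (L.fzero, L.fzero, g, \<one>)) =
      (\<one>, (L.fzero, L.fzero, L.fadd f g, \<one>))" if "f \<in> U'" "g \<in> U'" for f g
    using that D' L.rtrans_one[of g] by simp
  have conj: "x \<otimes>\<^bsub>?X\<^esub> (\<one>, (L.fzero, L.fzero, f, \<one>)) \<otimes>\<^bsub>?X\<^esub> inv\<^bsub>?X\<^esub> x =
      (\<one>, (L.fzero, L.fzero, L.rtrans l f, \<one>))"
    if x: "x = (h, (L.fzero, L.fzero, g, l))" "x \<in> Xc" and f: "f \<in> U'" for x h g l f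
  proof -
    let ?v = "(\<one>, (L.fzero, L.fzero, f, \<one>))" and ?w = "(\<one>, (L.fzero, L.fzero, L.rtrans l f, \<one>))"
    have xc: "h \<in> carrier H" "g \<in> U'" "l \<in> L" using x by (auto simp: Xc_def)
    have rf: "L.rtrans l f \<in> U'" using f xc(3) D' by simp
    have v: "?v \<in> carrier ?X" "?w \<in> carrier ?X" using VX f rf by (auto simp: V_def)
    have "g \<in> L.fns" "f \<in> L.fns" "L.rtrans l f \<in> L.fns" using D' xc f rf by auto
    then have "x \<otimes>\<^bsub>?X\<^esub> ?v = ?w \<otimes>\<^bsub>?X\<^esub> x"
      using x(1) xc L.rtrans_one[of g] L.fadd_ac(2)[of g] by simp
    moreover have xX: "x \<in> carrier ?X" using x(2) by simp
    ultimately show ?thesis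
      using X.inv_solve_right'[THEN iffD2, OF v(2) X.m_closed[OF xX v(1)] xX] by blast
  qed
  have Vn: "V \<lhd> ?X"
  proof (rule X.normal_invI)
    show "subgroup V ?X"
    proof (rule X.finite_closed_subgroup[OF finX])
      show "V \<subseteq> carrier ?X" using VX by simp
      show "V \<noteq> {}" using D'(2) by (auto simp: V_def)
      fix u v assume "u \<in> V" "v \<in> V"
      then show "u \<otimes>\<^bsub>?X\<^esub> v \<in> V" using Vmult D'(3) unfolding V_def by blast
    qed
    fix x v assume x: "x \<in> carrier ?X" and "v \<in> V"
    then obtain f where f: "v = (\<one>, (L.fzero, L.fzero, f, \<one>))" "f \<in> U'" by (auto simp: V_def)
    obtain h g l where hgl: "x = (h, (L.fzero, L.fzero, g, l))" "l \<in> L" using XE[OF x] by blast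
    have "L.rtrans l f \<in> U'" using f(2) hgl(2) D' by simp
    then show "x \<otimes>\<^bsub>?X\<^esub> v \<otimes>\<^bsub>?X\<^esub> inv\<^bsub>?X\<^esub> x \<in> V"
      using conj[OF hgl(1) _ f(2)] x f(1) by (auto simp: V_def)
  qed
  \<comment> \<open>Some representative in \<open>L\<close> of the coset of \<open>h\<close> modulo
    \<open>C\<close>; functions in \<open>U'\<close> do not depend on the choice.\<close>
  define sel where "sel h = (SOME l. l \<in> L \<and> (\<exists>c\<in>C. h = c \<otimes> l))" for h
  have sel: "sel h \<in> L \<and> (\<exists>c\<in>C. h = c \<otimes> sel h)" if "h \<in> carrier H" for h
    unfolding sel_def by (rule someI_ex) (use supp[OF that] in blast)
  have sel_eq: "f (sel h) = f l" if f: "f \<in> U'" and l: "l \<in> L" "c \<in> C" "h = c \<otimes> l" for f h l c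
  proof -
    have hc: "h \<in> carrier H" using l by simp
    obtain c' where c': "c' \<in> C" "h = c' \<otimes> sel h" "sel h \<in> L" using sel[OF hc] by blast
    let ?j = "inv l \<otimes> sel h"
    have "sel h = inv c' \<otimes> (c' \<otimes> sel h)"
      by (rule H.inv_cancel_left[symmetric]) (use c'(1,3) in simp_all)
    also have "\<dots> = inv c' \<otimes> (c \<otimes> l)" using c'(2) l(3) by simp
    finally have "?j = inv l \<otimes> (inv c' \<otimes> c) \<otimes> l" using c'(1) l(1,2) by (simp add: H.m_assoc)
    then have "?j \<in> C" using C.inv_op_closed1[of l "inv c' \<otimes> c"] c'(1) l(1,2) by simp
    then have "?j \<in> J" using c'(3) l(1) by (simp add: J_def)
    moreover have "sel h = l \<otimes> ?j"
      by (rule H.cancel_inv_left[symmetric]) (use c'(3) l(1) in simp_all)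
    ultimately show ?thesis using U'D(2)[OF f l(1)] by metis
  qed
  define \<mu> where "\<mu> v = (\<lambda>h. if h \<in> carrier H then fst (snd (snd (snd v))) (sel h) else 0)"
    for v :: "'a \<times> ('a \<Rightarrow> int) \<times> ('a \<Rightarrow> int) \<times> ('a \<Rightarrow> int) \<times> 'a"
  have good: "H.good (\<mu> ` V)"
  proof (rule H.good_image[OF X.group_axioms finX Vn resX fst])
    show "fst ` carrier ?X = carrier H"
    proof
      show "carrier H \<subseteq> fst ` carrier ?X"
      proof
        fix h assume h: "h \<in> carrier H"
        then obtain c l where "c \<in> C" "l \<in> L" "h = c \<otimes> l" using supp by blast
        then have "(h, (L.fzero, L.fzero, L.fzero, l)) \<in> carrier ?X"
          using h D'(2) by (auto simp: Xc_def)
        then show "h \<in> fst ` carrier ?X" by force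
      qed
    qed (auto simp: Xc_def)
    show "\<mu> v \<in> H.fns" if v: "v \<in> V" for v
    proof -
      obtain f where f: "v = (\<one>, (L.fzero, L.fzero, f, \<one>))" "f \<in> U'" using v by (auto simp: V_def)
      have "f \<in> L.fns" using D'(1) f(2) by blast
      then show ?thesis using f(1) sel by (auto simp: \<mu>_def H.fns_def L.fns_def)
    qed
    show "\<mu> (u \<otimes>\<^bsub>?X\<^esub> v) = H.fadd (\<mu> u) (\<mu> v)" if uv: "u \<in> V" "v \<in> V" for u v
    proof -
      obtain f g where f: "u = (\<one>, (L.fzero, L.fzero, f, \<one>))" "f \<in> U'"
        and g: "v = (\<one>, (L.fzero, L.fzero, g, \<one>))" "g \<in> U'" using uv by (auto simp: V_def)
      show ?thesis unfolding f(1) g(1) Vmult[OF f(2) g(2)]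
        by (auto simp: \<mu>_def H.fadd_def L.fadd_def)
    qed
    show "\<mu> (x \<otimes>\<^bsub>?X\<^esub> v \<otimes>\<^bsub>?X\<^esub> inv\<^bsub>?X\<^esub> x) = H.rtrans (fst x) (\<mu> v)"
      if x: "x \<in> carrier ?X" and v: "v \<in> V" for x v
    proof -
      obtain f where f: "v = (\<one>, (L.fzero, L.fzero, f, \<one>))" "f \<in> U'" using v by (auto simp: V_def)
      obtain h g l c where hgl: "x = (h, (L.fzero, L.fzero, g, l))" "h \<in> carrier H" "l \<in> L" "c \<in> C" "h = c \<otimes> l"
        using XE[OF x] by blast
      have "f (sel h' \<otimes> l) = f (sel (h' \<otimes> h))" if h': "h' \<in> carrier H" for h'
      proof -
        obtain c' where c': "c' \<in> C" "h' = c' \<otimes> sel h'" "sel h' \<in> L" using sel[OF h'] by blast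
        obtain c'' where "c'' \<in> C" "h' \<otimes> h = c'' \<otimes> (sel h' \<otimes> l)"
          using supp_mult[OF c'(2) hgl(5) c'(1) hgl(4) c'(3) hgl(3)] by blast
        then show ?thesis using sel_eq[OF f(2), of "sel h' \<otimes> l" c'' "h' \<otimes> h"] c'(3) hgl(3) by simp
      qed
      moreover have "x \<otimes>\<^bsub>?X\<^esub> v \<otimes>\<^bsub>?X\<^esub> inv\<^bsub>?X\<^esub> x = (\<one>, (L.fzero, L.fzero, L.rtrans l f, \<one>))"
        using conj[OF hgl(1) _ f(2)] x f(1) by simp
      ultimately show ?thesis
        using sel hgl(1,2) f(1) by (auto simp: \<mu>_def H.rtrans_def L.rtrans_def fun_eq_iff)
    qed
    show "fst b = \<one>" if "b \<in> {\<one>\<^bsub>?X\<^esub>}" for b using that by simp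
    show "\<mu> b = H.fzero" if "b \<in> {\<one>\<^bsub>?X\<^esub>}" for b
      using that by (auto simp: \<mu>_def H.fzero_def L.fzero_def)
    show "subgroup {\<one>\<^bsub>?X\<^esub>} ?X" by (rule X.triv_subgroup)
  qed
  let ?f = "\<mu> (\<one>, (L.fzero, L.fzero, w, \<one>))"
  have "?f \<in> H.tame" using good wU' unfolding H.tame_def V_def by blast
  then have "?f (y \<otimes> \<one>) = ?f \<one>"
    using yH H.one_closed unfolding H.tame_stabilizer_def by blast
  moreover have "?f y = w y"
    using sel_eq[OF wU' y(1) C.one_closed, of y] y(1) by (simp add: \<mu>_def)
  moreover have "?f \<one> = w \<one>"
    using sel_eq[OF wU' Ls.one_closed C.one_closed, of \<one>] by (simp add: \<mu>_def)
  moreover have "\<one> \<in> S"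
  proof -
    have "\<one> = \<one> \<otimes> \<one>" by simp
    then show ?thesis using subgroup.one_closed[OF Dsub] subgroup.one_closed[OF J] unfolding S_def by blast
  qed
  ultimately show False using yS y(1) by (simp add: w_def)
qed

section \<open>Minimal normal subgroups\<close>

lemma (in group) factor_unique:
  assumes V: "subgroup V G" and L: "subgroup L G" and triv: "\<And>x. x \<in> V \<Longrightarrow> x \<in> L \<Longrightarrow> x = \<one>"
    and eq: "v \<otimes> l = v' \<otimes> l'" and mem: "v \<in> V" "v' \<in> V" "l \<in> L" "l' \<in> L"
  shows "v = v'" "l = l'"
proof -
  interpret V: subgroup V G by (rule V)
  interpret L: subgroup L G by (rule L)
  have "inv v' \<otimes> v = inv v' \<otimes> (v \<otimes> l) \<otimes> inv l" using mem by (simp add: m_assoc)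
  also have "\<dots> = inv v' \<otimes> (v' \<otimes> l') \<otimes> inv l" by (simp only: eq)
  also have "\<dots> = l' \<otimes> inv l" using mem by (simp add: inv_cancel_left)
  finally have e: "inv v' \<otimes> v = l' \<otimes> inv l" .
  moreover have "inv v' \<otimes> v \<in> V" "l' \<otimes> inv l \<in> L" using mem by simp_all
  ultimately have "inv v' \<otimes> v = \<one>" using triv by metis
  then have "v' \<otimes> (inv v' \<otimes> v) = v'" using mem by simp
  then show "v = v'" using mem by (simp add: cancel_inv_left)
  then show "l = l'" using eq mem by simp
qed

locale p_length_one_formation = saturated_formation F for F +
  assumes F_sub: "F \<subseteq> L_a1"
begin

text \<open>The subnormality hypothesis in a form that passes to quotients.\<close>

definition normalizer_chains :: "('a, 'b) monoid_scheme \<Rightarrow> bool" where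
  "normalizer_chains G \<longleftrightarrow> (\<forall>p P. prime p \<and> sylow_subgroup p P G \<longrightarrow>
     residual_chain F G (normalizer G P) (carrier G))"

lemma in_class_p_series:
  assumes "in_class G F" "prime p"
  obtains C R where "p_series p G C R"
proof -
  obtain Q f where Q: "Q \<in> F" "f \<in> iso G Q" "group G"
    using assms(1) by (auto simp: in_class_def is_iso_def)
  obtain C R where "p_series p Q C R" using L_a1_p_series[OF _ assms(2)] Q(1) F_sub by blast
  from p_series_iso[OF Q(2,3) group_F[OF Q(1)] this] show thesis by (rule that)
qed

text \<open>A proper step at the top would map \<open>N\<close> nontrivially to a member of the
  class. Members are soluble, whereas images of a perfect group are perfect.\<close>

lemma residual_chain_perfect:
  assumes G: "group G" and chain: "residual_chain F G A N" and perfect: "derived G N = N"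
  shows "A = N"
proof (rule ccontr)
  interpret group G by (rule G)
  assume "A \<noteq> N"
  from residual_chain_top[OF chain this] obtain B where
    B: "B \<subset> N" "above_residual F (G\<lparr>carrier := N\<rparr>) B" by blast
  have N: "subgroup N G" using residual_chain_subgroup[OF chain] by blast
  let ?N = "G\<lparr>carrier := N\<rparr>"
  obtain Q h where Q: "Q \<in> F" "h \<in> hom ?N Q" "\<forall>x\<in>carrier ?N. h x = \<one>\<^bsub>Q\<^esub> \<longrightarrow> x \<in> B"
    using B(2) by (auto simp: above_residual_def)
  interpret h: group_hom ?N Q h
    using Q group_F subgroup_imp_group[OF N] by (simp add: group_hom_def group_hom_axioms_def)
  have "solvable Q" using Q(1) F_sub by (auto simp: L_a1_def)
  then obtain n where n: "(derived Q ^^ n) (carrier Q) = {\<one>\<^bsub>Q\<^esub>}"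
    using h.H.solvable_iff_trivial_derived_seq by blast
  have "derived ?N N = N" using derived_consistent[OF _ N] perfect by simp
  then have "(derived ?N ^^ n) N = N" by (induction n) simp_all
  moreover have "(derived Q ^^ n) (h ` N) = h ` ((derived ?N ^^ n) N)"
    using h.exp_of_derived_img[of N n] by simp
  moreover have "h ` N \<subseteq> carrier Q" using hom_carrier[OF Q(2)] by simp
  then have "(derived Q ^^ n) (h ` N) \<subseteq> {\<one>\<^bsub>Q\<^esub>}"
    using h.H.mono_exp_of_derived[of "h ` N" "carrier Q" n] n by simp
  ultimately have "h ` N \<subseteq> {\<one>\<^bsub>Q\<^esub>}" by simp
  then have "N \<subseteq> B" using Q(3) by auto
  then show False using B(1) by blast
qed

text \<open>Each Sylow subgroup of \<open>H\<close> is the image of one of \<open>G\<close> under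
  \<open>f\<close> followed by a conjugation; this composite is again surjective and transports both
  chain and normaliser.\<close>

lemma normalizer_chains_image:
  assumes G: "group G" and fin: "finite (carrier G)" and chains: "normalizer_chains G"
    and f: "f \<in> hom G H" "f ` carrier G = carrier H" and H: "group H"
  shows "normalizer_chains H"
  unfolding normalizer_chains_def
proof (intro allI impI)
  fix p P' assume P': "prime p \<and> sylow_subgroup p P' H"
  then have p: "prime p" by simp
  interpret H: group H by (rule H)
  have finH: "finite (carrier H)" using fin f(2) by (metis finite_imageI)
  obtain P where P: "sylow_subgroup p P G" using sylow_subgroup_exists[OF G fin p] .
  have fP: "sylow_subgroup p (f ` P) H" by (rule sylow_subgroup_image(1)[OF f G H fin p P])
  then have fP': "subgroup (f ` P) H" "card (f ` P) = p ^ multiplicity p (order H)"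
    by (auto simp: sylow_subgroup_def)
  obtain h where h: "h \<in> carrier H" "\<And>x. x \<in> f ` P \<Longrightarrow> h \<otimes>\<^bsub>H\<^esub> x \<otimes>\<^bsub>H\<^esub> inv\<^bsub>H\<^esub> h \<in> P'"
    using H.sylow_contains_conjugate[OF finH p conjunct2[OF P'] fP'] by blast
  let ?g = "\<lambda>x. h \<otimes>\<^bsub>H\<^esub> f x \<otimes>\<^bsub>H\<^esub> inv\<^bsub>H\<^esub> h"
  let ?c = "\<lambda>x. h \<otimes>\<^bsub>H\<^esub> x \<otimes>\<^bsub>H\<^esub> inv\<^bsub>H\<^esub> h"
  have c: "?c \<in> hom H H" "?c ` carrier H = carrier H" "inj_on ?c (carrier H)"
    using H.conjugation_iso[OF h(1)] by (simp_all add: Group.iso_iff)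
  have "?c \<circ> f \<in> hom G H" by (rule Group.hom_compose[OF f(1) c(1)])
  then have g: "?g \<in> hom G H" by (simp add: comp_def)
  have gsurj: "?g ` carrier G = carrier H" using c(2) f(2) by (simp flip: image_image[of ?c f])
  have "?g ` P \<subseteq> P'" using h(2) by blast
  moreover have "card (?g ` P) = card P'"
  proof -
    have "inj_on ?c (f ` P)" using c(3) subgroup.subset[OF fP'(1)] by (rule inj_on_subset)
    then have "card (?c ` f ` P) = card (f ` P)" by (rule card_image)
    then show ?thesis using fP'(2) P' by (simp add: image_image sylow_subgroup_def)
  qed
  moreover have "finite P'" using H.subgroup_finite[OF finH] P' by (simp add: sylow_subgroup_def)
  ultimately have gP: "?g ` P = P'" by (metis card_subset_eq)
  have "residual_chain F G (normalizer G P) (carrier G)"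
    using chains p P by (simp add: normalizer_chains_def)
  from residual_chain_image[OF this g G H]
  show "residual_chain F H (normalizer H P') (carrier H)"
    using sylow_subgroup_image(2)[OF g gsurj G H fin p P] gP gsurj by simp
qed

text \<open>A nonabelian \<open>N\<close> would be perfect, hence normalise every Sylow subgroup of \<open>G\<close>; then its own
  Sylow subgroups are normal in \<open>G\<close> and \<open>N\<close> is a \<open>p\<close>-group after all.\<close>

lemma minimal_normal_elementary_abelian:
  fixes G (structure)
  assumes G: "group G" and fin: "finite (carrier G)" and chains: "normalizer_chains G"
    and N: "N \<lhd> G" "N \<noteq> {\<one>}" and minimal: "\<And>Y. Y \<lhd> G \<Longrightarrow> Y \<noteq> {\<one>} \<Longrightarrow> N \<subseteq> Y"
  obtains q where "prime q" "q dvd card N" "\<And>x. x \<in> N \<Longrightarrow> x [^] q = \<one>"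
    "\<And>x y. x \<in> N \<Longrightarrow> y \<in> N \<Longrightarrow> x \<otimes> y = y \<otimes> x"
proof -
  interpret group G by (rule G)
  interpret N: normal N G by (rule N)
  have Nsub: "subgroup N G" by (rule N.subgroup_axioms)
  have card_N: "card N \<noteq> 1" using N(2) N.one_closed by (metis card_1_singletonE singletonD)
  have conj_pow: "(g \<otimes> x \<otimes> inv g) [^] (k::nat) = g \<otimes> x [^] k \<otimes> inv g"
    if "g \<in> carrier G" "x \<in> carrier G" for g x k
  proof -
    interpret c: group_hom G G "\<lambda>y. g \<otimes> y \<otimes> inv g"
      using conjugation_iso[OF that(1)] by (simp add: group_hom_def group_hom_axioms_def iso_def)
    show ?thesis by (rule c.hom_nat_pow[OF that(2), symmetric])
  qed
  have comm: "x \<otimes> y = y \<otimes> x" if xy: "x \<in> N" "y \<in> N" for x y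
  proof (cases "derived G N = {\<one>}")
    case True
    then show ?thesis using derived_trivial_commute[OF N.subset] xy by blast
  next
    case False
    have "N \<subseteq> derived G N" using minimal[OF derived_is_normal[OF N(1)] False] .
    then have perfect: "derived G N = N" using derived_incl[OF order_refl Nsub] by blast
    obtain p where p: "prime p" "p dvd card N" using prime_factor_nat[OF card_N] by blast
    obtain P where P: "sylow_subgroup p P G" using sylow_subgroup_exists[OF G fin p(1)] .
    then have Psub: "subgroup P G" "card P = p ^ multiplicity p (order G)" by (auto simp: sylow_subgroup_def)
    have "residual_chain F G (normalizer G P) (carrier G)"
      using chains p(1) P by (simp add: normalizer_chains_def)
    \<comment> \<open>Intersected with \<open>N\<close>, the chain ends in a perfect group, so its
      lowest term is \<open>N\<close> as well.\<close>
    from residual_chain_Int[OF this G Nsub]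
    have "residual_chain F G (normalizer G P \<inter> N) N" using N.subset by (simp add: Int_absorb1)
    from residual_chain_perfect[OF G this perfect] have NP: "N \<subseteq> normalizer G P" by blast
    \<comment> \<open>Since \<open>N\<close> normalises \<open>P\<close>, all p-elements of
      \<open>N\<close> lie in \<open>P\<close>; \<open>?T\<close> is the set of these elements and
      hence preserved by conjugation.\<close>
    let ?T = "N \<inter> P"
    have T: "?T \<lhd> G"
    proof (rule normal_invI[OF subgroups_Inter_pair[OF Nsub Psub(1)]])
      fix g t assume g: "g \<in> carrier G" and t: "t \<in> ?T"
      have "t [^] card P = \<one>" using subgroup_pow_card[OF Psub(1) fin] t by simp
      then have "(g \<otimes> t \<otimes> inv g) [^] (p ^ multiplicity p (order G)) = \<one>"
        using conj_pow[OF g, of t "card P"] t g Psub(2) by simp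
      moreover have "g \<otimes> t \<otimes> inv g \<in> N" using N.inv_op_closed2 g t by simp
      ultimately show "g \<otimes> t \<otimes> inv g \<in> ?T"
        using p_element_normalizing_sylow[OF fin p(1) P] NP by blast
    qed
    obtain x where x: "x \<in> N" "x \<noteq> \<one>" "x [^] p = \<one>" using cauchy[OF fin p(1) Nsub p(2)] .
    obtain g where g: "g \<in> carrier G" "g \<otimes> x \<otimes> inv g \<in> P"
      using p_element_conjugate_in_sylow[OF fin p(1) P, of x 1] x by auto
    have "g \<otimes> x \<otimes> inv g \<noteq> \<one>" using g(1) x(1,2) by (simp add: inv_solve_right')
    moreover have "g \<otimes> x \<otimes> inv g \<in> ?T" using g x(1) N.inv_op_closed2 by simp
    ultimately have "?T \<noteq> {\<one>}" by blast
    then have "N \<subseteq> P" using minimal[OF T] by blast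
    then have "card N dvd p ^ multiplicity p (order G)"
      using subgroup_card_dvd_subgroup[OF Nsub Psub(1)] Psub(2) by simp
    then obtain m where m: "card N = p ^ m" using p(1) by (auto simp: divides_primepow_nat)
    have conj_N: "y \<otimes> x \<otimes> inv y \<in> N" if "y \<in> N" "x \<in> N" for y x using that by simp
    from p_group_fixed_point[OF fin p(1) Nsub m Nsub m N(2) conj_N]
    obtain z where z: "z \<in> N" "z \<noteq> \<one>" "\<And>y. y \<in> N \<Longrightarrow> y \<otimes> z = z \<otimes> y" by blast
    \<comment> \<open>The centre of the p-group \<open>N\<close> is nontrivial and normal in
      \<open>G\<close>, so minimality makes it all of \<open>N\<close>.\<close>
    let ?Z = "{z \<in> N. \<forall>y\<in>N. y \<otimes> z = z \<otimes> y}"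
    have "?Z \<lhd> G"
    proof (rule normal_invI)
      show "subgroup ?Z G"
      proof (rule finite_closed_subgroup[OF fin])
        show "?Z \<subseteq> carrier G" "?Z \<noteq> {}" using N.subset z by auto
        fix a b assume ab: "a \<in> ?Z" "b \<in> ?Z"
        have "y \<otimes> (a \<otimes> b) = a \<otimes> b \<otimes> y" if "y \<in> N" for y
        proof -
          have c: "a \<in> carrier G" "b \<in> carrier G" "y \<in> carrier G" using ab that by auto
          have "y \<otimes> (a \<otimes> b) = (y \<otimes> a) \<otimes> b" using c by (simp add: m_assoc)
          also have "y \<otimes> a = a \<otimes> y" using ab that by blast
          also have "a \<otimes> y \<otimes> b = a \<otimes> (y \<otimes> b)" using c by (simp add: m_assoc)
          also have "y \<otimes> b = b \<otimes> y" using ab that by blast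
          also have "a \<otimes> (b \<otimes> y) = a \<otimes> b \<otimes> y" using c by (simp add: m_assoc)
          finally show ?thesis .
        qed
        moreover have "a \<otimes> b \<in> N" using ab by (intro N.m_closed) blast+
        ultimately show "a \<otimes> b \<in> ?Z" by blast
      qed
      fix g a assume g: "g \<in> carrier G" and a: "a \<in> ?Z"
      have "y \<otimes> (g \<otimes> a \<otimes> inv g) = g \<otimes> a \<otimes> inv g \<otimes> y" if y: "y \<in> N" for y
      proof -
        let ?y = "inv g \<otimes> y \<otimes> g"
        have yN: "?y \<in> N" using N.inv_op_closed1[OF g y] .
        have c: "a \<in> carrier G" "y \<in> carrier G" using a y by auto
        have "y \<otimes> (g \<otimes> a \<otimes> inv g) = g \<otimes> (?y \<otimes> a) \<otimes> inv g"
          using g c by (simp add: group_simps)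
        also have "?y \<otimes> a = a \<otimes> ?y" using a yN by blast
        also have "g \<otimes> (a \<otimes> ?y) \<otimes> inv g = g \<otimes> a \<otimes> inv g \<otimes> y"
          using g c by (simp add: group_simps)
        finally show ?thesis .
      qed
      then show "g \<otimes> a \<otimes> inv g \<in> ?Z" using N.inv_op_closed2[OF g] a by blast
    qed
    moreover have "?Z \<noteq> {\<one>}" using z by blast
    ultimately have "N \<subseteq> ?Z" by (rule minimal)
    then show ?thesis using xy by blast
  qed
  obtain q where q: "prime q" "q dvd card N" using prime_factor_nat[OF card_N] by blast
  let ?Y = "{x \<in> N. x [^] q = \<one>}"
  have "?Y \<lhd> G"
  proof (rule normal_invI)
    show "subgroup ?Y G"
    proof (rule finite_closed_subgroup[OF fin])
      show "?Y \<subseteq> carrier G" using N.subset by blast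
      have "\<one> \<in> ?Y" by simp
      then show "?Y \<noteq> {}" by blast
      show "a \<otimes> b \<in> ?Y" if "a \<in> ?Y" "b \<in> ?Y" for a b
        using that pow_mult_distrib[OF comm, of a b q] by simp
    qed
    show "g \<otimes> a \<otimes> inv g \<in> ?Y" if "g \<in> carrier G" "a \<in> ?Y" for g a
      using that conj_pow[of g a q] N.inv_op_closed2 by simp
  qed
  moreover have "?Y \<noteq> {\<one>}" using cauchy[OF fin q(1) Nsub q(2)] by blast
  ultimately have "N \<subseteq> ?Y" by (rule minimal)
  then show thesis using that[OF q] comm by blast
qed

section \<open>Chief factors of a Sylow normaliser\<close>

text \<open>\<open>L\<close> normalises \<open>P0 \<le> P\<close>. A chief factor \<open>V/B\<close> of \<open>L\<close> in \<open>N\<close> on which \<open>P0\<close> acts nontrivially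
  has no nontrivial fixed points of \<open>P\<close>, so \<open>L\<close> is a maximal subgroup of \<open>VL/B\<close> above its residual;
  hence \<open>VL/B\<close> lies in the class.\<close>

lemma tame_stabilizer_sylow_normalizer:
  fixes G (structure)
  assumes G: "group G" and fin: "finite (carrier G)"
    and N: "N \<lhd> G" and q: "prime q" and Nq: "\<And>x. x \<in> N \<Longrightarrow> x [^] q = \<one>"
    and comm: "\<And>x y. x \<in> N \<Longrightarrow> y \<in> N \<Longrightarrow> x \<otimes> y = y \<otimes> x"
    and M: "subgroup M G" and NM: "N \<inter> M = {\<one>}" and resN: "above_residual F G N"
    and p: "prime p" "p \<noteq> q" and P: "subgroup P G" "P \<subseteq> M" "\<And>x. x \<in> P \<Longrightarrow> x [^] (p ^ a) = \<one>"
    and chain: "residual_chain F G (normalizer G P) (carrier G)"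
    and L: "L = normalizer G P \<inter> M"
    and P0: "P0 \<subseteq> P" "\<And>l y. l \<in> L \<Longrightarrow> y \<in> P0 \<Longrightarrow> l \<otimes> y \<otimes> inv l \<in> P0"
    and nontriv: "y0 \<in> P0" "n0 \<in> N" "y0 \<otimes> n0 \<noteq> n0 \<otimes> y0"
    and LF: "formation_functions F (G\<lparr>carrier := L\<rparr>) q"
  shows "\<exists>y\<in>P0. y \<notin> formation_functions.tame_stabilizer F (G\<lparr>carrier := L\<rparr>) q"
proof -
  interpret group G by (rule G)
  interpret N: normal N G by (rule N)
  interpret M: subgroup M G by (rule M)
  interpret P: subgroup P G by (rule P)
  interpret LF: formation_functions F "G\<lparr>carrier := L\<rparr>" q by (rule LF)
  have Psub: "subgroup P G" by (rule P)
  have norm: "normalizer G P = {g \<in> carrier G. \<forall>x\<in>P. g \<otimes> x \<otimes> inv g \<in> P}"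
    by (rule normalizer_eq[OF fin Psub])
  have normsub: "subgroup (normalizer G P) G" by (rule normalizer_subgroup[OF P.subset])
  have Lsub: "subgroup L G" unfolding L by (rule subgroups_Inter_pair[OF normsub M])
  interpret L: subgroup L G by (rule Lsub)
  have LM: "L \<subseteq> M" using L by blast
  have PL: "P \<subseteq> L"
  proof
    fix x assume x: "x \<in> P"
    then have "x \<in> normalizer G P" unfolding norm by simp
    then show "x \<in> L" unfolding L using x P(2) by blast
  qed
  have P0c: "y \<in> carrier G" "y \<in> L" "y \<in> P" if "y \<in> P0" for y using that P0(1) PL P.mem_carrier by blast+
  have triv: "x = \<one>" if "x \<in> N" "x \<in> M" for x using NM that by blast
  define inv_sub where "inv_sub V \<longleftrightarrow> subgroup V G \<and> V \<subseteq> N \<and> (\<forall>l\<in>L. \<forall>v\<in>V. l \<otimes> v \<otimes> inv l \<in> V)" for V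
  have inv_subD: "subgroup V G" "V \<subseteq> N" "\<And>l v. l \<in> L \<Longrightarrow> v \<in> V \<Longrightarrow> l \<otimes> v \<otimes> inv l \<in> V"
    if "inv_sub V" for V using that by (auto simp: inv_sub_def)
  let ?moved = "\<lambda>V. \<exists>y\<in>P0. \<exists>v\<in>V. y \<otimes> v \<noteq> v \<otimes> y"
  have "inv_sub N" using N.subgroup_axioms N.inv_op_closed2 by (auto simp: inv_sub_def)
  moreover have "?moved N" using nontriv by blast
  \<comment> \<open>By minimality of \<open>V\<close>, every smaller \<open>L\<close>-invariant
    subgroup, in particular \<open>B\<close> below, is centralised by \<open>P0\<close>.\<close>
  ultimately obtain V where V: "inv_sub V \<and> ?moved V"
    and Vmin: "\<And>W. inv_sub W \<and> ?moved W \<Longrightarrow> W \<subseteq> V \<Longrightarrow> W = V"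
    using ex_minimal_subset[of N "\<lambda>V. inv_sub V \<and> ?moved V" N] finite_subset[OF N.subset fin] inv_subD(2)
    by blast
  note VD = inv_subD[OF conjunct1[OF V]]
  interpret V: subgroup V G by (rule VD)
  have Vc: "v \<in> carrier G" "v \<in> N" if "v \<in> V" for v using that VD(2) by auto
  have "inv_sub {\<one>}" using triv_subgroup by (auto simp: inv_sub_def)
  moreover have "V \<noteq> {\<one>}"
  proof
    assume "V = {\<one>}"
    then show False using V P0c(1) by auto
  qed
  ultimately obtain B where B: "inv_sub B \<and> B \<subset> V"
    and Bmax: "\<And>W. inv_sub W \<and> W \<subset> V \<Longrightarrow> B \<subseteq> W \<Longrightarrow> W = B"
    using ex_maximal_subset[of V "\<lambda>B. inv_sub B \<and> B \<subset> V" "{\<one>}"] subgroup_finite[OF fin VD(1)]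
      V.one_closed by blast
  note BD = inv_subD[OF conjunct1[OF B]]
  interpret B: subgroup B G by (rule BD)
  have BV: "B \<subseteq> V" "B \<noteq> V" using B by auto
  have irred: "W = B \<or> W = V" if "inv_sub W" "B \<subseteq> W" "W \<subseteq> V" for W
    using Bmax[of W] that by blast
  have Bfix: "y \<otimes> b = b \<otimes> y" if "y \<in> P0" "b \<in> B" for y b
    using Vmin[of B] B that by blast
  let ?comm = "\<lambda>y v. y \<otimes> v \<otimes> inv y \<otimes> inv v"
  have comm_V: "y \<otimes> v \<otimes> inv y \<in> V" "?comm y v \<in> V" if "y \<in> P0" "v \<in> V" for y v
    using VD(3) P0c(2) that by simp_all
  \<comment> \<open>The preimage of the fixed points of \<open>P0\<close> on V/B. It is
    \<open>L\<close>-invariant because \<open>L\<close> normalises \<open>P0\<close>, so it is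
    \<open>B\<close> or \<open>V\<close>.\<close>
  define Cc where "Cc = {v \<in> V. \<forall>y\<in>P0. ?comm y v \<in> B}"
  have "inv_sub Cc"
    unfolding inv_sub_def
  proof (intro conjI ballI)
    show "subgroup Cc G"
    proof (rule finite_closed_subgroup[OF fin])
      show "Cc \<subseteq> carrier G" using V.subset by (auto simp: Cc_def)
      have "\<one> \<in> Cc" using P0c(1) by (auto simp: Cc_def)
      then show "Cc \<noteq> {}" by blast
      fix u v assume uv: "u \<in> Cc" "v \<in> Cc"
      have "?comm y (u \<otimes> v) \<in> B" if y: "y \<in> P0" for y
      proof -
        have c: "u \<in> V" "v \<in> V" "y \<in> carrier G" using uv P0c(1)[OF y] by (auto simp: Cc_def)
        have b: "?comm y u \<in> B" "?comm y v \<in> B" using uv y by (auto simp: Cc_def)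
        have "?comm y (u \<otimes> v) = (y \<otimes> u \<otimes> inv y) \<otimes> (?comm y v \<otimes> inv u)"
          using c Vc by (simp add: group_simps)
        also have "?comm y v \<otimes> inv u = inv u \<otimes> ?comm y v"
          using comm comm_V(2)[OF y c(2)] c(1) Vc(2) N.m_inv_closed by blast
        also have "(y \<otimes> u \<otimes> inv y) \<otimes> (inv u \<otimes> ?comm y v) = ?comm y u \<otimes> ?comm y v"
          using c Vc by (simp add: m_assoc)
        finally show ?thesis using b by simp
      qed
      then show "u \<otimes> v \<in> Cc" using uv by (simp add: Cc_def)
    qed
    show "Cc \<subseteq> N" using VD(2) by (auto simp: Cc_def)
    fix l v assume l: "l \<in> L" and v: "v \<in> Cc"
    have vV: "v \<in> V" using v by (simp add: Cc_def)
    have "?comm y (l \<otimes> v \<otimes> inv l) \<in> B" if y: "y \<in> P0" for y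
    proof -
      let ?y = "inv l \<otimes> y \<otimes> l"
      have "?y \<in> P0" using P0(2)[of "inv l" y] l y by simp
      then have "?comm ?y v \<in> B" using v by (simp add: Cc_def)
      then have "l \<otimes> ?comm ?y v \<otimes> inv l \<in> B" using BD(3) l by simp
      moreover have "l \<otimes> ?comm ?y v \<otimes> inv l = ?comm y (l \<otimes> v \<otimes> inv l)"
        using l P0c(1)[OF y] Vc(1)[OF vV] by (simp add: group_simps)
      ultimately show ?thesis by simp
    qed
    then show "l \<otimes> v \<otimes> inv l \<in> Cc" using VD(3)[OF l vV] by (simp add: Cc_def)
  qed
  moreover have "B \<subseteq> Cc"
  proof
    fix b assume b: "b \<in> B"
    have "?comm y b = \<one>" if y: "y \<in> P0" for y
      using Bfix[OF y b] P0c(1)[OF y] b by (simp add: m_assoc)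
    then show "b \<in> Cc" using b BV(1) by (auto simp: Cc_def)
  qed
  moreover have "Cc \<noteq> V"
  proof
    \<comment> \<open>Coprime action: if \<open>P0\<close> centralises both \<open>B\<close> and
      V/B, then the commutator \<open>b\<close> of \<open>y\<close> and \<open>v\<close> is killed
      by a power of \<open>p\<close> and by \<open>q\<close>, so \<open>P0\<close> centralises
      \<open>V\<close>.\<close>
    assume CcV: "Cc = V"
    obtain y v where yv: "y \<in> P0" "v \<in> V" "y \<otimes> v \<noteq> v \<otimes> y" using V by blast
    define b where "b = ?comm y v"
    have b: "b \<in> B" using yv CcV by (auto simp: Cc_def b_def)
    have c: "y \<in> carrier G" "v \<in> carrier G" "b \<in> carrier G" using yv P0c(1) b by auto
    have yb: "y \<otimes> b = b \<otimes> y" using Bfix yv(1) b .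
    have bv: "y \<otimes> v = b \<otimes> v \<otimes> y" using c by (simp add: b_def group_simps)
    have ypow: "y [^] (k::nat) \<otimes> v = b [^] k \<otimes> v \<otimes> y [^] k" for k
    proof (induction k)
      case (Suc k)
      have "y [^] Suc k \<otimes> v = y [^] k \<otimes> (b \<otimes> v \<otimes> y)" using c bv by (simp add: m_assoc)
      also have "\<dots> = b \<otimes> (y [^] k \<otimes> v) \<otimes> y"
        using c group_commutes_pow[OF yb c(1,3), of k] by (simp flip: m_assoc)
      also have "\<dots> = b [^] Suc k \<otimes> v \<otimes> y [^] Suc k"
        using c by (simp add: Suc m_assoc nat_pow_Suc2[of b, symmetric] flip: nat_pow_Suc2[of b])
          (simp add: group_commutes_pow flip: m_assoc)
      finally show ?case .
    qed (use c in simp)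
    have "y [^] (p ^ a) = \<one>" using P(3) P0c(3)[OF yv(1)] .
    then have "v = b [^] (p ^ a) \<otimes> v" using ypow[of "p ^ a"] c by simp
    then have bp: "b [^] (p ^ a) = \<one>" using c by (metis l_one nat_pow_closed one_closed right_cancel)
    have "b [^] q = \<one>" using Nq b BD(2) by blast
    moreover have "coprime (p ^ a) q" using p q by (simp add: primes_coprime)
    ultimately have "b \<in> {\<one>}" using pow_gcd_one[of b "p ^ a" "{\<one>}" q] bp c(3) triv_subgroup by simp
    then show False using bv yv(3) c by simp
  qed
  ultimately have CcB: "Cc = B" using irred[of Cc] by (auto simp: Cc_def)
  define K where "K = {v \<otimes> l |v l. v \<in> V \<and> l \<in> L}"
  have Kmult: "(v \<otimes> l) \<otimes> (v' \<otimes> l') = (v \<otimes> (l \<otimes> v' \<otimes> inv l)) \<otimes> (l \<otimes> l')"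
    if "v \<in> V" "l \<in> L" "v' \<in> V" "l' \<in> L" for v l v' l'
    using that Vc by (simp add: group_simps)
  have Ksub: "subgroup K G"
  proof (rule finite_closed_subgroup[OF fin])
    show "K \<subseteq> carrier G" by (auto simp: K_def)
    show "K \<noteq> {}" using V.one_closed L.one_closed unfolding K_def by blast
    fix x y assume "x \<in> K" "y \<in> K"
    then obtain v l v' l' where x: "x = v \<otimes> l" "y = v' \<otimes> l'" "v \<in> V" "l \<in> L" "v' \<in> V" "l' \<in> L"
      by (auto simp: K_def)
    have "x \<otimes> y = (v \<otimes> (l \<otimes> v' \<otimes> inv l)) \<otimes> (l \<otimes> l')"
      unfolding x(1,2) by (rule Kmult[OF x(3-6)])
    moreover have "v \<otimes> (l \<otimes> v' \<otimes> inv l) \<in> V" "l \<otimes> l' \<in> L" using x VD(3) by simp_all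
    ultimately show "x \<otimes> y \<in> K" unfolding K_def by blast
  qed
  interpret K: subgroup K G by (rule Ksub)
  have VK: "V \<subseteq> K" and LK: "L \<subseteq> K"
  proof -
    show "V \<subseteq> K"
    proof
      fix v assume "v \<in> V"
      then have "v = v \<otimes> \<one>" by simp
      then show "v \<in> K" using \<open>v \<in> V\<close> L.one_closed unfolding K_def by blast
    qed
    show "L \<subseteq> K"
    proof
      fix l assume "l \<in> L"
      then have "l = \<one> \<otimes> l" by simp
      then show "l \<in> K" using \<open>l \<in> L\<close> V.one_closed unfolding K_def by blast
    qed
  qed
  let ?K = "G\<lparr>carrier := K\<rparr>"
  interpret KG: group ?K by (rule subgroup_imp_group[OF Ksub])
  have finK: "finite (carrier ?K)" using subgroup_finite[OF fin Ksub] by simp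
  have Kinv: "inv\<^bsub>?K\<^esub> x = inv x" if "x \<in> K" for x by (rule m_inv_consistent[OF Ksub that])
  have Knormal: "W \<lhd> ?K" if W: "inv_sub W" "W \<subseteq> V" for W
  proof (rule KG.normal_invI)
    note WD = inv_subD[OF W(1)]
    show "subgroup W ?K" using subgroup_incl[OF WD(1) Ksub] W(2) VK by blast
    fix x w assume x: "x \<in> carrier ?K" and w: "w \<in> W"
    then obtain v l where vl: "x = v \<otimes> l" "v \<in> V" "l \<in> L" by (auto simp: K_def)
    have lw: "l \<otimes> w \<otimes> inv l \<in> W" using WD(3) vl(3) w .
    have "x \<otimes> w \<otimes> inv x = v \<otimes> (l \<otimes> w \<otimes> inv l) \<otimes> inv v"
      using vl Vc(1)[of w] W(2) w Vc(1)[of v] by (simp add: group_simps subset_iff)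
    also have "v \<otimes> (l \<otimes> w \<otimes> inv l) = (l \<otimes> w \<otimes> inv l) \<otimes> v"
      using comm Vc(2) vl(2) lw W(2) by blast
    also have "(l \<otimes> w \<otimes> inv l) \<otimes> v \<otimes> inv v = l \<otimes> w \<otimes> inv l"
      using vl Vc(1)[of v] subgroup.mem_carrier[OF WD(1) w] by (simp add: m_assoc)
    finally show "x \<otimes>\<^bsub>?K\<^esub> w \<otimes>\<^bsub>?K\<^esub> inv\<^bsub>?K\<^esub> x \<in> W" using lw x Kinv by simp
  qed
  have BK: "B \<lhd> ?K" using Knormal B BV(1) by blast
  interpret BK: normal B ?K by (rule BK)
  let ?X = "?K Mod B"
  let ?f = "\<lambda>x. B #>\<^bsub>?K\<^esub> x"
  interpret X: group ?X by (rule BK.factorgroup_is_group)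
  interpret f: group_hom ?K ?X ?f
    using BK.r_coset_hom_Mod by (simp add: group_hom_def group_hom_axioms_def)
  have fsurj: "?f ` K = carrier ?X" using carrier_FactGroup[of ?K B] by simp
  have feq: "\<exists>b\<in>B. x = b \<otimes> y" if "x \<in> K" "y \<in> K" "?f x = ?f y" for x y
  proof -
    have "x \<in> B #> y" using rcos_self[of x B] that BD(1) by simp
    then show ?thesis by (auto simp: r_coset_def)
  qed
  define A where "A = normalizer G P \<inter> K"
  have LA: "L \<subseteq> A" using L LK by (auto simp: A_def)
  \<comment> \<open>An element of \<open>V\<close> normalising \<open>P\<close> has its commutators
    with \<open>P0\<close> in both \<open>N\<close> and \<open>P\<close>, hence trivial; so it lies
    in \<open>Cc\<close>, which is \<open>B\<close>.\<close>
  have AB: "v \<in> B" if "v \<in> V" "l \<in> L" "v \<otimes> l \<in> A" for v l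
  proof -
    have lP: "l \<in> normalizer G P" using that(2) L by blast
    have "v \<otimes> l \<otimes> inv l \<in> normalizer G P"
      using that(3) lP subgroup.m_closed[OF normsub] subgroup.m_inv_closed[OF normsub] by (simp add: A_def)
    then have vP: "v \<in> normalizer G P" using that(1,2) Vc(1) by (simp add: m_assoc)
    have "?comm y v \<in> B" if y: "y \<in> P0" for y
    proof -
      have c: "v \<in> carrier G" "y \<in> carrier G" "y \<in> P" using \<open>v \<in> V\<close> Vc P0c[OF y] by auto
      have "v \<otimes> inv y \<otimes> inv v \<in> P" using vP c(3) by (simp add: norm)
      then have "y \<otimes> (v \<otimes> inv y \<otimes> inv v) \<in> P" using c(3) by simp
      then have "?comm y v \<in> P" using c by (simp add: m_assoc)
      moreover have "?comm y v \<in> N" using comm_V(2)[OF y \<open>v \<in> V\<close>] Vc(2) by blast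
      ultimately have "?comm y v = \<one>" using triv P(2) by blast
      then show ?thesis by simp
    qed
    then have "v \<in> Cc" using that(1) by (simp add: Cc_def)
    then show ?thesis using CcB by simp
  qed
  have "residual_chain F G A K"
    using residual_chain_Int[OF chain G Ksub] K.subset by (simp add: A_def Int_absorb1)
  from residual_chain_restrict[OF this G Ksub] have "residual_chain F ?K A K" by simp
  from residual_chain_image[OF this f.homh KG.group_axioms X.group_axioms]
  have chainX: "residual_chain F ?X (?f ` A) (carrier ?X)" using fsurj by simp
  \<comment> \<open>By \<open>AB\<close> the elements of \<open>A\<close> lie in B L, which meets
    \<open>V\<close> only in \<open>B\<close> because \<open>V\<close> and \<open>L\<close> meet
    trivially.\<close>
  have "?f ` A \<noteq> carrier ?X"
  proof
    assume eq: "?f ` A = carrier ?X"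
    obtain v where v: "v \<in> V" "v \<notin> B" using BV by blast
    have "?f v \<in> ?f ` A" using eq fsurj v(1) VK by blast
    then obtain x where x: "x \<in> A" "?f v = ?f x" by blast
    then obtain v' l where vl: "x = v' \<otimes> l" "v' \<in> V" "l \<in> L" by (auto simp: A_def K_def)
    have v'B: "v' \<in> B" using AB vl x(1) by blast
    obtain b where b: "b \<in> B" "v = b \<otimes> x" using feq[of v x] v(1) VK x by (auto simp: A_def)
    have bv: "b \<otimes> v' \<in> B" using b(1) v'B by simp
    have "v = (b \<otimes> v') \<otimes> l" using b vl Vc(1) by (simp add: m_assoc)
    then have "l = inv (b \<otimes> v') \<otimes> v" using bv vl(3) by (simp add: inv_cancel_left)
    moreover have "inv (b \<otimes> v') \<otimes> v \<in> N" using bv BD(2) Vc(2)[OF v(1)] by blast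
    ultimately have "l = \<one>" using triv vl(3) LM by blast
    then have "v = b \<otimes> v'" using \<open>v = (b \<otimes> v') \<otimes> l\<close> bv by simp
    then show False using v(2) bv by simp
  qed
  from residual_chain_top[OF chainX this] obtain A' where A': "subgroup A' ?X" "?f ` A \<subseteq> A'"
    "A' \<subset> carrier ?X" "above_residual F (?X\<lparr>carrier := carrier ?X\<rparr>) A'" by blast
  \<comment> \<open>\<open>S\<close> contains \<open>L\<close> and \<open>B\<close> and is proper in
    \<open>K\<close>, so by irreducibility it meets \<open>V\<close> in \<open>B\<close>. As
    \<open>V\<close> also lies above the residual of \<open>K\<close>, inherited from
    \<open>N\<close>, so does \<open>B\<close>.\<close>
  define S where "S = {x \<in> carrier ?K. ?f x \<in> A'}"
  have resS: "above_residual F ?K S"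
    unfolding S_def using above_residual_hom[OF f.homh, of F A'] A'(4) by simp
  have "subgroup S ?K" unfolding S_def by (rule preimage_subgroup[OF f.homh KG.group_axioms X.group_axioms A'(1)])
  then have Ssub: "subgroup S G" using incl_subgroup[OF Ksub] by blast
  have LS: "L \<subseteq> S" using A'(2) LA LK by (auto simp: S_def)
  have W: "inv_sub (S \<inter> V)"
    unfolding inv_sub_def
  proof (intro conjI ballI)
    show "subgroup (S \<inter> V) G" by (rule subgroups_Inter_pair[OF Ssub VD(1)])
    show "S \<inter> V \<subseteq> N" using VD(2) by blast
    fix l v assume l: "l \<in> L" and v: "v \<in> S \<inter> V"
    have "l \<in> S" using l LS by blast
    then have "l \<otimes> v \<otimes> inv l \<in> S"
      using v by (simp add: subgroup.m_closed[OF Ssub] subgroup.m_inv_closed[OF Ssub])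
    then show "l \<otimes> v \<otimes> inv l \<in> S \<inter> V" using VD(3)[OF l] v by blast
  qed
  have BS: "B \<subseteq> S \<inter> V"
  proof
    fix b assume b: "b \<in> B"
    have "?f b = B" using KG.coset_eq_iff[OF BK, of b] b BV(1) VK by auto
    then show "b \<in> S \<inter> V"
      using b BV(1) VK subgroup.one_closed[OF A'(1)] by (auto simp: S_def)
  qed
  have "S \<inter> V \<noteq> V"
  proof
    assume "S \<inter> V = V"
    then have VS: "V \<subseteq> S" by blast
    have "K \<subseteq> S"
    proof
      fix x assume "x \<in> K"
      then obtain v l where "x = v \<otimes> l" "v \<in> S" "l \<in> S" using VS LS unfolding K_def by blast
      then show "x \<in> S" by (simp add: subgroup.m_closed[OF Ssub])
    qed
    then have "?f ` K \<subseteq> A'" unfolding S_def by blast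
    then have "carrier ?X \<subseteq> A'" unfolding fsurj .
    then show False using A'(3) by (meson leD)
  qed
  then have SVB: "S \<inter> V = B" using irred[OF W BS] by blast
  have "above_residual F ?K N" by (rule above_residual_restrict[OF resN K.subset])
  then have resV: "above_residual F ?K V"
  proof (rule above_residual_mono)
    fix x assume "x \<in> carrier ?K" "x \<in> N"
    then obtain v l where vl: "x = v \<otimes> l" "v \<in> V" "l \<in> L" by (auto simp: K_def)
    then have "l = inv v \<otimes> x" using Vc(1) by (simp add: inv_cancel_left)
    then have "l \<in> N" using \<open>x \<in> N\<close> Vc(2)[OF vl(2)] by simp
    then have "l = \<one>" using triv vl(3) LM by blast
    then show "x \<in> V" using vl Vc(1) by simp
  qed
  have resB: "above_residual F ?K B"
    using above_residual_Int[OF KG.group_axioms finK resS resV] SVB by simp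
  obtain v where v: "v \<in> V" "v \<notin> Cc" using CcB BV by blast
  then obtain y where yv: "y \<in> P0" "v \<in> V" "?comm y v \<notin> B" unfolding Cc_def by blast
  have Vcomm: "u \<otimes> v = v \<otimes> u" if "u \<in> V" "v \<in> V" for u v using comm that Vc(2) by blast
  have Vq: "v [^] q = \<one>" if "v \<in> V" for v using Nq that Vc(2) by blast
  \<comment> \<open>Trivial on \<open>B\<close>, so that \<mu> below kills \<open>B\<close>; nonzero
    on the commutator, so that \<mu> separates \<open>y\<close> from the identity.\<close>
  obtain lam :: "'a \<Rightarrow> int" where lam: "\<And>v. v \<in> V \<Longrightarrow> lam v \<in> {0..<int q}"
    "\<And>u v. u \<in> V \<Longrightarrow> v \<in> V \<Longrightarrow> lam (u \<otimes> v) = (lam u + lam v) mod int q"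
    "\<And>b. b \<in> B \<Longrightarrow> lam b = 0" "lam (?comm y v) \<noteq> 0"
  proof (rule ex_functional_subgroup[OF fin q VD(1) Vcomm Vq BD(1) BV(1) comm_V(2)[OF yv(1,2)] yv(3)])
    fix l :: "'a \<Rightarrow> int"
    assume "\<And>v. v \<in> V \<Longrightarrow> l v \<in> {0..<int q}"
      "\<And>u v. u \<in> V \<Longrightarrow> v \<in> V \<Longrightarrow> l (u \<otimes> v) = (l u + l v) mod int q"
      "\<And>b. b \<in> B \<Longrightarrow> l b = 0" "l (?comm y v) \<noteq> 0"
    then show thesis by (rule that)
  qed
  have VL1: "x = \<one>" if "x \<in> V" "x \<in> L" for x using triv that Vc(2) LM by blast
  define \<phi> where "\<phi> x = (SOME l. l \<in> L \<and> (\<exists>v\<in>V. x = v \<otimes> l))" for x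
  have \<phi>: "\<phi> (v \<otimes> l) = l" if vl: "v \<in> V" "l \<in> L" for v l
  proof -
    have "\<phi> (v \<otimes> l) \<in> L \<and> (\<exists>v'\<in>V. v \<otimes> l = v' \<otimes> \<phi> (v \<otimes> l))"
      unfolding \<phi>_def by (rule someI_ex) (use vl in blast)
    then show ?thesis using factor_unique(2)[OF VD(1) Lsub VL1] vl by metis
  qed
  have \<phi>hom: "\<phi> \<in> hom ?K (G\<lparr>carrier := L\<rparr>)"
  proof (rule homI)
    fix x x' assume "x \<in> carrier ?K" "x' \<in> carrier ?K"
    then obtain v l v' l' where x: "x = v \<otimes> l" "x' = v' \<otimes> l'" "v \<in> V" "l \<in> L" "v' \<in> V" "l' \<in> L"
      by (auto simp: K_def)
    have "\<phi> (x \<otimes> x') = l \<otimes> l'"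
      unfolding x(1,2) Kmult[OF x(3,4,5,6)] using x VD(3) by (intro \<phi>) auto
    then show "\<phi> (x \<otimes>\<^bsub>?K\<^esub> x') = \<phi> x \<otimes>\<^bsub>G\<lparr>carrier := L\<rparr>\<^esub> \<phi> x'" using x \<phi> by simp
  qed (use \<phi> in \<open>auto simp: K_def\<close>)
  have \<phi>V: "\<phi> v = \<one>" if "v \<in> V" for v using \<phi>[of v \<one>] that Vc(1) by simp
  \<comment> \<open>The coinduced form of \<open>lam\<close>: evaluation along the conjugates of
    \<open>v\<close> turns conjugation into right translation.\<close>
  define \<mu> where "\<mu> v = (\<lambda>l. if l \<in> L then lam (l \<otimes> v \<otimes> inv l) else 0)" for v
  have "LF.good (\<mu> ` V)"
  proof (rule LF.good_image[OF KG.group_axioms finK Knormal[OF conjunct1[OF V] order_refl] resB \<phi>hom])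
    show "\<phi> ` carrier ?K = carrier (G\<lparr>carrier := L\<rparr>)"
    proof
      show "carrier (G\<lparr>carrier := L\<rparr>) \<subseteq> \<phi> ` carrier ?K"
      proof
        fix l assume "l \<in> carrier (G\<lparr>carrier := L\<rparr>)"
        then have "l \<in> L" by simp
        then have "\<phi> l = l" using \<phi>[OF V.one_closed, of l] by simp
        then show "l \<in> \<phi> ` carrier ?K" using LK \<open>l \<in> L\<close> by (intro image_eqI[of _ _ l]) auto
      qed
    qed (use \<phi> in \<open>auto simp: K_def\<close>)
    show "\<mu> v \<in> LF.fns" if "v \<in> V" for v
      using lam(1) VD(3) that by (auto simp: \<mu>_def LF.fns_def)
    show "\<mu> (u \<otimes>\<^bsub>?K\<^esub> v) = LF.fadd (\<mu> u) (\<mu> v)" if uv: "u \<in> V" "v \<in> V" for u v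
    proof -
      have "lam (l \<otimes> (u \<otimes> v) \<otimes> inv l) = (lam (l \<otimes> u \<otimes> inv l) + lam (l \<otimes> v \<otimes> inv l)) mod int q" if l: "l \<in> L" for l
      proof -
        have "l \<otimes> (u \<otimes> v) \<otimes> inv l = (l \<otimes> u \<otimes> inv l) \<otimes> (l \<otimes> v \<otimes> inv l)"
          using l uv Vc(1) by (simp add: group_simps)
        then show ?thesis using lam(2) VD(3) l uv by simp
      qed
      then show ?thesis by (auto simp: \<mu>_def LF.fadd_def)
    qed
    show "\<mu> (x \<otimes>\<^bsub>?K\<^esub> v \<otimes>\<^bsub>?K\<^esub> inv\<^bsub>?K\<^esub> x) = LF.rtrans (\<phi> x) (\<mu> v)"
      if x: "x \<in> carrier ?K" and v: "v \<in> V" for x v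
    proof -
      obtain v' l where vl: "x = v' \<otimes> l" "v' \<in> V" "l \<in> L" using x by (auto simp: K_def)
      have lv: "l \<otimes> v \<otimes> inv l \<in> V" using VD(3) vl(3) v .
      have "x \<otimes> v \<otimes> inv x = v' \<otimes> (l \<otimes> v \<otimes> inv l) \<otimes> inv v'"
        using vl v Vc(1) by (simp add: group_simps)
      also have "v' \<otimes> (l \<otimes> v \<otimes> inv l) = (l \<otimes> v \<otimes> inv l) \<otimes> v'"
        using comm Vc(2) vl(2) lv by blast
      also have "(l \<otimes> v \<otimes> inv l) \<otimes> v' \<otimes> inv v' = l \<otimes> v \<otimes> inv l"
        using vl Vc(1) lv v by (simp add: m_assoc)
      finally have xv: "x \<otimes> v \<otimes> inv x = l \<otimes> v \<otimes> inv l" .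
      have "m \<otimes> (l \<otimes> v \<otimes> inv l) \<otimes> inv m = (m \<otimes> l) \<otimes> v \<otimes> inv (m \<otimes> l)" if "m \<in> L" for m
        using that vl(3) v Vc(1) by (simp add: group_simps)
      moreover have "\<phi> x = l" using vl \<phi> by simp
      ultimately show ?thesis using x Kinv xv vl(3) by (auto simp: \<mu>_def LF.rtrans_def)
    qed
    show "\<phi> b = \<one>\<^bsub>G\<lparr>carrier := L\<rparr>\<^esub>" if "b \<in> B" for b using \<phi>V that BV(1) by auto
    show "\<mu> b = LF.fzero" if "b \<in> B" for b using lam(3) BD(3) that by (auto simp: \<mu>_def LF.fzero_def)
    show "subgroup B ?K" by (rule BK.subgroup_axioms)
  qed
  then have tame: "\<mu> v \<in> LF.tame" using yv(2) by (auto simp: LF.tame_def)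
  have yL: "y \<in> L" "y \<in> carrier G" using P0c yv(1) by auto
  \<comment> \<open>The conjugate of \<open>v\<close> by \<open>y\<close> is the commutator times
    \<open>v\<close>, so the two values differ by \<open>lam\<close> of the commutator.\<close>
  have "\<mu> v y \<noteq> \<mu> v \<one>"
  proof
    assume eq: "\<mu> v y = \<mu> v \<one>"
    have "y \<otimes> v \<otimes> inv y = ?comm y v \<otimes> v" using yL(2) Vc(1)[OF yv(2)] by (simp add: m_assoc)
    then have "lam (y \<otimes> v \<otimes> inv y) = (lam (?comm y v) + lam v) mod int q"
      using lam(2)[OF comm_V(2)[OF yv(1,2)] yv(2)] by simp
    moreover have "lam (y \<otimes> v \<otimes> inv y) = lam v"
      using eq yL(1) Vc(1)[OF yv(2)] by (simp add: \<mu>_def)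
    ultimately have "(lam (?comm y v) + lam v) mod int q = (0 + lam v) mod int q"
      using lam(1)[OF yv(2)] by simp
    then have "int q dvd lam (?comm y v)" by (simp add: mod_eq_dvd_iff)
    then have "lam (?comm y v) = 0"
      using lam(1)[OF comm_V(2)[OF yv(1,2)]] by (metis atLeastLessThan_iff mod_pos_pos_trivial dvd_imp_mod_0)
    then show False using lam(4) by simp
  qed
  then have "y \<notin> LF.tame_stabilizer"
    using tame yL by (auto simp: LF.tame_stabilizer_def intro!: bexI[of _ "\<mu> v"] bexI[of _ \<one>])
  then show ?thesis using yv(1) by blast
qed

end

section \<open>Groups with a unique minimal normal subgroup\<close>

context p_length_one_formation
begin

lemma in_class_unique_minimal_normal:
  fixes G (structure)
  assumes G: "group G" and fin: "finite (carrier G)" and chains: "normalizer_chains G"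
    and primes: "primes_of G \<subseteq> class_primes F"
    and N: "N \<lhd> G" "N \<noteq> {\<one>}" and minimal: "\<And>Y. Y \<lhd> G \<Longrightarrow> Y \<noteq> {\<one>} \<Longrightarrow> N \<subseteq> Y"
    and resN: "above_residual F G N"
  shows "in_class G F"
proof (rule ccontr)
  assume not_in: "\<not> in_class G F"
  interpret group G by (rule G)
  interpret N: normal N G by (rule N)
  have Nsub: "subgroup N G" by (rule N.subgroup_axioms)
  obtain q where q: "prime q" "q dvd card N" and Nq: "\<And>x. x \<in> N \<Longrightarrow> x [^] q = \<one>"
    and comm: "\<And>x y. x \<in> N \<Longrightarrow> y \<in> N \<Longrightarrow> x \<otimes> y = y \<otimes> x"
    using minimal_normal_elementary_abelian[OF G fin chains N minimal] by blast
  have q_in: "q \<in> class_primes F"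
    using primes q subgroup_card_dvd[OF Nsub] by (auto simp: primes_of_def dest: dvd_trans)
  have "\<not> N \<subseteq> frattini G"
  proof
    assume "N \<subseteq> frattini G"
    then have "above_residual F G (frattini G)" by (intro above_residual_mono[OF resN]) blast
    then show False using in_class_frattini[OF G fin] not_in by blast
  qed
  then obtain M where M: "maximal_subgroup M G" "\<not> N \<subseteq> M"
    using N.subset by (auto simp: frattini_def)
  have Msub: "subgroup M G" and Mmax: "\<And>K. subgroup K G \<Longrightarrow> M \<subseteq> K \<Longrightarrow> K = M \<or> K = carrier G"
    using M(1) by (auto simp: maximal_subgroup_def)
  interpret M: subgroup M G by (rule Msub)
  have mult: "(n \<otimes> m) \<otimes> (n' \<otimes> m') = (n \<otimes> (m \<otimes> n' \<otimes> inv m)) \<otimes> (m \<otimes> m')"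
    if "n \<in> N" "m \<in> M" "n' \<in> N" "m' \<in> M" for n m n' m'
    using that by (simp add: group_simps)
  have decomp: "\<exists>n\<in>N. \<exists>m\<in>M. g = n \<otimes> m" if g: "g \<in> carrier G" for g
  proof -
    let ?K = "{n \<otimes> m |n m. n \<in> N \<and> m \<in> M}"
    have "subgroup ?K G"
    proof (rule finite_closed_subgroup[OF fin])
      show "?K \<subseteq> carrier G" by auto
      show "?K \<noteq> {}" using N.one_closed M.one_closed by blast
      fix x y assume "x \<in> ?K" "y \<in> ?K"
      then obtain n m n' m' where x: "x = n \<otimes> m" "y = n' \<otimes> m'" "n \<in> N" "m \<in> M" "n' \<in> N" "m' \<in> M" by blast
      have "x \<otimes> y = (n \<otimes> (m \<otimes> n' \<otimes> inv m)) \<otimes> (m \<otimes> m')" unfolding x(1,2) by (rule mult[OF x(3-6)])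
      moreover have "n \<otimes> (m \<otimes> n' \<otimes> inv m) \<in> N" "m \<otimes> m' \<in> M"
        using x N.inv_op_closed2[of m n'] by simp_all
      ultimately show "x \<otimes> y \<in> ?K" by blast
    qed
    moreover have "M \<subseteq> ?K"
    proof
      fix m assume m: "m \<in> M"
      then have "m = \<one> \<otimes> m" by simp
      then show "m \<in> ?K" using m N.one_closed by blast
    qed
    ultimately have alt: "?K = M \<or> ?K = carrier G" by (rule Mmax)
    have NK: "N \<subseteq> ?K"
    proof
      fix n assume n: "n \<in> N"
      then have "n = n \<otimes> \<one>" by simp
      then show "n \<in> ?K" using n M.one_closed by blast
    qed
    have "?K \<noteq> M"
    proof
      assume eq: "?K = M"
      show False using NK M(2) unfolding eq by simp
    qed
    then have "?K = carrier G" using alt by simp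
    then have "g \<in> ?K" using g by simp
    then show ?thesis by blast
  qed
  \<comment> \<open>By \<open>decomp\<close>, conjugation by \<open>G\<close> reduces to conjugation
    by \<open>N\<close> and by \<open>M\<close>. The normal subgroups to which minimality of
    \<open>N\<close> is applied below all arise in this way.\<close>
  have normal_of: "Y \<lhd> G" if Y: "subgroup Y G" "\<And>n y. n \<in> N \<Longrightarrow> y \<in> Y \<Longrightarrow> n \<otimes> y = y \<otimes> n"
    "\<And>m y. m \<in> M \<Longrightarrow> y \<in> Y \<Longrightarrow> m \<otimes> y \<otimes> inv m \<in> Y" for Y
  proof (rule normal_invI[OF Y(1)])
    fix g y assume g: "g \<in> carrier G" and y: "y \<in> Y"
    obtain n m where nm: "n \<in> N" "m \<in> M" "g = n \<otimes> m" using decomp[OF g] by blast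
    have my: "m \<otimes> y \<otimes> inv m \<in> Y" using Y(3) nm(2) y .
    have yc: "y \<in> carrier G" using subgroup.mem_carrier[OF Y(1) y] .
    have "g \<otimes> y \<otimes> inv g = n \<otimes> (m \<otimes> y \<otimes> inv m) \<otimes> inv n"
      using nm yc by (simp add: group_simps)
    also have "n \<otimes> (m \<otimes> y \<otimes> inv m) = (m \<otimes> y \<otimes> inv m) \<otimes> n" using Y(2)[OF nm(1) my] .
    also have "(m \<otimes> y \<otimes> inv m) \<otimes> n \<otimes> inv n = m \<otimes> y \<otimes> inv m"
      using nm yc by (simp add: m_assoc)
    finally show "g \<otimes> y \<otimes> inv g \<in> Y" using my by simp
  qed
  have triv: "x = \<one>" if "x \<in> N" "x \<in> M" for x
  proof -
    have "N \<inter> M \<lhd> G"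
    proof (rule normal_of)
      show "subgroup (N \<inter> M) G" by (rule subgroups_Inter_pair[OF Nsub Msub])
      show "n \<otimes> y = y \<otimes> n" if "n \<in> N" "y \<in> N \<inter> M" for n y using comm that by blast
      show "m \<otimes> y \<otimes> inv m \<in> N \<inter> M" if "m \<in> M" "y \<in> N \<inter> M" for m y
        using that N.inv_op_closed2[of m y] by simp
    qed
    then have "N \<inter> M = {\<one>}" using minimal M(2) by blast
    then show ?thesis using that by blast
  qed
  have conj_comm: "n \<otimes> (m \<otimes> c \<otimes> inv m) = (m \<otimes> c \<otimes> inv m) \<otimes> n"
    if c: "n \<in> carrier G" "m \<in> carrier G" "c \<in> carrier G"
      and eq: "(inv m \<otimes> n \<otimes> m) \<otimes> c = c \<otimes> (inv m \<otimes> n \<otimes> m)" for n m c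
  proof -
    have "n \<otimes> (m \<otimes> c \<otimes> inv m) = m \<otimes> ((inv m \<otimes> n \<otimes> m) \<otimes> c) \<otimes> inv m"
      using c by (simp add: group_simps)
    also have "\<dots> = m \<otimes> (c \<otimes> (inv m \<otimes> n \<otimes> m)) \<otimes> inv m" by (simp only: eq)
    also have "\<dots> = (m \<otimes> c \<otimes> inv m) \<otimes> n" using c by (simp add: group_simps)
    finally show ?thesis .
  qed
  have comm_mult: "n \<otimes> (a \<otimes> b) = (a \<otimes> b) \<otimes> n"
    if c: "n \<in> carrier G" "a \<in> carrier G" "b \<in> carrier G" and eq: "n \<otimes> a = a \<otimes> n" "n \<otimes> b = b \<otimes> n" for n a b
  proof -
    have "n \<otimes> (a \<otimes> b) = (n \<otimes> a) \<otimes> b" using c by (simp add: m_assoc)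
    also have "\<dots> = (a \<otimes> n) \<otimes> b" by (simp only: eq(1))
    also have "\<dots> = a \<otimes> (n \<otimes> b)" using c by (simp add: m_assoc)
    also have "\<dots> = a \<otimes> (b \<otimes> n)" by (simp only: eq(2))
    also have "\<dots> = (a \<otimes> b) \<otimes> n" using c by (simp add: m_assoc)
    finally show ?thesis .
  qed
  \<comment> \<open>The centraliser of \<open>N\<close> in \<open>M\<close> is normal in
    \<open>G\<close> and does not contain \<open>N\<close>, as \<open>M\<close> does not; minimality
    makes it trivial.\<close>
  have faithful: "m = \<one>" if m: "m \<in> M" "\<And>n. n \<in> N \<Longrightarrow> n \<otimes> m = m \<otimes> n" for m
  proof -
    let ?C = "{m \<in> M. \<forall>n\<in>N. n \<otimes> m = m \<otimes> n}"
    have "?C \<lhd> G"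
    proof (rule normal_of)
      show "subgroup ?C G"
      proof (rule finite_closed_subgroup[OF fin])
        show "?C \<subseteq> carrier G" using M.subset by blast
        show "?C \<noteq> {}" using m by blast
        show "a \<otimes> b \<in> ?C" if "a \<in> ?C" "b \<in> ?C" for a b
          using that comm_mult M.mem_carrier N.mem_carrier M.m_closed by blast
      qed
      show "n \<otimes> y = y \<otimes> n" if "n \<in> N" "y \<in> ?C" for n y using that by blast
      fix x y assume x: "x \<in> M" and y: "y \<in> ?C"
      have "n \<otimes> (x \<otimes> y \<otimes> inv x) = (x \<otimes> y \<otimes> inv x) \<otimes> n" if n: "n \<in> N" for n
      proof (rule conj_comm)
        have "inv x \<otimes> n \<otimes> x \<in> N" using N.inv_op_closed1[of x n] x n by simp
        then show "(inv x \<otimes> n \<otimes> x) \<otimes> y = y \<otimes> (inv x \<otimes> n \<otimes> x)" using y by blast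
      qed (use n x y in auto)
      moreover have "x \<otimes> y \<otimes> inv x \<in> M" using x y by (intro M.m_closed M.m_inv_closed) blast+
      ultimately show "x \<otimes> y \<otimes> inv x \<in> ?C" by blast
    qed
    then have "?C = {\<one>}" using minimal M(2) by blast
    then show ?thesis using m by blast
  qed
  have card_N: "\<exists>k. card N = q ^ k"
    using p_group_card[OF fin Nsub q(1)] Nq by (metis power_one_right)
  \<comment> \<open>The q-group \<open>Y\<close> has nontrivial fixed points on the q-group
    \<open>N\<close>. They form a normal subgroup of \<open>G\<close>, hence all of
    \<open>N\<close>, and \<open>faithful\<close> makes \<open>Y\<close> trivial.\<close>
  have no_normal_q_subgroup: "Y = {\<one>}" if Y: "subgroup Y G" "Y \<subseteq> M"
    "\<And>m y. m \<in> M \<Longrightarrow> y \<in> Y \<Longrightarrow> m \<otimes> y \<otimes> inv m \<in> Y" "card Y = q ^ k" for Y k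
  proof -
    obtain j where j: "card N = q ^ j" using card_N by blast
    have Yc: "y \<in> carrier G" if "y \<in> Y" for y using subgroup.mem_carrier[OF Y(1) that] .
    have "y \<otimes> x \<otimes> inv y \<in> N" if "y \<in> Y" "x \<in> N" for y x using N.inv_op_closed2[OF Yc[OF that(1)] that(2)] .
    from p_group_fixed_point[OF fin q(1) Y(1,4) Nsub j N(2) this]
    obtain z where z: "z \<in> N" "z \<noteq> \<one>" "\<And>y. y \<in> Y \<Longrightarrow> y \<otimes> z = z \<otimes> y" by blast
    let ?Z = "{n \<in> N. \<forall>y\<in>Y. y \<otimes> n = n \<otimes> y}"
    have "?Z \<lhd> G"
    proof (rule normal_of)
      show "subgroup ?Z G"
      proof (rule finite_closed_subgroup[OF fin])
        show "?Z \<subseteq> carrier G" using N.subset by blast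
        show "?Z \<noteq> {}" using z by blast
        show "a \<otimes> b \<in> ?Z" if "a \<in> ?Z" "b \<in> ?Z" for a b
          using that comm_mult Yc N.mem_carrier N.m_closed by blast
      qed
      show "n \<otimes> y = y \<otimes> n" if "n \<in> N" "y \<in> ?Z" for n y using comm that by blast
      fix m n assume m: "m \<in> M" and n: "n \<in> ?Z"
      have "y \<otimes> (m \<otimes> n \<otimes> inv m) = (m \<otimes> n \<otimes> inv m) \<otimes> y" if y: "y \<in> Y" for y
      proof (rule conj_comm)
        have "inv m \<otimes> y \<otimes> m \<in> Y" using Y(3)[of "inv m" y] m y by simp
        then show "(inv m \<otimes> y \<otimes> m) \<otimes> n = n \<otimes> (inv m \<otimes> y \<otimes> m)" using n by blast
      qed (use m n Yc[OF y] in auto)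
      moreover have "m \<otimes> n \<otimes> inv m \<in> N" using n m N.inv_op_closed2[of m n] by simp
      ultimately show "m \<otimes> n \<otimes> inv m \<in> ?Z" by blast
    qed
    moreover have "?Z \<noteq> {\<one>}" using z by blast
    ultimately have NZ: "N \<subseteq> ?Z" by (rule minimal)
    have "y = \<one>" if y: "y \<in> Y" for y
    proof (rule faithful)
      show "y \<in> M" using y Y(2) by blast
      show "n \<otimes> y = y \<otimes> n" if "n \<in> N" for n using NZ that y by force
    qed
    then show ?thesis using subgroup.one_closed[OF Y(1)] by blast
  qed
  let ?H = "G\<lparr>carrier := M\<rparr>"
  interpret H: group ?H by (rule subgroup_imp_group[OF Msub])
  have finH: "finite (carrier ?H)" using subgroup_finite[OF fin Msub] by simp
  have Hinv: "inv\<^bsub>?H\<^esub> x = inv x" if "x \<in> M" for x by (rule m_inv_consistent[OF Msub that])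
  \<comment> \<open>\<open>M\<close> meets \<open>N\<close> trivially and so embeds into
    G/N.\<close>
  have "above_residual F ?H N" by (rule above_residual_restrict[OF resN M.subset])
  then have "above_residual F ?H {\<one>\<^bsub>?H\<^esub>}" by (rule above_residual_mono) (use triv in simp)
  then have H_in: "in_class ?H F" using H.group_axioms in_class_above_residual by blast
  have ff: "formation_functions F K q" if "in_class K F" for K :: "('a, 'b) monoid_scheme"
    using that in_class_finite[OF that] q(1) q_in
    by (auto simp: in_class_def formation_functions_def formation_functions_axioms_def
        modular_functions_def modular_functions_axioms_def saturated_formation_axioms)
  interpret T: formation_functions F ?H q by (rule ff[OF H_in])
  interpret D: normal "T.tame_stabilizer" ?H by (rule T.tame_stabilizer_normal)
  let ?D = "T.tame_stabilizer"
  have Dsub: "subgroup ?D G" using incl_subgroup[OF Msub D.subgroup_axioms] .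
  have DM: "?D \<subseteq> M" using D.subset by simp
  have Dconj: "m \<otimes> d \<otimes> inv m \<in> ?D" if "m \<in> M" "d \<in> ?D" for m d
    using D.inv_op_closed2[of m d] that Hinv by simp
  have "?D = {\<one>}"
  proof (rule ccontr)
    assume D1: "?D \<noteq> {\<one>}"
    have "\<exists>p. prime p \<and> p \<noteq> q \<and> p dvd card ?D"
    proof (rule ccontr)
      assume none: "\<nexists>p. prime p \<and> p \<noteq> q \<and> p dvd card ?D"
      have "card ?D > 0" using subgroup.finite_imp_card_positive[OF Dsub fin] .
      then obtain k m where km: "card ?D = q ^ k * m" "\<not> q dvd m"
        using multiplicity_decompose'[of "card ?D" q] q(1) by (metis neq0_conv not_prime_unit)
      have "m = 1"
      proof (rule ccontr)
        assume "m \<noteq> 1"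
        then obtain r where "prime r" "r dvd m" using prime_factor_nat by blast
        then show False using none km by (metis dvd_mult)
      qed
      then have "card ?D = q ^ k" using km(1) by simp
      then show False using no_normal_q_subgroup[OF Dsub DM Dconj] D1 by blast
    qed
    then obtain p where p: "prime p" "p \<noteq> q" "p dvd card ?D" by blast
    obtain x where x: "x \<in> ?D" "x \<noteq> \<one>" "x [^] p = \<one>" using cauchy[OF fin p(1) Dsub p(3)] .
    have xM: "x \<in> M" using x(1) DM by blast
    obtain P where P: "sylow_subgroup p P ?H" using sylow_subgroup_exists[OF H.group_axioms finH p(1)] .
    obtain g where g: "g \<in> M" "g \<otimes> x \<otimes> inv g \<in> P"
    proof -
      have "x \<in> carrier ?H" "x [^]\<^bsub>?H\<^esub> (p ^ 1) = \<one>\<^bsub>?H\<^esub>"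
        using xM x(3) by (simp_all add: nat_pow_consistent[symmetric])
      from H.p_element_conjugate_in_sylow[OF finH p(1) P this]
      obtain g where g: "g \<in> M" "g \<otimes> x \<otimes> inv\<^bsub>?H\<^esub> g \<in> P" by auto
      show thesis by (rule that[OF g(1)]) (use g Hinv in simp)
    qed
    define x1 where "x1 = g \<otimes> x \<otimes> inv g"
    have x1: "x1 \<in> ?D" "x1 \<in> P" using Dconj[OF g(1) x(1)] g(2) by (auto simp: x1_def)
    have x1_ne: "x1 \<noteq> \<one>"
    proof
      assume "x1 = \<one>"
      then have "inv g \<otimes> x1 \<otimes> g = \<one>" using g(1) by simp
      then show False using g(1) xM x(2) by (simp add: x1_def group_simps)
    qed
    have PH: "subgroup P ?H" "card P = p ^ multiplicity p (card M)"
      using P by (auto simp: sylow_subgroup_def order_def)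
    have Psub: "subgroup P G" using incl_subgroup[OF Msub PH(1)] .
    have PM: "P \<subseteq> M" using subgroup.subset[OF PH(1)] by simp
    \<comment> \<open>Unique factorisation computes \<open>order G\<close>. As \<open>p\<close> does
      not divide \<open>card N\<close>, the Sylow subgroup \<open>P\<close> of \<open>M\<close> is
      one of \<open>G\<close>, and the hypothesis provides a chain from its normaliser.\<close>
    have "bij_betw (\<lambda>(n, m). n \<otimes> m) (N \<times> M) (carrier G)"
      unfolding bij_betw_def
    proof
      show "inj_on (\<lambda>(n, m). n \<otimes> m) (N \<times> M)"
      proof (rule inj_onI, clarify)
        fix n m n' m' assume "n \<in> N" "m \<in> M" "n' \<in> N" "m' \<in> M" "n \<otimes> m = n' \<otimes> m'"
        then show "n = n' \<and> m = m'" using factor_unique[OF Nsub Msub triv, of n m n' m'] by simp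
      qed
      show "(\<lambda>(n, m). n \<otimes> m) ` (N \<times> M) = carrier G"
      proof
        show "carrier G \<subseteq> (\<lambda>(n, m). n \<otimes> m) ` (N \<times> M)"
        proof
          fix g assume "g \<in> carrier G"
          then obtain n m where "n \<in> N" "m \<in> M" "g = n \<otimes> m" using decomp by blast
          then show "g \<in> (\<lambda>(n, m). n \<otimes> m) ` (N \<times> M)" by (intro image_eqI[of _ _ "(n, m)"]) auto
        qed
      qed auto
    qed
    then have order: "order G = card N * card M"
      by (metis bij_betw_same_card card_cartesian_product order_def)
    have "\<not> p dvd card N"
    proof
      obtain j where j: "card N = q ^ j" using card_N by blast
      assume "p dvd card N"
      then have "p dvd q" using j p(1) by (metis prime_dvd_power)
      then show False using p q(1) by (simp add: primes_dvd_imp_eq)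
    qed
    then have "multiplicity p (order G) = multiplicity p (card M)"
    proof -
      have "card N \<noteq> 0" "card M \<noteq> 0"
        using subgroup.finite_imp_card_positive[OF Nsub fin] subgroup.finite_imp_card_positive[OF Msub fin] by simp_all
      then show ?thesis
        using prime_elem_multiplicity_mult_distrib[of p "card N" "card M"] p(1) \<open>\<not> p dvd card N\<close> order
        by (simp add: not_dvd_imp_multiplicity_0)
    qed
    then have "sylow_subgroup p P G" using Psub PH(2) by (simp add: sylow_subgroup_def)
    then have chain: "residual_chain F G (normalizer G P) (carrier G)"
      using chains p(1) by (simp add: normalizer_chains_def)
    define L where "L = normalizer G P \<inter> M"
    have normG: "normalizer G P = {g \<in> carrier G. \<forall>x\<in>P. g \<otimes> x \<otimes> inv g \<in> P}"
      by (rule normalizer_eq[OF fin Psub])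
    have normH: "normalizer ?H P = L"
      unfolding H.normalizer_eq[OF finH PH(1)] L_def normG using Hinv by auto
    have LH: "subgroup L ?H" using H.normalizer_subgroup[of P] PM normH by simp
    have LM: "L \<subseteq> M" by (simp add: L_def)
    obtain C R where S: "p_series p ?H C R" using in_class_p_series[OF H_in p(1)] .
    have C: "C \<lhd> ?H" using S by (simp add: p_series_def)
    have HL: "?H\<lparr>carrier := L\<rparr> = G\<lparr>carrier := L\<rparr>" by simp
    have LF: "formation_functions F (G\<lparr>carrier := L\<rparr>) q"
      using ff[of "G\<lparr>carrier := L\<rparr>"] in_class_subgroup[OF H_in LH] HL by simp
    \<comment> \<open>\<open>L\<close> normalises both factors of this intersection, and
      \<open>x1\<close> shows that it does not centralise \<open>N\<close>. An element of it that is
      not in the stabiliser over \<open>L\<close> will lie outside the stabiliser over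
      \<open>M\<close>, a contradiction.\<close>
    let ?P0 = "?D \<inter> P"
    have Ppow: "x [^] (p ^ multiplicity p (card M)) = \<one>" if "x \<in> P" for x
      using subgroup_pow_card[OF Psub fin that] PH(2) by simp
    have P0conj: "l \<otimes> y \<otimes> inv l \<in> ?P0" if "l \<in> L" "y \<in> ?P0" for l y
      using that Dconj[of l y] by (auto simp: L_def normG)
    have "\<exists>n\<in>N. n \<otimes> x1 \<noteq> x1 \<otimes> n"
    proof (rule ccontr)
      assume "\<not> (\<exists>n\<in>N. n \<otimes> x1 \<noteq> x1 \<otimes> n)"
      then have "n \<otimes> x1 = x1 \<otimes> n" if "n \<in> N" for n using that by blast
      moreover have "x1 \<in> M" using x1(1) DM by blast
      ultimately show False using faithful[of x1] x1_ne by blast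
    qed
    then obtain n0 where n0: "n0 \<in> N" "x1 \<otimes> n0 \<noteq> n0 \<otimes> x1" by fastforce
    have NM1: "N \<inter> M = {\<one>}" using triv N.one_closed M.one_closed by blast
    have x1P0: "x1 \<in> ?P0" using x1 by blast
    have "\<exists>y\<in>?P0. y \<notin> formation_functions.tame_stabilizer F (G\<lparr>carrier := L\<rparr>) q"
      by (rule tame_stabilizer_sylow_normalizer[OF G fin N(1) q(1) Nq comm Msub NM1 resN p(1,2) Psub PM Ppow
          chain L_def Int_lower2 P0conj x1P0 n0 LF])
    then obtain y where y: "y \<in> ?P0" "y \<notin> formation_functions.tame_stabilizer F (G\<lparr>carrier := L\<rparr>) q"
      by blast
    interpret P: subgroup P G by (rule Psub)
    have "y \<in> normalizer G P" unfolding normG using y(1) by simp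
    then have yL: "y \<in> L" unfolding L_def using y(1) PM by blast
    have "y \<notin> T.tame_stabilizer"
    proof (rule tame_stabilizer_supplement[OF T.formation_functions_axioms _ C LH _ p(1)])
      show "formation_functions F (?H\<lparr>carrier := L\<rparr>) q" using LF HL by simp
      show "\<exists>c\<in>C. \<exists>l\<in>L. h = c \<otimes>\<^bsub>?H\<^esub> l" if "h \<in> carrier ?H" for h
        using H.p_series_sylow(1)[OF finH p(1) P S that] normH by simp
      show "\<exists>k::nat. \<not> p dvd k \<and> c [^]\<^bsub>?H\<^esub> k = \<one>\<^bsub>?H\<^esub>" if "c \<in> C" for c
        using S that by (simp add: p_series_def)
      show "y \<in> L" by (rule yL)
      show "y [^]\<^bsub>?H\<^esub> (p ^ multiplicity p (card M)) = \<one>\<^bsub>?H\<^esub>"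
        using Ppow y(1) by (simp add: nat_pow_consistent[symmetric])
      show "j \<otimes>\<^bsub>?H\<^esub> y = y \<otimes>\<^bsub>?H\<^esub> j" if "j \<in> C" "j \<in> L" for j
        using H.p_series_sylow(2)[OF finH p(1) P S that(1)] normH that(2) y(1) by blast
      show "y \<notin> formation_functions.tame_stabilizer F (?H\<lparr>carrier := L\<rparr>) q" using y(2) HL by simp
    qed
    then show False using y(1) by blast
  qed
  then have D1: "T.tame_stabilizer = {\<one>\<^bsub>?H\<^esub>}" by simp
  obtain n0 where n0: "n0 \<in> N" "n0 \<noteq> \<one>" using N(2) N.one_closed by blast
  have triv_sub: "{\<one>} \<subseteq> N" and n0': "n0 \<notin> {\<one>}" using n0 by auto
  obtain lam :: "'a \<Rightarrow> int" where lam: "\<And>v. v \<in> N \<Longrightarrow> lam v \<in> {0..<int q}"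
    "\<And>u v. u \<in> N \<Longrightarrow> v \<in> N \<Longrightarrow> lam (u \<otimes> v) = (lam u + lam v) mod int q"
    "\<And>b. b \<in> {\<one>} \<Longrightarrow> lam b = 0" "lam n0 \<noteq> 0"
  proof (rule ex_functional_subgroup[OF fin q(1) Nsub comm Nq triv_subgroup triv_sub n0(1) n0'])
    fix l :: "'a \<Rightarrow> int"
    assume "\<And>v. v \<in> N \<Longrightarrow> l v \<in> {0..<int q}"
      "\<And>u v. u \<in> N \<Longrightarrow> v \<in> N \<Longrightarrow> l (u \<otimes> v) = (l u + l v) mod int q"
      "\<And>b. b \<in> {\<one>} \<Longrightarrow> l b = 0" "l n0 \<noteq> 0"
    then show thesis by (rule that)
  qed
  define \<mu> where "\<mu> n = (\<lambda>m. if m \<in> M then lam (m \<otimes> n \<otimes> inv m) else 0)" for n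
  have mN: "m \<otimes> n \<otimes> inv m \<in> N" if "m \<in> M" "n \<in> N" for m n
    using N.inv_op_closed2[of m n] that by simp
  have \<mu>_fns: "\<mu> n \<in> T.fns" if "n \<in> N" for n
    using lam(1) mN that by (auto simp: \<mu>_def T.fns_def)
  have \<mu>_mult: "\<mu> (n \<otimes> n') = T.fadd (\<mu> n) (\<mu> n')" if n: "n \<in> N" "n' \<in> N" for n n'
  proof -
    have "m \<otimes> (n \<otimes> n') \<otimes> inv m = (m \<otimes> n \<otimes> inv m) \<otimes> (m \<otimes> n' \<otimes> inv m)" if "m \<in> M" for m
      using that n by (simp add: group_simps)
    then show ?thesis using lam(2) mN n by (auto simp: \<mu>_def T.fadd_def)
  qed
  have \<mu>_conj: "\<mu> (m \<otimes> n \<otimes> inv m) = T.rtrans m (\<mu> n)" if m: "m \<in> M" and n: "n \<in> N" for m n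
  proof -
    have "m' \<otimes> (m \<otimes> n \<otimes> inv m) \<otimes> inv m' = (m' \<otimes> m) \<otimes> n \<otimes> inv (m' \<otimes> m)" if "m' \<in> M" for m'
      using that m n by (simp add: group_simps)
    then show ?thesis using m by (auto simp: \<mu>_def T.rtrans_def)
  qed
  have \<mu>_one: "\<mu> \<one> = T.fzero" using lam(3) by (auto simp: \<mu>_def T.fzero_def)
  \<comment> \<open>Every function is tame now, so \<open>\<mu> n0\<close> lies in some good
    \<open>U\<close>. The elements of \<open>N\<close> mapped into \<open>U\<close> form a
    nontrivial normal subgroup of \<open>G\<close>, hence all of \<open>N\<close>.\<close>
  have "\<mu> n0 \<in> T.tame" by (rule T.tame_stabilizer_trivial[OF D1 \<mu>_fns[OF n0(1)]])
  then obtain U where U: "T.good U" "\<mu> n0 \<in> U" by (auto simp: T.tame_def)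
  note UD = T.submoduleD[OF T.good_submodule[OF U(1)]]
  have normal_\<mu>: "{n \<in> N. \<mu> n \<in> W} \<lhd> G" if W: "T.submodule W" for W
  proof (rule normal_of)
    note WD = T.submoduleD[OF W]
    show "subgroup {n \<in> N. \<mu> n \<in> W} G"
    proof (rule finite_closed_subgroup[OF fin])
      show "{n \<in> N. \<mu> n \<in> W} \<subseteq> carrier G" using N.subset by blast
      have "\<one> \<in> {n \<in> N. \<mu> n \<in> W}" using \<mu>_one WD(2) by simp
      then show "{n \<in> N. \<mu> n \<in> W} \<noteq> {}" by blast
      show "a \<otimes> b \<in> {n \<in> N. \<mu> n \<in> W}" if "a \<in> {n \<in> N. \<mu> n \<in> W}" "b \<in> {n \<in> N. \<mu> n \<in> W}" for a b
        using that \<mu>_mult WD(3) by simp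
    qed
    show "n \<otimes> y = y \<otimes> n" if "n \<in> N" "y \<in> {n \<in> N. \<mu> n \<in> W}" for n y using comm that by blast
    show "m \<otimes> y \<otimes> inv m \<in> {n \<in> N. \<mu> n \<in> W}" if "m \<in> M" "y \<in> {n \<in> N. \<mu> n \<in> W}" for m y
      using that mN \<mu>_conj WD(4) by simp
  qed
  have "{n \<in> N. \<mu> n \<in> U} \<noteq> {\<one>}" using n0 U(2) by blast
  then have \<mu>U: "\<mu> n \<in> U" if "n \<in> N" for n
    using minimal[OF normal_\<mu>[OF T.good_submodule[OF U(1)]]] that by blast
  \<comment> \<open>The kernel of \<mu> is normal in \<open>G\<close>; if nontrivial it would
    contain \<open>n0\<close>, on which \<open>lam\<close> does not vanish.\<close>
  have \<mu>_inj: "n = \<one>" if n: "n \<in> N" "\<mu> n = T.fzero" for n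
  proof (rule ccontr)
    assume "n \<noteq> \<one>"
    then have "{n \<in> N. \<mu> n \<in> {T.fzero}} \<noteq> {\<one>}" using n by blast
    from minimal[OF normal_\<mu>[OF T.submodule_zero] this] have "\<mu> n0 = T.fzero" using n0(1) by blast
    then have "\<mu> n0 \<one> = 0" by (simp add: T.fzero_def)
    then show False using lam(4) n0(1) by (simp add: \<mu>_def)
  qed
  define mm where "mm g = (SOME m. m \<in> M \<and> (\<exists>n\<in>N. g = n \<otimes> m))" for g
  have mm: "mm (n \<otimes> m) = m" if nm: "n \<in> N" "m \<in> M" for n m
  proof -
    have "mm (n \<otimes> m) \<in> M \<and> (\<exists>n'\<in>N. n \<otimes> m = n' \<otimes> mm (n \<otimes> m))"
      unfolding mm_def by (rule someI_ex) (use nm in blast)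
    then show ?thesis using factor_unique(2)[OF Nsub Msub triv] nm by metis
  qed
  let ?S = "T.semidirect U"
  \<comment> \<open>The embedding of n m as the pair of \<open>\<mu> n\<close> and m, with
    \<open>mm\<close> extracting the factor in \<open>M\<close>.\<close>
  let ?t = "\<lambda>g. (T.fzero, T.fzero, \<mu> (g \<otimes> inv (mm g)), mm g)"
  have t: "?t (n \<otimes> m) = (T.fzero, T.fzero, \<mu> n, m)" if "n \<in> N" "m \<in> M" for n m
    using mm[OF that] that by (simp add: m_assoc)
  have "?t \<in> hom G ?S"
  proof (rule homI)
    fix g assume g: "g \<in> carrier G"
    then obtain n m where nm: "n \<in> N" "m \<in> M" "g = n \<otimes> m" using decomp by blast
    show "?t g \<in> carrier ?S" unfolding nm(3) t[OF nm(1,2)] using \<mu>U nm by (simp add: T.heis_sub_def)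
    fix g' assume g': "g' \<in> carrier G"
    then obtain n' m' where nm': "n' \<in> N" "m' \<in> M" "g' = n' \<otimes> m'" using decomp by blast
    have mn': "m \<otimes> n' \<otimes> inv m \<in> N" using mN nm nm' by blast
    have "?t (g \<otimes> g') = (T.fzero, T.fzero, \<mu> (n \<otimes> (m \<otimes> n' \<otimes> inv m)), m \<otimes> m')"
      unfolding nm(3) nm'(3) mult[OF nm(1,2) nm'(1,2)] using nm nm' mn' by (intro t) auto
    also have "\<mu> (n \<otimes> (m \<otimes> n' \<otimes> inv m)) = T.fadd (\<mu> n) (T.rtrans m (\<mu> n'))"
      using \<mu>_mult[OF nm(1) mn'] \<mu>_conj[OF nm(2) nm'(1)] by simp
    also have "(T.fzero, T.fzero, T.fadd (\<mu> n) (T.rtrans m (\<mu> n')), m \<otimes> m') = ?t g \<otimes>\<^bsub>?S\<^esub> ?t g'"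
      unfolding nm(3) nm'(3) t[OF nm(1,2)] t[OF nm'(1,2)]
      using \<mu>_fns[OF nm(1)] \<mu>_fns[OF nm'(1)] nm(2) by simp
    finally show "?t (g \<otimes> g') = ?t g \<otimes>\<^bsub>?S\<^esub> ?t g'" .
  qed
  from above_residual_hom[OF this T.good_above_residual[OF U(1)]]
  have "above_residual F G {\<one>}"
  proof (rule above_residual_mono)
    fix g assume g: "g \<in> carrier G" and "g \<in> {x \<in> carrier G. ?t x \<in> {\<one>\<^bsub>?S\<^esub>}}"
    then have t_one: "?t g = \<one>\<^bsub>?S\<^esub>" by blast
    have unit: "\<one>\<^bsub>?S\<^esub> = (T.fzero, T.fzero, T.fzero, \<one>)" by simp
    have one: "?t g = (T.fzero, T.fzero, T.fzero, \<one>)" by (rule trans[OF t_one unit])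
    obtain n m where nm: "n \<in> N" "m \<in> M" "g = n \<otimes> m" using decomp[OF g] by blast
    have "(T.fzero, T.fzero, \<mu> n, m) = (T.fzero, T.fzero, T.fzero, \<one>)"
      by (rule trans[OF t[OF nm(1,2), symmetric] one[unfolded nm(3)]])
    then have "\<mu> n = T.fzero" "m = \<one>" by simp_all
    then show "g \<in> {\<one>}" using \<mu>_inj nm by simp
  qed
  then show False using not_in in_class_above_residual G by blast
qed

lemma in_class_of_normalizer_chains:
  fixes G (structure)
  assumes G: "group G" and fin: "finite (carrier G)" and chains: "normalizer_chains G"
    and primes: "primes_of G \<subseteq> class_primes F"
  shows "in_class G F"
proof (rule ccontr)
  assume not_in: "\<not> in_class G F"
  interpret group G by (rule G)
  let ?R = "residual F G"
  have R: "?R \<lhd> G" "above_residual F G ?R" using residual_above_residual(1)[OF G fin] by auto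
  have "\<not> ?R \<subseteq> {\<one>}"
  proof
    assume "?R \<subseteq> {\<one>}"
    then have "above_residual F G {\<one>}" by (intro above_residual_mono[OF R(2)]) blast
    then show False using not_in in_class_above_residual G by blast
  qed
  then have "{\<one>} \<lhd> G \<and> \<not> ?R \<subseteq> {\<one>}" using one_is_normal by blast
  then obtain K where K: "K \<lhd> G \<and> \<not> ?R \<subseteq> K"
    and Kmax: "\<And>K'. K' \<lhd> G \<and> \<not> ?R \<subseteq> K' \<Longrightarrow> K \<subseteq> K' \<Longrightarrow> K' = K"
    by (rule ex_maximal_subset[OF fin]) (use normal_subset in blast)+
  interpret K: normal K G using K by blast
  let ?Q = "G Mod K" and ?f = "\<lambda>x. K #> x"
  have Q: "group ?Q" by (rule K.factorgroup_is_group)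
  interpret f: group_hom G ?Q ?f
    using K.r_coset_hom_Mod Q by (simp add: group_hom_def group_hom_axioms_def)
  have surj: "?f ` carrier G = carrier ?Q" by (simp add: carrier_FactGroup)
  have finQ: "finite (carrier ?Q)" using fin by (simp add: carrier_FactGroup)
  have KN: "K \<lhd> G" using K by blast
  have ker: "?f x = \<one>\<^bsub>?Q\<^esub> \<longleftrightarrow> x \<in> K" if "x \<in> carrier G" for x
    using coset_eq_iff[OF KN that] by simp
  let ?N = "?f ` ?R"
  have "in_class ?Q F"
  proof (rule in_class_unique_minimal_normal[OF Q finQ])
    show "normalizer_chains ?Q" by (rule normalizer_chains_image[OF G fin chains f.homh surj Q])
    have "order ?Q dvd order G" using hom_card[OF f.homh G Q] surj by (metis dvd_triv_left order_def)
    then show "primes_of ?Q \<subseteq> class_primes F" using primes by (auto simp: primes_of_def dest: dvd_trans)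
    show "?N \<lhd> ?Q" by (rule normal.surj_hom_normal_subgroup[OF R(1) f.group_hom_axioms surj])
    show "?N \<noteq> {\<one>\<^bsub>?Q\<^esub>}"
    proof
      assume "?N = {\<one>\<^bsub>?Q\<^esub>}"
      then have fx: "?f x = \<one>\<^bsub>?Q\<^esub>" if "x \<in> ?R" for x using imageI[OF that, of ?f] by simp
      have "?R \<subseteq> K"
      proof
        fix x assume x: "x \<in> ?R"
        then show "x \<in> K" using ker[of x] fx[OF x] normal_subset[OF R(1)] by blast
      qed
      then show False using K by blast
    qed
    show "above_residual F ?Q ?N"
      using above_residual_image[OF f.homh surj G Q R(2)] by (rule above_residual_mono) blast
    fix Y assume Y: "Y \<lhd> ?Q" "Y \<noteq> {\<one>\<^bsub>?Q\<^esub>}"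
    let ?Y = "{x \<in> carrier G. ?f x \<in> Y}"
    have Y1: "\<one>\<^bsub>?Q\<^esub> \<in> Y" using subgroup.one_closed[OF normal_imp_subgroup[OF Y(1)]] .
    have Yn: "?Y \<lhd> G" by (rule preimage_normal[OF f.homh G Q Y(1)])
    have KY: "K \<subseteq> ?Y"
    proof
      fix x assume x: "x \<in> K"
      then have "?f x = \<one>\<^bsub>?Q\<^esub>" using ker[of x] by simp
      then show "x \<in> ?Y" using x Y1 by simp
    qed
    obtain y where y: "y \<in> Y" "y \<noteq> \<one>\<^bsub>?Q\<^esub>" using Y(2) Y1 by blast
    then have "y \<in> ?f ` carrier G" unfolding surj using normal_subset[OF Y(1)] by blast
    then obtain x where x: "x \<in> carrier G" "y = ?f x" by blast
    then have "x \<in> ?Y" "x \<notin> K" using y ker[of x] by simp_all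
    then have "?Y \<noteq> K" by blast
    \<comment> \<open>By the choice of \<open>K\<close>, a normal subgroup properly above
      \<open>K\<close> contains the residual; so the image of the residual lies in every nontrivial
      normal subgroup of the quotient.\<close>
    then have RY: "?R \<subseteq> ?Y" using Kmax[OF _ KY] Yn by blast
    show "?N \<subseteq> Y"
    proof
      fix z assume "z \<in> ?N"
      then show "z \<in> Y" using RY by blast
    qed
  qed
  then have "above_residual F G K" using in_class_Mod[OF KN] by blast
  then show False using residual_above_residual(2)[OF G fin KN] K by blast
qed

text \<open>All subgroups of \<open>G\<close> belong to the class and have trivial residual, so any
  chain of maximal inclusions will do; it is built upwards from \<open>H\<close> through minimal
  overgroups.\<close>

lemma F_subnormal_in_class:
  fixes G (structure)
  assumes G_in: "in_class G F" and H: "subgroup H G"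
  shows "F_subnormal F H G"
  using H
proof (induction "order G - card H" arbitrary: H rule: less_induct)
  case less
  have G: "group G" using G_in by (simp add: in_class_def)
  interpret group G by (rule G)
  have fin: "finite (carrier G)" by (rule in_class_finite[OF G_in])
  show ?case
  proof (cases "H = carrier G")
    case True
    then show ?thesis
      unfolding F_subnormal_def using subgroup_self
      by (intro exI[of _ "\<lambda>_. carrier G"] exI[of _ 0]) simp
  next
    case False
    let ?P = "\<lambda>K. subgroup K G \<and> H \<subset> K"
    have "?P (carrier G)" using False subgroup.subset[OF less.prems] subgroup_self by blast
    then obtain K where K: "?P K" and Kmin: "\<And>K'. ?P K' \<Longrightarrow> K' \<subseteq> K \<Longrightarrow> K' = K"
      by (rule ex_minimal_subset[OF fin]) (use subgroup.subset in blast)+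
    have Ksub: "subgroup K G" "H \<subseteq> K" using K by auto
    let ?K = "G\<lparr>carrier := K\<rparr>"
    have finK: "finite K" using subgroup_finite[OF fin Ksub(1)] .
    have "card H < card K" using K finK by (auto intro: psubset_card_mono)
    moreover have "card K \<le> order G"
      unfolding order_def by (rule card_mono[OF fin subgroup.subset[OF Ksub(1)]])
    ultimately have "F_subnormal F K G" using less.hyps[OF _ Ksub(1)] by simp
    then obtain C n where C: "C 0 = K" "C n = carrier G" "\<And>i. i \<le> n \<Longrightarrow> subgroup (C i) G"
      "\<And>i. i < n \<Longrightarrow> maximal_subgroup (C i) (G\<lparr>carrier := C (Suc i)\<rparr>) \<and>
        residual F (G\<lparr>carrier := C (Suc i)\<rparr>) \<subseteq> C i"
      unfolding F_subnormal_def by blast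
    have max: "maximal_subgroup H ?K"
      unfolding maximal_subgroup_def
    proof (intro conjI allI impI)
      show "subgroup H ?K" by (rule subgroup_incl[OF less.prems Ksub])
      show "H \<noteq> carrier ?K" using K by auto
      fix K' assume K': "subgroup K' ?K \<and> H \<subseteq> K'"
      then have "subgroup K' G" "K' \<subseteq> K" using incl_subgroup[OF Ksub(1)] subgroup.subset by fastforce+
      then show "K' = H \<or> K' = carrier ?K" using Kmin[of K'] K' by auto
    qed
    have K_in: "in_class ?K F" by (rule in_class_subgroup[OF G_in Ksub(1)])
    then have "residual F ?K \<subseteq> {\<one>\<^bsub>?K\<^esub>}"
      using residual_above_residual(2)[of ?K] in_class_above_residual[of ?K] finK group.one_is_normal[of ?K] by simp
    then have res: "residual F ?K \<subseteq> H" using subgroup.one_closed[OF less.prems] by auto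
    show ?thesis
      unfolding F_subnormal_def
    proof (intro exI[of _ "case_nat H C"] exI[of _ "Suc n"] conjI allI impI)
      show "case_nat H C 0 = H" "case_nat H C (Suc n) = carrier G" using C(2) by simp_all
      show "subgroup (case_nat H C i) G" if "i \<le> Suc n" for i
        using that less.prems C(3) by (cases i) simp_all
      show "maximal_subgroup (case_nat H C i) (G\<lparr>carrier := case_nat H C (Suc i)\<rparr>)" if "i < Suc n" for i
        using that max C(1,4) by (cases i) simp_all
      show "residual F (G\<lparr>carrier := case_nat H C (Suc i)\<rparr>) \<subseteq> case_nat H C i" if "i < Suc n" for i
        using that res C(1,4) by (cases i) simp_all
    qed
  qed
qed

end

theorem theorem3p4:
  fixes F :: "nat monoid set" and G :: "('a, 'b) monoid_scheme"
  assumes "F \<noteq> {}" and "formation F" and "hereditary F" and "saturated F"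
    and "F \<subseteq> L_a1"
    and "group G" and "finite (carrier G)"
  shows "in_class G F \<longleftrightarrow>
    primes_of G \<subseteq> class_primes F \<and>
    (\<forall>p P. prime p \<and> sylow_subgroup p P G \<longrightarrow> strongly_K_F_subnormal F P G)"
proof -
  interpret p_length_one_formation F by unfold_locales (fact assms)+
  interpret group G by fact
  show ?thesis
  proof
    assume G_in: "in_class G F"
    then obtain Q where "Q \<in> F" "G \<cong> Q" by (auto simp: in_class_def)
    then have "primes_of G \<subseteq> class_primes F"
      using iso_same_card[of G Q] by (auto simp: class_primes_def primes_of_def order_def)
    moreover have "strongly_K_F_subnormal F P G" if "sylow_subgroup p P G" for p P
    proof -
      have P: "subgroup P G" using that by (simp add: sylow_subgroup_def)
      then show ?thesis
        using F_subnormal_in_class[OF G_in normalizer_subgroup[OF subgroup.subset[OF P]]]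
        by (simp add: strongly_K_F_subnormal_def)
    qed
    ultimately show "primes_of G \<subseteq> class_primes F \<and>
      (\<forall>p P. prime p \<and> sylow_subgroup p P G \<longrightarrow> strongly_K_F_subnormal F P G)" by blast
  next
    assume A: "primes_of G \<subseteq> class_primes F \<and>
      (\<forall>p P. prime p \<and> sylow_subgroup p P G \<longrightarrow> strongly_K_F_subnormal F P G)"
    have "normalizer_chains G"
      unfolding normalizer_chains_def
    proof (intro allI impI)
      fix p P assume "prime p \<and> sylow_subgroup p P G"
      then have "F_subnormal F (normalizer G P) G" using A by (simp add: strongly_K_F_subnormal_def)
      then show "residual_chain F G (normalizer G P) (carrier G)"
        by (rule F_subnormal_residual_chain[OF assms(6,7)])
    qed
    then show "in_class G F" using in_class_of_normalizer_chains assms(6,7) A by blast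
  qed
qed

end
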